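(* Let $f:\mathbb{R}^n\to\mathbb{R}$ be an integrable log-concave function. For $c\in\Delta_n$ let $g_c(x)=e^{-\Vert x\Vert_{\Delta_n-c}}$. Then for any $c\in\Delta_n$, $$I.rat(f)\leq I.rat(g_c).$$ Furthermore, there is equality if and only if $\frac{f}{\Vert f\Vert_\infty}=g_c\circ T$ for some invertible affine map $T$ and some $c\in\Delta_n$. If moreover $f$ is assumed to be even, then, with $g(x)=e^{-\Vert x\Vert_{B_\infty^n}}$, $$I.rat(f)\leq I.rat(g),$$ with equality if and only if $\frac{f}{\Vert f\Vert_\infty}=g\circ T$ for some linear map $T\in GL(n)$.
   Context: A function $f:\mathbb{R}^n\to\mathbb{R}$ is log-concave if $f=e^{-v}$ with $v:\mathbb{R}^n\to(-\infty,+\infty]$ convex. Integrable log-concave functions are assumed upper semicontinuous with $\int_{\mathbb{R}^n}f>0$, so that the level sets $\{x: f(x)\ge t\Vert f\Vert_\infty\}$, $t\in(0,1)$, are convex bodies, and the one for $t=1$ is nonempty, compact and convex. $\Vert f\Vert_\infty=\sup f$. An ellipsoid is a set $\mathcal{E}=c+TB_2^n$ with $c\in\mathbb{R}^n$, $T\in GL(n)$, where $B_2^n$ is the closed Euclidean unit ball; $\mathcal{E}^a=a\chi_{\mathcal{E}}$ for $a>0$. The John's ellipsoid $\mathcal{E}(f)$ of an integrable log-concave function $f$ is the unique function of the form $\mathcal{E}^{a}$ with $\mathcal{E}^a\le f$ pointwise that has the largest integral $\int_{\mathbb{R}^n}\mathcal{E}^a$ among all such functions. The integral ratio of $f$ is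 $$I.rat(f)=\left(\frac{\int_{\mathbb{R}^n}f(x)\,dx}{\int_{\mathbb{R}^n}\mathcal{E}(f)(x)\,dx}\right)^{1/n}.$$ $\Delta_n$ (also written $\Delta^n$) is the (fixed) regular simplex in $\mathbb{R}^n$ centered at the origin and $B_\infty^n=[-1,1]^n$. For a convex body $K$ containing the origin (possibly on its boundary), $\Vert x\Vert_K=\inf\{\lambda>0:x\in\lambda K\}\in[0,+\infty]$ (with $\inf\emptyset=+\infty$, $e^{-\infty}=0$). *)

theory Defs
  imports "HOL-Analysis.Analysis"
begin

(* The exponential of -t for t in (-infinity, +infinity], with exp (-infinity) = 0.
   Never applied to t = -infinity, where the value is meaningless. *)
definition exp_neg :: "ereal \<Rightarrow> real" where
  "exp_neg t = (if t = \<infinity> then 0 else exp (- real_of_ereal t))"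

(* convex_on does not apply to extended-real-valued functions.  For v > -infinity no
   indeterminate sum occurs, and the ereal convention 0 * infinity = 0 makes the
   endpoints t = 0 and t = 1 harmless. *)
definition convex_ereal :: "('a::real_vector \<Rightarrow> ereal) \<Rightarrow> bool" where
  "convex_ereal v \<longleftrightarrow>
     (\<forall>x y. \<forall>t\<in>{0..1::real}.
        v ((1 - t) *\<^sub>R x + t *\<^sub>R y) \<le> ereal (1 - t) * v x + ereal t * v y)"

definition log_concave :: "('a::real_vector \<Rightarrow> real) \<Rightarrow> bool" where
  "log_concave f \<longleftrightarrow>
     (\<exists>v. (\<forall>x. v x \<noteq> -\<infinity>) \<and> convex_ereal v \<and> f = (\<lambda>x. exp_neg (v x)))"

definition upper_semicont :: "('a::topological_space \<Rightarrow> real) \<Rightarrow> bool" where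
  "upper_semicont f \<longleftrightarrow> (\<forall>x. \<forall>y>f x. eventually (\<lambda>z. f z < y) (nhds x))"

(* Integrable log-concave functions, including the standing assumptions of upper
   semicontinuity and positive integral. *)
definition integrable_log_concave :: "('a::euclidean_space \<Rightarrow> real) \<Rightarrow> bool" where
  "integrable_log_concave f \<longleftrightarrow>
     log_concave f \<and> integrable lborel f \<and> upper_semicont f \<and> 0 < integral\<^sup>L lborel f"

(* Integrable log-concave functions are bounded above, so this is a
   genuine supremum. *)
definition sup_norm :: "('a \<Rightarrow> real) \<Rightarrow> real" where
  "sup_norm f = (SUP x. f x)"

definition ellipsoid :: "(real^'n) set \<Rightarrow> bool" where
  "ellipsoid E \<longleftrightarrow>
     (\<exists>c (T::real^'n^'n). invertible T \<and> E = (\<lambda>u. c + T *v u) ` cball 0 1)"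

definition ellipsoid_functions_below :: "(real^'n \<Rightarrow> real) \<Rightarrow> (real^'n \<Rightarrow> real) set" where
  "ellipsoid_functions_below f =
     {e. (\<exists>a E. a > 0 \<and> ellipsoid E \<and> e = (\<lambda>x. a * indicator E x)) \<and> (\<forall>x. e x \<le> f x)}"

definition john_ellipsoid :: "(real^'n \<Rightarrow> real) \<Rightarrow> (real^'n \<Rightarrow> real)" where
  "john_ellipsoid f =
     (THE e. e \<in> ellipsoid_functions_below f \<and>
        (\<forall>e'\<in>ellipsoid_functions_below f. integral\<^sup>L lborel e' \<le> integral\<^sup>L lborel e))"

definition integral_ratio :: "(real^'n \<Rightarrow> real) \<Rightarrow> real" where
  "integral_ratio f =
     (integral\<^sup>L lborel f / integral\<^sup>L lborel (john_ellipsoid f)) powr (1 / real CARD('n))"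

(* Full-dimensional simplex with all edges of equal length and with centroid at the
   origin; its size and orientation are left open. *)
definition centered_regular_simplex :: "'a::euclidean_space set \<Rightarrow> bool" where
  "centered_regular_simplex S \<longleftrightarrow>
     (\<exists>V. \<not> affine_dependent V \<and> card V = DIM('a) + 1 \<and> S = convex hull V \<and>
        (\<exists>d. \<forall>x\<in>V. \<forall>y\<in>V. x \<noteq> y \<longrightarrow> dist x y = d) \<and> (\<Sum>x\<in>V. x) = 0)"

definition unit_cube :: "(real^'n) set" where
  "unit_cube = {x. \<forall>i. -1 \<le> x $ i \<and> x $ i \<le> 1}"

(* In ereal the infimum of the empty set is infinity. *)
definition minkowski_functional :: "'a::real_vector set \<Rightarrow> 'a \<Rightarrow> ereal" where
  "minkowski_functional K x = Inf (ereal ` {l. l > 0 \<and> x \<in> (\<lambda>y. l *\<^sub>R y) ` K})"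

definition exp_neg_gauge :: "'a::real_vector set \<Rightarrow> 'a \<Rightarrow> real" where
  "exp_neg_gauge K x = exp_neg (minkowski_functional K x)"

end

theory Submission
  imports Defs "HOL-Probability.Probability"
begin

text \<open>
Write \<open>K(u) = {x. exp (- u) \<le> f x}\<close>. Log-concavity says that these convex sets are concave in
\<open>u\<close>: \<open>(1 - t) K(u) + t K(w) \<subseteq> K((1 - t) u + t w)\<close>. A multiple \<open>exp (- u)\<close> of the indicator of an
ellipsoid \<open>E\<close> lies below \<open>f\<close> exactly if \<open>E \<subseteq> K(u)\<close>. Let \<open>E\<^sub>0 \<subseteq> K(u\<^sub>0)\<close> give the largest integral
\<open>exp (- u\<^sub>0) vol E\<^sub>0\<close>. If \<open>E\<close> is any ellipsoid in another level \<open>K(u)\<close>, the ellipsoids that interpolate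
between \<open>E\<^sub>0\<close> and \<open>E\<close> are admissible, so the derivative of their integral at \<open>E\<^sub>0\<close> is not positive. With
the inequality between the arithmetic and the geometric mean this becomes
\<open>vol E \<le> vol E\<^sub>0 (1 + (u - u\<^sub>0) / n)\<^sup>n\<close> (\<open>john_pair_first_order\<close>, \<open>john_pair_ellipsoid_bound\<close>). It also
yields the uniqueness of the maximiser (\<open>john_pair_unique\<close>).

Ball's theorem bounds the volume of a convex body by \<open>\<kappa>\<close> times the volume of the largest ellipsoid in
it, where \<open>\<kappa>\<close> is the value of this quotient for a simplex, or for a cube if the body is symmetric
(\<open>volume_ratio_simplex\<close>, \<open>volume_ratio_cube\<close>). So all the volumes \<open>vol K(u)\<close> lie below one explicit
profile, and integration of \<open>exp (- u) vol K(u)\<close> over \<open>u\<close> gives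
\<open>\<integral> f \<le> \<kappa> (e\<^sup>n n! / n\<^sup>n) \<integral> \<E>(f)\<close> (\<open>integral_ratio_bound\<close>). The levels of \<open>exp (- \<parallel>x\<parallel>\<^sub>K)\<close> are the
dilates \<open>u K\<close>, and for them the same computation is an equality with the volume quotient of \<open>K\<close> in place
of \<open>\<kappa>\<close> (\<open>integral_ratio_conic\<close>), whence the simplex and the cube attain the bound.

Conversely, equality forces \<open>vol K(u)\<close> to be a constant multiple of \<open>(u - u\<^sub>1)\<^sup>n\<close> for \<open>u \<ge> u\<^sub>1\<close>. A homothetic copy of a higher
level that concavity places inside a lower one then has the full volume of the latter, so all levels are
homothetic about one point (\<open>conic_of_profile\<close>), and \<open>f\<close> is a gauge exponential up to a factor and a
translation. Its body attains equality in Ball's theorem.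

Ball's theorem itself: if the unit ball is the largest ellipsoid in \<open>K\<close>, first-order optimality gives unit
vectors \<open>u\<close> normal to hyperplanes that support both \<open>K\<close> and the ball, and weights \<open>c\<^sub>u\<close>, with
\<open>\<Sum> c\<^sub>u u \<otimes> u = I\<close> and \<open>\<Sum> c\<^sub>u u = 0\<close>
(\<open>john_decomposition\<close>). So \<open>K\<close> lies in the polytope \<open>{x. u \<bullet> x \<le> 1}\<close>, whose volume is estimated by the
Brascamp-Lieb inequality. That inequality is proved by transport (\<open>frame_transport\<close>): if \<open>T\<close> moves a density on an
interval to the Gaussian density, then \<open>\<Phi> x = \<Sum> c\<^sub>u T (u \<bullet> x) u\<close> is injective, its Jacobian is at least
\<open>\<Prod> T' (u \<bullet> x) powr c\<^sub>u\<close> and \<open>\<bar>\<Phi> x\<bar>\<^sup>2 \<le> \<Sum> c\<^sub>u T (u \<bullet> x)\<^sup>2\<close>, so that a change of variables compares the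
integral with that of a Gaussian. For symmetric \<open>K\<close> the density is the uniform one on \<open>(-1, 1)\<close>. In general
the frame is lifted to dimension \<open>n + 1\<close>, and the exponential density is integrated over the cone over the
polytope. Equality forces \<open>T (u \<bullet> x) = u \<bullet> \<Phi> x\<close>; differentiating shows that any two of the vectors
(respectively of their lifts) are orthogonal or opposite, which characterises cubes and simplices.
\<close>

section \<open>Lebesgue measure under isometries\<close>

text \<open>Change of variables under linear and under differentiable maps is stated for vectors over a well-ordered
index type. Enumerating an orthonormal basis transfers it to every Euclidean space, such as the product
of \<open>real^'n\<close> and \<open>real\<close> that contains the cone over a polytope.\<close>

typedef (overloaded) ('a::euclidean_space) basis_index = "Basis :: 'a set"
  using nonempty_Basis by blast

lemma CARD_basis_index: "CARD('a::euclidean_space basis_index) = DIM('a)"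
  by (rule type_definition.card[OF type_definition_basis_index])

instance basis_index :: (euclidean_space) finite
proof
  show "finite (UNIV :: 'a basis_index set)"
    unfolding type_definition.univ[OF type_definition_basis_index] by simp
qed

definition basis_rank :: "'a::euclidean_space basis_index \<Rightarrow> nat" where
  "basis_rank = (SOME r. inj r)"

lemma inj_basis_rank: "inj basis_rank"
proof -
  obtain r :: "'a basis_index \<Rightarrow> nat" where "inj r"
    using finite_imp_inj_to_nat_seg[OF finite_class.finite_UNIV] by auto
  then show ?thesis
    unfolding basis_rank_def by (rule someI[of inj])
qed

instantiation basis_index :: (euclidean_space) wellorder
begin
definition less_eq_basis_index :: "'a basis_index \<Rightarrow> 'a basis_index \<Rightarrow> bool" where
  "less_eq_basis_index i j \<longleftrightarrow> basis_rank i \<le> basis_rank j"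
definition less_basis_index :: "'a basis_index \<Rightarrow> 'a basis_index \<Rightarrow> bool" where
  "less_basis_index i j \<longleftrightarrow> basis_rank i < basis_rank j"
instance
proof
  fix P :: "'a basis_index \<Rightarrow> bool" and i
  assume step: "\<And>i. (\<And>j. j < i \<Longrightarrow> P j) \<Longrightarrow> P i"
  show "P i"
    by (induction i rule: measure_induct_rule[of basis_rank])
       (metis less_basis_index_def step)
qed (auto simp: less_eq_basis_index_def less_basis_index_def dest: injD[OF inj_basis_rank])
end

definition cart_coords :: "'a::euclidean_space \<Rightarrow> real^('a basis_index)" where
  "cart_coords x = (\<chi> i. x \<bullet> Rep_basis_index i)"

definition of_cart_coords :: "real^('a basis_index) \<Rightarrow> 'a::euclidean_space" where
  "of_cart_coords y = (\<Sum>i\<in>UNIV. (y $ i) *\<^sub>R Rep_basis_index i)"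

lemma bij_betw_Rep_basis_index: "bij_betw Rep_basis_index UNIV (Basis :: 'a::euclidean_space set)"
  using type_definition.Rep_range[OF type_definition_basis_index]
  by (auto simp: bij_betw_def inj_def Rep_basis_index_inject)

lemma inner_Rep_basis_index:
  "Rep_basis_index i \<bullet> Rep_basis_index j = (if i = j then 1 else 0)"
  using Rep_basis_index[of i] Rep_basis_index[of j]
  by (simp add: inner_Basis Rep_basis_index_inject)

lemma of_cart_coords_cart_coords [simp]: "of_cart_coords (cart_coords x) = x"
  unfolding of_cart_coords_def cart_coords_def
  using sum.reindex_bij_betw[OF bij_betw_Rep_basis_index, of "\<lambda>b. (x \<bullet> b) *\<^sub>R b"]
  by (simp add: euclidean_representation)

lemma cart_coords_of_cart_coords [simp]: "cart_coords (of_cart_coords y) = y"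
  by (simp add: vec_eq_iff of_cart_coords_def cart_coords_def inner_sum_left
      inner_Rep_basis_index if_distrib sum.delta cong: if_cong)

lemma linear_cart_coords: "linear cart_coords"
  by (rule linearI) (auto simp: cart_coords_def vec_eq_iff inner_simps)

lemma linear_of_cart_coords: "linear of_cart_coords"
  by (rule linearI)
     (auto simp: of_cart_coords_def scaleR_add_left sum.distrib scaleR_sum_right)

lemma inner_cart_coords [simp]: "cart_coords x \<bullet> cart_coords y = x \<bullet> y"
  unfolding inner_vec_def cart_coords_def
  using sum.reindex_bij_betw[OF bij_betw_Rep_basis_index, of "\<lambda>b. (x \<bullet> b) * (y \<bullet> b)"]
  by (simp add: euclidean_inner[of x y])

lemma inner_of_cart_coords [simp]: "of_cart_coords x \<bullet> of_cart_coords y = x \<bullet> y"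
  by (metis cart_coords_of_cart_coords inner_cart_coords)

lemma borel_measurable_linear: "linear f \<Longrightarrow> f \<in> borel_measurable borel"
  for f :: "'a::euclidean_space \<Rightarrow> 'b::euclidean_space"
  by (intro borel_measurable_continuous_onI linear_continuous_on linear_conv_bounded_linear[THEN iffD1])

lemma distr_lborel_of_cart_coords:
  "distr lborel borel (of_cart_coords :: _ \<Rightarrow> 'a::euclidean_space) = lborel"
proof (rule lborel_eqI[symmetric])
  fix l u :: 'a
  assume le: "\<And>b. b \<in> Basis \<Longrightarrow> l \<bullet> b \<le> u \<bullet> b"
  have B: "(Basis :: (real^('a basis_index)) set) = range (\<lambda>i. axis i 1)"
    by (auto simp: Basis_vec_def)
  have mem: "of_cart_coords y \<in> box l u \<longleftrightarrow> y \<in> box (cart_coords l) (cart_coords u)" for y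
  proof -
    have "of_cart_coords y \<bullet> Rep_basis_index i = y $ i" for i
      using arg_cong[OF cart_coords_of_cart_coords[of y], of "\<lambda>z. z $ i"]
      by (simp add: cart_coords_def)
    moreover have "(\<forall>b\<in>Basis. P b) \<longleftrightarrow> (\<forall>i. P (Rep_basis_index i))" for P :: "'a \<Rightarrow> bool"
      unfolding bij_betw_imp_surj_on[OF bij_betw_Rep_basis_index, symmetric] by simp
    ultimately show ?thesis
      by (simp add: mem_box(1)[of "of_cart_coords y" l u] mem_box_cart cart_coords_def)
  qed
  have "emeasure (distr lborel borel of_cart_coords) (box l u) =
      emeasure lborel (box (cart_coords l) (cart_coords u))"
    using mem
    by (subst emeasure_distr) (auto simp: borel_measurable_linear linear_of_cart_coords
        intro!: arg_cong[where f="emeasure lborel"])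
  also have "\<dots> = (\<Prod>b\<in>Basis. (cart_coords u - cart_coords l) \<bullet> b)"
    using le[OF Rep_basis_index] by (subst emeasure_lborel_box) (auto simp: B inner_axis cart_coords_def)
  also have "(\<Prod>b\<in>Basis. (cart_coords u - cart_coords l) \<bullet> b) = (\<Prod>i\<in>UNIV. (u - l) \<bullet> Rep_basis_index i)"
    unfolding B by (subst prod.reindex) (auto simp: inj_def axis_eq_axis inner_axis cart_coords_def inner_simps)
  also have "\<dots> = (\<Prod>b\<in>Basis. (u - l) \<bullet> b)"
    by (rule prod.reindex_bij_betw[OF bij_betw_Rep_basis_index])
  finally show "emeasure (distr lborel borel of_cart_coords) (box l u) = (\<Prod>b\<in>Basis. (u - l) \<bullet> b)" .
qed simp

lemma distr_lborel_cart_coords: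
  "distr lborel borel (cart_coords :: 'a::euclidean_space \<Rightarrow> _) = lborel"
proof -
  have "distr (distr lborel borel (of_cart_coords :: _ \<Rightarrow> 'a)) borel cart_coords = distr lborel borel (\<lambda>x. x)"
    by (subst distr_distr)
       (auto simp: o_def borel_measurable_linear linear_of_cart_coords linear_cart_coords)
  also have "\<dots> = lborel"
    by (rule measure_eqI) (auto simp: emeasure_distr)
  finally show ?thesis
    by (simp add: distr_lborel_of_cart_coords)
qed

lemma distr_lborel_orthogonal_transformation_cart:
  fixes Q :: "real^'m::{finite,wellorder} \<Rightarrow> real^'m::_"
  assumes Q: "orthogonal_transformation Q"
  shows "distr lborel borel Q = lborel"
proof (rule lborel_eqI[symmetric])
  fix l u :: "(real, 'm) vec"
  assume le: "\<And>b. b \<in> Basis \<Longrightarrow> l \<bullet> b \<le> u \<bullet> b"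
  have [measurable]: "Q \<in> borel_measurable borel"
    using Q by (simp add: borel_measurable_linear orthogonal_transformation_linear)
  obtain R where R: "orthogonal_transformation R" "\<And>x. R (Q x) = x" "\<And>x. Q (R x) = x"
    using orthogonal_transformation_inv[OF Q] orthogonal_transformation_bij[OF Q]
    by (metis bij_inv_eq_iff)
  have "Q -` box l u = R ` box l u"
    using R by (auto simp: image_iff) metis
  moreover have "R ` box l u \<in> lmeasurable" "measure lebesgue (R ` box l u) = measure lebesgue (box l u)"
    using measurable_orthogonal_image[OF R(1)] measure_orthogonal_image[OF R(1)] by auto
  moreover have "Q -` box l u \<in> sets borel"
    by (metis UNIV_I \<open>Q \<in> borel_measurable borel\<close> borel_open measurable_sets_borel open_box)
  moreover have "emeasure lborel A = ennreal (measure lebesgue A)" if "A \<in> lmeasurable" "A \<in> sets borel"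
    for A :: "(real, 'm) vec set"
    using emeasure_eq_measure2[OF that(1)] that(2) by (simp add: main_part_sets)
  ultimately have "emeasure lborel (Q -` box l u) = emeasure lborel (box l u)"
    by (metis lmeasurable_box borel_open open_box)
  then show "emeasure (distr lborel borel Q) (box l u) = (\<Prod>b\<in>Basis. (u - l) \<bullet> b)"
    using le by (simp add: emeasure_distr)
qed simp

text \<open>Conjugation with the coordinate maps, which preserve both the inner product and Lebesgue measure,
reduces the claim to well-ordered coordinates.\<close>

lemma distr_lborel_orthogonal_transformation:
  fixes Q :: "'a::euclidean_space \<Rightarrow> 'a"
  assumes Q: "orthogonal_transformation Q"
  shows "distr lborel borel Q = lborel"
proof -
  let ?R = "(\<lambda>y. cart_coords (Q (of_cart_coords y))) :: real^'a basis_index \<Rightarrow> real^'a basis_index"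
  have lin: "linear Q" "linear ?R"
    using Q linear_cart_coords linear_of_cart_coords
    using linear_compose[OF linear_compose[OF linear_of_cart_coords], of Q cart_coords]
    by (auto simp: o_def orthogonal_transformation_linear)
  have R: "orthogonal_transformation ?R"
    unfolding orthogonal_transformation_def using lin Q by (simp add: orthogonal_transformation_def)
  have [measurable]: "Q \<in> borel_measurable borel" "?R \<in> borel_measurable borel"
      "(cart_coords :: 'a \<Rightarrow> _) \<in> borel_measurable borel" "(of_cart_coords :: _ \<Rightarrow> 'a) \<in> borel_measurable borel"
    using lin linear_cart_coords linear_of_cart_coords by (auto intro: borel_measurable_linear)
  have "distr (distr (distr lborel borel cart_coords) borel ?R) borel of_cart_coords =
      distr (distr lborel borel (\<lambda>x. ?R (cart_coords x))) borel of_cart_coords"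
    by (subst distr_distr) (auto simp: o_def)
  also have "\<dots> = distr lborel borel (\<lambda>x. of_cart_coords (?R (cart_coords x)))"
    by (subst distr_distr) (auto simp: o_def)
  finally have "distr lborel borel Q = distr (distr (distr lborel borel cart_coords) borel ?R) borel of_cart_coords"
    by simp
  also have "\<dots> = lborel"
    by (simp add: distr_lborel_cart_coords distr_lborel_of_cart_coords
        distr_lborel_orthogonal_transformation_cart[OF R])
  finally show ?thesis .
qed

section \<open>Orthonormal bases and self-adjoint maps\<close>

(* Products with a transposed matrix stay in this form: they are adjoints below. *)
declare transpose_matrix_vector [simp del] vector_transpose_matrix [simp del]

lemma inner_matrix_transpose: "(A *v x) \<bullet> y = x \<bullet> (transpose A *v y)"
  for A :: "real^'n^'m"
  by (simp add: dot_lmul_matrix transpose_matrix_vector inner_commute[of _ y] flip: dot_lmul_matrix)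
     (simp add: inner_commute dot_lmul_matrix)

definition orthobasis :: "('n::finite \<Rightarrow> real^'n) \<Rightarrow> bool" where
  "orthobasis e \<longleftrightarrow> (\<forall>i j. e i \<bullet> e j = (if i = j then 1 else 0))"

text \<open>Every self-adjoint map has this form; all determinants of frame operators and of perturbed ellipsoids
below are read off from the eigenvalues \<open>\<mu>\<close>.\<close>

definition diag_op :: "('n::finite \<Rightarrow> real^'n) \<Rightarrow> ('n \<Rightarrow> real) \<Rightarrow> real^'n \<Rightarrow> real^'n" where
  "diag_op e \<mu> x = (\<Sum>i\<in>UNIV. (\<mu> i * (x \<bullet> e i)) *\<^sub>R e i)"

lemma orthobasis_inner: "orthobasis e \<Longrightarrow> e i \<bullet> e j = (if i = j then 1 else 0)"
  by (simp add: orthobasis_def)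

lemma orthobasis_norm [simp]: "orthobasis e \<Longrightarrow> norm (e i) = 1"
  by (simp add: norm_eq_sqrt_inner orthobasis_inner)

lemma orthobasis_inj: "orthobasis e \<Longrightarrow> inj e"
  by (metis injI orthobasis_inner zero_neq_one)

lemma span_orthobasis:
  fixes e :: "'n::finite \<Rightarrow> real^'n"
  assumes e: "orthobasis e" shows "span (range e) = UNIV"
proof -
  have "pairwise orthogonal (range e)" "0 \<notin> range e"
    using e by (auto simp: pairwise_def orthogonal_def orthobasis_inner)
       (metis orthobasis_inner inner_zero_left zero_neq_one)
  then have "independent (range e)"
    by (rule pairwise_orthogonal_independent)
  moreover have "card (range e) = DIM(real^'n)"
    using orthobasis_inj[OF e] by (simp add: card_image)
  ultimately show ?thesis
    using card_eq_dim[of "range e" UNIV] by auto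
qed

lemma orthobasis_expand:
  assumes e: "orthobasis e" shows "(\<Sum>i\<in>UNIV. (x \<bullet> e i) *\<^sub>R e i) = x"
proof -
  let ?y = "x - (\<Sum>i\<in>UNIV. (x \<bullet> e i) *\<^sub>R e i)"
  have y0: "?y \<bullet> e j = 0" for j
    by (simp add: inner_diff_left inner_sum_left orthobasis_inner[OF e] if_distrib cong: if_cong)
  have "?y \<bullet> z = 0" if "z \<in> span (range e)" for z
    using that by (induction rule: span_induct_alt) (auto simp: inner_add_right y0)
  then have "?y \<bullet> ?y = 0"
    by (simp add: span_orthobasis[OF e])
  then show ?thesis
    by simp
qed

lemma orthobasis_inner_expand:
  assumes e: "orthobasis e" shows "x \<bullet> y = (\<Sum>i\<in>UNIV. (x \<bullet> e i) * (y \<bullet> e i))"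
proof -
  have "x \<bullet> y = (\<Sum>i\<in>UNIV. (x \<bullet> e i) *\<^sub>R e i) \<bullet> y"
    by (simp add: orthobasis_expand[OF e])
  also have "\<dots> = (\<Sum>i\<in>UNIV. (x \<bullet> e i) * (e i \<bullet> y))"
    by (simp add: inner_sum_left)
  finally show ?thesis
    by (simp add: inner_commute[of y])
qed

lemma orthobasis_norm_expand:
  "orthobasis e \<Longrightarrow> (norm x)\<^sup>2 = (\<Sum>i\<in>UNIV. (x \<bullet> e i)\<^sup>2)"
  unfolding power2_norm_eq_inner by (simp add: orthobasis_inner_expand[of e x x] power2_eq_square)

lemma linear_diag_op: "linear (diag_op e \<mu>)"
  by (rule linearI)
     (auto simp: diag_op_def inner_simps algebra_simps sum.distrib scaleR_sum_right)

lemma matrix_diag_op_mult: "matrix (diag_op e \<mu>) *v x = diag_op e \<mu> x"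
  using matrix_vector_mul(2)[OF linear_diag_op] by metis

lemma diag_op_inner:
  "orthobasis e \<Longrightarrow> diag_op e \<mu> x \<bullet> e j = \<mu> j * (x \<bullet> e j)"
  by (simp add: diag_op_def inner_sum_left orthobasis_inner if_distrib cong: if_cong)

lemma orthobasis_eqI: "orthobasis e \<Longrightarrow> (\<And>i. x \<bullet> e i = y \<bullet> e i) \<Longrightarrow> x = y"
  by (metis (no_types, lifting) orthobasis_expand sum.cong)

lemma diag_op_mult:
  "orthobasis e \<Longrightarrow> diag_op e \<mu> (diag_op e \<nu> x) = diag_op e (\<lambda>i. \<mu> i * \<nu> i) x"
  by (rule orthobasis_eqI) (auto simp: diag_op_inner)

lemma diag_op_one: "orthobasis e \<Longrightarrow> diag_op e (\<lambda>_. 1) x = x"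
  by (rule orthobasis_eqI) (auto simp: diag_op_inner)

lemma diag_op_self_adjoint: "orthobasis e \<Longrightarrow> diag_op e \<mu> x \<bullet> y = x \<bullet> diag_op e \<mu> y"
  using orthobasis_inner_expand[of e "diag_op e \<mu> x" y] orthobasis_inner_expand[of e x "diag_op e \<mu> y"]
  by (simp add: diag_op_inner mult.assoc mult.left_commute)

definition basis_matrix :: "('n::finite \<Rightarrow> real^'n) \<Rightarrow> real^'n^'n" where
  "basis_matrix e = (\<chi> i. e i)"

lemma basis_matrix_mult: "basis_matrix e *v x = (\<chi> i. x \<bullet> e i)"
  by (simp add: basis_matrix_def vec_eq_iff matrix_vector_mul_component inner_commute)

lemma transpose_basis_matrix_mult: "transpose (basis_matrix e) *v y = (\<Sum>i\<in>UNIV. (y $ i) *\<^sub>R e i)"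
  by (simp add: vec_eq_iff transpose_def matrix_vector_mult_def basis_matrix_def mult.commute)

lemma orthogonal_basis_matrix:
  assumes e: "orthobasis e" shows "orthogonal_matrix (basis_matrix e)"
proof -
  have "transpose (basis_matrix e) ** basis_matrix e = mat 1"
    by (rule matrix_eq[THEN iffD2])
       (simp add: matrix_vector_mul_assoc[symmetric] basis_matrix_mult transpose_basis_matrix_mult
         orthobasis_expand[OF e])
  then show ?thesis
    by (simp add: orthogonal_matrix)
qed

definition diag_matrix :: "('n::finite \<Rightarrow> real) \<Rightarrow> real^'n^'n" where
  "diag_matrix \<mu> = (\<chi> i j. if i = j then \<mu> i else 0)"

lemma diag_matrix_mult: "diag_matrix \<mu> *v x = (\<chi> i. \<mu> i * x $ i)"
  by (simp add: diag_matrix_def vec_eq_iff matrix_vector_mult_def if_distrib[of "\<lambda>a. a * _"] cong: if_cong)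

lemma det_diag_matrix: "det (diag_matrix \<mu>) = prod \<mu> UNIV"
  by (subst det_diagonal) (auto simp: diag_matrix_def)

lemma matrix_diag_op:
  "matrix (diag_op e \<mu>) = transpose (basis_matrix e) ** diag_matrix \<mu> ** basis_matrix e"
  by (rule matrix_eq[THEN iffD2])
     (simp add: matrix_vector_mul_assoc[symmetric] basis_matrix_mult transpose_basis_matrix_mult
        diag_matrix_mult diag_op_def matrix_diag_op_mult)

lemma det_matrix_diag_op:
  assumes e: "orthobasis e" shows "det (matrix (diag_op e \<mu>)) = prod \<mu> UNIV"
proof -
  have "det (basis_matrix e) * det (basis_matrix e) = 1"
    using det_orthogonal_matrix[OF orthogonal_basis_matrix[OF e]] by auto
  then show ?thesis
    by (simp add: matrix_diag_op det_mul det_diag_matrix)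
qed

text \<open>The quadratic form of \<open>A\<close> attains its maximum over the unit sphere of \<open>S\<close>, and the vanishing of the
first variation at a maximiser is the eigenvector equation.\<close>

lemma self_adjoint_has_eigenvector:
  fixes A :: "'a::euclidean_space \<Rightarrow> 'a"
  assumes S: "subspace S" "S \<noteq> {0}" and lin: "linear A"
    and inv: "\<And>x. x \<in> S \<Longrightarrow> A x \<in> S" and adj: "\<And>x y. A x \<bullet> y = x \<bullet> A y"
  obtains v m where "v \<in> S" "norm v = 1" "A v = m *\<^sub>R v"
proof -
  have contA: "continuous_on X A" for X
    using lin by (simp add: linear_continuous_on linear_conv_bounded_linear)
  obtain w where w: "w \<in> S" "w \<noteq> 0"
    using S subspace_0 by blast
  then have "w /\<^sub>R norm w \<in> sphere 0 1 \<inter> S"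
    using S(1) by (auto simp: subspace_scale)
  then have ne: "sphere 0 1 \<inter> S \<noteq> {}"
    by blast
  have "compact (sphere 0 1 \<inter> S)"
    using closed_subspace[OF S(1)] by (rule compact_Int_closed[OF compact_sphere])
  then obtain v where v: "v \<in> sphere 0 1 \<inter> S" and vmax: "\<And>x. x \<in> sphere 0 1 \<inter> S \<Longrightarrow> A x \<bullet> x \<le> A v \<bullet> v"
    using continuous_attains_sup[OF _ ne continuous_on_inner[OF contA continuous_on_id]] by blast
  define m where "m = A v \<bullet> v"
  have q: "A x \<bullet> x \<le> m * (x \<bullet> x)" if "x \<in> S" for x
  proof (cases "x = 0")
    case False
    have "A (x /\<^sub>R norm x) \<bullet> (x /\<^sub>R norm x) \<le> m"
      unfolding m_def using False that S(1) by (intro vmax) (auto simp: subspace_scale)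
    then have "(A x \<bullet> x) / (norm x)\<^sup>2 \<le> m"
      using lin by (simp add: linear_cmul power2_eq_square divide_simps)
    then show ?thesis
      using False by (simp add: power2_norm_eq_inner divide_simps split: if_splits)
  qed (use lin in \<open>simp add: linear_0\<close>)
  define d where "d = m *\<^sub>R v - A v"
  have dS: "d \<in> S"
    using v inv S(1) by (auto simp: d_def subspace_diff subspace_scale)
  \<comment> \<open>The form \<open>m |x|\<^sup>2 - A x \<bullet> x\<close> is nonnegative on \<open>S\<close> and vanishes at \<open>v\<close>, so its first variation at \<open>v\<close> vanishes.\<close>
  have vary: "0 \<le> 2 * t * (d \<bullet> d) + t\<^sup>2 * (m * (d \<bullet> d) - A d \<bullet> d)" for t
  proof -
    have "A (v + t *\<^sub>R d) \<bullet> (v + t *\<^sub>R d) \<le> m * ((v + t *\<^sub>R d) \<bullet> (v + t *\<^sub>R d))"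
      using v dS S(1) by (intro q) (auto simp: subspace_add subspace_scale)
    moreover have "A d \<bullet> v = d \<bullet> A v" and "v \<bullet> v = 1" "A v \<bullet> v = m" "d \<bullet> v = v \<bullet> d" "A v \<bullet> d = d \<bullet> A v"
      using v adj by (auto simp: m_def inner_commute power2_norm_eq_inner[symmetric])
    moreover have "d \<bullet> d = d \<bullet> (m *\<^sub>R v - A v)"
      by (simp only: d_def)
    then have "d \<bullet> A v = m * (v \<bullet> d) - d \<bullet> d"
      by (simp add: inner_diff_right inner_commute[of d v])
    ultimately show ?thesis
      using lin by (simp add: linear_add linear_cmul inner_simps power2_eq_square algebra_simps)
  qed
  have "d \<bullet> d = 0"
  proof (rule ccontr)
    assume "d \<bullet> d \<noteq> 0"
    then have pos: "d \<bullet> d > 0"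
      by (simp add: order_less_le)
    \<comment> \<open>Such that the quadratic term in \<open>t\<close> is outweighed by the linear one.\<close>
    define C where "C = \<bar>m * (d \<bullet> d) - A d \<bullet> d\<bar> + 1"
    define t where "t = (d \<bullet> d) / C"
    have "C > 0" by (simp add: C_def)
    then have tpos: "t > 0" using pos by (simp add: t_def)
    have "0 \<le> - 2 * t * (d \<bullet> d) + t\<^sup>2 * (m * (d \<bullet> d) - A d \<bullet> d)"
      using vary[of "-t"] by simp
    also have "\<dots> \<le> - 2 * t * (d \<bullet> d) + t\<^sup>2 * C"
      by (intro add_left_mono mult_left_mono) (auto simp: C_def)
    also have "t\<^sup>2 * C = t * (d \<bullet> d)"
      using \<open>C > 0\<close> by (simp add: t_def power2_eq_square)
    finally show False
      using mult_pos_pos[OF tpos pos] by simp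
  qed
  then have "A v = m *\<^sub>R v"
    by (simp add: d_def)
  then show ?thesis
    using v that by auto
qed

text \<open>Induction on the dimension: the orthogonal complement of one eigenvector is again invariant.\<close>

lemma self_adjoint_orthonormal_eigenvectors:
  fixes A :: "'a::euclidean_space \<Rightarrow> 'a"
  assumes "subspace S" and lin: "linear A"
    and "\<And>x. x \<in> S \<Longrightarrow> A x \<in> S" and adj: "\<And>x y. A x \<bullet> y = x \<bullet> A y"
  shows "\<exists>B\<subseteq>S. finite B \<and> card B = dim S \<and> pairwise orthogonal B \<and>
      (\<forall>b\<in>B. norm b = 1 \<and> (\<exists>m. A b = m *\<^sub>R b))"
  using assms(1,3)
proof (induction "dim S" arbitrary: S)
  case 0
  then show ?case by (intro exI[of _ "{}"]) auto
next
  case (Suc k)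
  have "S \<noteq> {0}"
    using Suc(2) by auto
  then obtain v m where v: "v \<in> S" "norm v = 1" "A v = m *\<^sub>R v"
    using self_adjoint_has_eigenvector[OF Suc(3) _ lin Suc(4) adj] by blast
  define S' where "S' = {y \<in> S. \<forall>x\<in>span {v}. orthogonal x y}"
  have S'_eq: "S' = {y \<in> S. v \<bullet> y = 0}"
    by (auto simp: S'_def orthogonal_def span_singleton span_base)
  have sub: "subspace S'"
    using Suc(3) unfolding S'_eq subspace_def by (auto simp: inner_simps)
  have "dim (span {v}) = 1"
    using v(2) by (auto simp: dim_singleton)
  moreover have "dim S' + dim (span {v}) = dim S"
    unfolding S'_def using Suc(3) v(1)
    by (intro dim_subspace_orthogonal_to_vectors) (auto simp: span_minimal)
  ultimately have "k = dim S'"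
    using Suc(2) by simp
  moreover have "A x \<in> S'" if "x \<in> S'" for x
    using that Suc(4) v(3) adj[of v x] by (auto simp: S'_eq)
  ultimately obtain B where B: "B \<subseteq> S'" "finite B" "card B = dim S'" "pairwise orthogonal B"
      "\<forall>b\<in>B. norm b = 1 \<and> (\<exists>m. A b = m *\<^sub>R b)"
    using Suc(1)[of S'] sub by blast
  have "v \<notin> B"
    using B(1) v(2) by (auto simp: S'_eq norm_eq_1)
  show ?case
  proof (intro exI[of _ "insert v B"] conjI)
    show "card (insert v B) = dim S"
      using \<open>v \<notin> B\<close> B(2,3) \<open>k = dim S'\<close> Suc(2) by simp
    show "pairwise orthogonal (insert v B)"
      using B(1,4) by (auto simp: pairwise_insert S'_eq orthogonal_def inner_commute)
  qed (use B v in \<open>auto simp: S'_eq\<close>)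
qed

lemma orthobasis_of_set:
  fixes B :: "(real^'n) set"
  assumes B: "finite B" "card B = CARD('n)" "pairwise orthogonal B" "\<And>b. b \<in> B \<Longrightarrow> norm b = 1"
  obtains e :: "'n \<Rightarrow> real^'n" where "orthobasis e" "range e = B"
proof -
  obtain e :: "'n \<Rightarrow> real^'n" where e: "bij_betw e UNIV B"
    using finite_same_card_bij[of "UNIV :: 'n set" B] B by auto
  then have "inj e" "range e = B"
    by (auto simp: bij_betw_def)
  then have "orthobasis e"
    unfolding orthobasis_def using B(3,4)
    by (auto simp: pairwise_def orthogonal_def inj_def norm_eq_1)
       (metis rangeI)+
  then show ?thesis
    using that \<open>range e = B\<close> by blast
qed

lemma spectral_theorem:
  fixes A :: "real^'n \<Rightarrow> real^'n"
  assumes lin: "linear A" and adj: "\<And>x y. A x \<bullet> y = x \<bullet> A y"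
  obtains e \<mu> where "orthobasis e" "A = diag_op e \<mu>"
proof -
  obtain B where B: "finite B" "card B = CARD('n)" "pairwise orthogonal B"
      "\<forall>b\<in>B. norm b = 1 \<and> (\<exists>m. A b = m *\<^sub>R b)"
    using self_adjoint_orthonormal_eigenvectors[OF subspace_UNIV lin _ adj] by auto
  obtain e :: "'n \<Rightarrow> real^'n" where e: "orthobasis e" "range e = B"
    using orthobasis_of_set[of B] B by blast
  have "\<forall>i. \<exists>m. A (e i) = m *\<^sub>R e i"
    using B(4) e(2) by auto
  then obtain \<mu> where \<mu>: "\<And>i. A (e i) = \<mu> i *\<^sub>R e i"
    by metis
  have "A x = diag_op e \<mu> x" for x
  proof (rule orthobasis_eqI[OF e(1)])
    fix i show "A x \<bullet> e i = diag_op e \<mu> x \<bullet> e i"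
      by (simp add: adj \<mu> diag_op_inner[OF e(1)])
  qed
  then show ?thesis
    using that e(1) by blast
qed

text \<open>The positive factor is the square root of \<open>T ** transpose T\<close>, taken in an eigenbasis of that matrix.\<close>

lemma invertible_matrix_polar:
  fixes T :: "real^'n^'n"
  assumes T: "invertible T"
  obtains e \<mu> Q where "orthobasis e" "\<And>i. \<mu> i > 0" "orthogonal_matrix Q" "T = matrix (diag_op e \<mu>) ** Q"
proof -
  define A where "A x = T *v (transpose T *v x)" for x
  have lin: "linear A"
    unfolding A_def by (rule linearI) (auto simp: matrix_vector_right_distrib matrix_vector_mult_scaleR)
  have T_adj: "(T *v x) \<bullet> y = x \<bullet> (transpose T *v y)" for x y
    by (rule inner_matrix_transpose)
  have adj: "A x \<bullet> y = x \<bullet> A y" for x y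
    by (metis A_def T_adj inner_commute)
  obtain e \<nu> where e: "orthobasis e" and A: "A = diag_op e \<nu>"
    using spectral_theorem[OF lin adj] by blast
  have inj: "transpose T *v x = 0 \<Longrightarrow> x = 0" for x
    using transpose_invertible[OF T] by (metis invertible_def matrix_left_invertible_ker)
  have "\<nu> i > 0" for i
  proof -
    have "\<nu> i = A (e i) \<bullet> e i"
      by (simp add: A diag_op_inner[OF e] orthobasis_inner[OF e])
    also have "\<dots> = (norm (transpose T *v e i))\<^sup>2"
      by (simp add: A_def T_adj power2_norm_eq_inner)
    also have "\<dots> > 0"
      using inj[of "e i"] e by (metis norm_eq_zero orthobasis_norm zero_less_power2 zero_neq_one)
    finally show ?thesis .
  qed
  define \<mu> where "\<mu> i = sqrt (\<nu> i)" for i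
  have \<mu>: "\<mu> i > 0" "\<mu> i * \<mu> i = \<nu> i" for i
    using \<open>\<nu> i > 0\<close> by (auto simp: \<mu>_def)
  define W where "W = matrix (diag_op e (\<lambda>i. 1 / \<mu> i))"
  have W: "W *v x = diag_op e (\<lambda>i. 1 / \<mu> i) x" for x
    by (simp add: W_def matrix_diag_op_mult)
  have tW: "transpose W = W"
  proof -
    have "(transpose W *v x) \<bullet> y = (W *v x) \<bullet> y" for x y
      using inner_matrix_transpose[of W y x] diag_op_self_adjoint[OF e, of "\<lambda>i. 1 / \<mu> i" y x]
      by (simp add: W inner_commute[of _ y])
    then show ?thesis
      by (metis matrix_eq vector_eq_rdot)
  qed
  have WTTW: "(W ** T) ** transpose (W ** T) = mat 1"
  proof (rule matrix_eq[THEN iffD2], rule allI)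
    fix x
    have "((W ** T) ** transpose (W ** T)) *v x = W *v A (W *v x)"
      by (simp add: matrix_transpose_mul tW A_def matrix_vector_mul_assoc matrix_mul_assoc)
    also have "\<dots> = x"
      using \<mu> less_imp_neq[OF \<mu>(1)] by (simp add: W A diag_op_mult[OF e] field_simps diag_op_one[OF e] flip: \<mu>(2))
    finally show "((W ** T) ** transpose (W ** T)) *v x = mat 1 *v x" by simp
  qed
  then have "orthogonal_matrix (W ** T)"
    by (metis orthogonal_matrix_def matrix_left_right_inverse)
  moreover have "T = matrix (diag_op e \<mu>) ** (W ** T)"
  proof (rule matrix_eq[THEN iffD2], rule allI)
    fix x
    have nz: "\<mu> i \<noteq> 0" for i
      using \<mu>(1)[of i] by simp
    show "T *v x = (matrix (diag_op e \<mu>) ** (W ** T)) *v x"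
      by (simp add: matrix_vector_mul_assoc[symmetric] W matrix_diag_op_mult
          diag_op_mult[OF e] nz diag_op_one[OF e])
  qed
  ultimately show ?thesis
    using that e \<mu>(1) by blast
qed

section \<open>Volumes under affine maps\<close>

lemma emeasure_lborel_vimage_isometry:
  fixes Q :: "'a::euclidean_space \<Rightarrow> 'a"
  assumes Q: "orthogonal_transformation Q" and S: "S \<in> sets borel"
  shows "emeasure lborel (Q -` S) = emeasure lborel S"
proof -
  have "Q \<in> borel_measurable borel"
    using Q by (simp add: borel_measurable_linear orthogonal_transformation_linear)
  then have "emeasure (distr lborel borel Q) S = emeasure lborel (Q -` S)"
    using S by (subst emeasure_distr) auto
  then show ?thesis
    by (simp add: distr_lborel_orthogonal_transformation[OF Q])
qed

lemma emeasure_lborel_vimage_diag_matrix: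
  fixes \<mu> :: "'n::finite \<Rightarrow> real"
  assumes \<mu>: "\<And>i. \<mu> i \<noteq> 0" and S: "S \<in> sets borel"
  shows "emeasure lborel S = ennreal \<bar>prod \<mu> UNIV\<bar> * emeasure lborel ((\<lambda>x. diag_matrix \<mu> *v x) -` S)"
proof -
  have B: "(Basis :: (real^'n) set) = range (\<lambda>i. axis i 1)"
    by (auto simp: Basis_vec_def)
  have inj: "inj (\<lambda>i. axis i (1::real))"
    by (auto simp: inj_def axis_eq_axis)
  define c :: "real^'n \<Rightarrow> real" where "c b = \<mu> (THE i. b = axis i 1)" for b
  have c: "c (axis i 1) = \<mu> i" for i
    by (simp add: c_def axis_eq_axis)
  define T :: "real^'n \<Rightarrow> real^'n" where "T x = 0 + (\<Sum>j\<in>Basis. (c j * (x \<bullet> j)) *\<^sub>R j)" for x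
  have "T x = (\<Sum>i\<in>UNIV. (\<mu> i * x $ i) *\<^sub>R axis i 1)" for x
    unfolding T_def B by (subst sum.reindex[OF inj]) (simp add: c inner_axis)
  then have T: "T x = diag_matrix \<mu> *v x" for x
    by (simp add: diag_matrix_mult vec_eq_iff axis_def if_distrib cong: if_cong)
  have [measurable]: "T \<in> borel_measurable borel"
    by (simp add: T_def[abs_def])
  have "lborel = density (distr lborel borel T) (\<lambda>_. (\<Prod>j\<in>Basis. \<bar>c j\<bar>))"
    unfolding T_def by (rule lborel_affine_euclidean) (auto simp: B c \<mu>)
  also have "(\<Prod>j\<in>Basis. \<bar>c j\<bar>) = \<bar>prod \<mu> UNIV\<bar>"
    unfolding B by (subst prod.reindex[OF inj]) (simp add: c abs_prod)
  finally have "emeasure lborel S = emeasure (density (distr lborel borel T) (\<lambda>_. \<bar>prod \<mu> UNIV\<bar>)) S"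
    by simp
  also have "\<dots> = ennreal \<bar>prod \<mu> UNIV\<bar> * emeasure (distr lborel borel T) S"
    using S by (subst emeasure_density_const) auto
  also have "emeasure (distr lborel borel T) S = emeasure lborel (T -` S)"
    using S by (subst emeasure_distr) auto
  finally show ?thesis
    by (simp add: T[abs_def])
qed

lemma sets_borel_vimage_matrix: "S \<in> sets borel \<Longrightarrow> (\<lambda>x. T *v x) -` S \<in> sets borel"
  for T :: "real^'n^'m"
proof -
  have "(\<lambda>x. T *v x) \<in> borel_measurable borel"
    by (intro borel_measurable_linear) simp
  then show "S \<in> sets borel \<Longrightarrow> ?thesis"
    using measurable_sets_borel by blast
qed

text \<open>Polar decomposition and diagonalisation factor \<open>T\<close> into isometries and one rescaling of the coordinates.\<close>

lemma emeasure_lborel_vimage_matrix: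
  fixes T :: "real^'n^'n"
  assumes T: "invertible T" and S: "S \<in> sets borel"
  shows "emeasure lborel S = ennreal \<bar>det T\<bar> * emeasure lborel ((\<lambda>x. T *v x) -` S)"
proof -
  obtain e \<mu> Q where e: "orthobasis e" "\<And>i. \<mu> i > 0" and Q: "orthogonal_matrix Q"
      and TQ: "T = matrix (diag_op e \<mu>) ** Q"
    using invertible_matrix_polar[OF T] by blast
  have nz: "\<mu> i \<noteq> 0" for i
    using e(2)[of i] by simp
  let ?P = "basis_matrix e"
  have P: "orthogonal_matrix (transpose ?P)" "orthogonal_matrix (?P ** Q)"
    using orthogonal_basis_matrix[OF e(1)] Q
    by (auto simp: orthogonal_matrix_transpose orthogonal_matrix_mul)
  have iso: "emeasure lborel ((\<lambda>x. R *v x) -` S) = emeasure lborel S"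
    if "orthogonal_matrix R" "S \<in> sets borel" for R :: "real^'n^'n" and S
    using that by (intro emeasure_lborel_vimage_isometry)
      (auto simp: orthogonal_transformation_matrix matrix_of_matrix_vector_mul)
  let ?S1 = "(\<lambda>x. transpose ?P *v x) -` S" and ?D = "\<lambda>x. diag_matrix \<mu> *v x"
  have T_eq: "T = transpose ?P ** (diag_matrix \<mu> ** (?P ** Q))"
    by (simp add: TQ matrix_diag_op matrix_mul_assoc)
  have "\<bar>det T\<bar> = \<bar>prod \<mu> UNIV\<bar>"
    using det_orthogonal_matrix[OF Q] by (auto simp: TQ det_mul det_matrix_diag_op[OF e(1)])
  moreover have "(\<lambda>x. T *v x) -` S = (\<lambda>x. (?P ** Q) *v x) -` (?D -` ?S1)"
    unfolding T_eq matrix_vector_mul_assoc[symmetric] by auto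
  moreover have "emeasure lborel S = emeasure lborel ?S1"
    using iso[OF P(1) S] by simp
  moreover have S1: "?S1 \<in> sets borel"
    using S by (rule sets_borel_vimage_matrix)
  moreover have "emeasure lborel ?S1 = ennreal \<bar>prod \<mu> UNIV\<bar> * emeasure lborel (?D -` ?S1)"
    by (rule emeasure_lborel_vimage_diag_matrix[OF nz S1])
  moreover have "emeasure lborel ((\<lambda>x. (?P ** Q) *v x) -` (?D -` ?S1)) = emeasure lborel (?D -` ?S1)"
    by (rule iso[OF P(2) sets_borel_vimage_matrix[OF S1]])
  ultimately show ?thesis
    by simp
qed

lemma invertible_matrix_inverse:
  fixes T :: "real^'n^'n"
  assumes "invertible T"
  shows "\<exists>I :: real^'n^'n. invertible I \<and> (\<forall>x. I *v (T *v x) = x) \<and> (\<forall>x. T *v (I *v x) = x)"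
proof -
  obtain I where I: "T ** I = mat 1" "I ** T = mat 1"
    using assms by (auto simp: invertible_def)
  then have "invertible I"
    by (auto simp: invertible_def)
  with I show ?thesis
    by (intro exI[of _ I]) (simp add: matrix_vector_mul_assoc)
qed

lemma
  fixes T :: "real^'n^'n"
  assumes T: "invertible T" and S: "S \<in> sets borel"
  shows sets_borel_affine_image: "(\<lambda>x. c + T *v x) ` S \<in> sets borel"
    and emeasure_affine_image:
      "emeasure lborel ((\<lambda>x. c + T *v x) ` S) = ennreal \<bar>det T\<bar> * emeasure lborel S"
proof -
  obtain I where I: "\<And>x. I *v (T *v x) = x" "\<And>x. T *v (I *v x) = x"
    using invertible_matrix_inverse[OF T] by metis
  have TS: "(\<lambda>x. T *v x) ` S = (\<lambda>x. I *v x) -` S"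
  proof (rule set_eqI)
    show "x \<in> (\<lambda>x. T *v x) ` S \<longleftrightarrow> x \<in> (\<lambda>x. I *v x) -` S" for x
      by (metis I image_iff vimage_eq)
  qed
  have TSb: "(\<lambda>x. T *v x) ` S \<in> sets borel"
    unfolding TS by (rule sets_borel_vimage_matrix[OF S])
  have c: "(\<lambda>x. c + T *v x) ` S = (\<lambda>x. - c + x) -` ((\<lambda>x. T *v x) ` S)"
  proof (rule set_eqI)
    show "x \<in> (\<lambda>x. c + T *v x) ` S \<longleftrightarrow> x \<in> (\<lambda>x. - c + x) -` ((\<lambda>x. T *v x) ` S)" for x
      unfolding vimage_eq image_iff by (simp add: diff_eq_eq add.commute)
  qed
  show "(\<lambda>x. c + T *v x) ` S \<in> sets borel"
    unfolding c using TSb by (intro measurable_sets_borel[of _ borel]) auto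
  have "emeasure lborel ((\<lambda>x. c + T *v x) ` S) = emeasure (distr lborel borel ((+) (- c))) ((\<lambda>x. T *v x) ` S)"
    unfolding c using TSb by (subst emeasure_distr) auto
  also have "\<dots> = emeasure lborel ((\<lambda>x. T *v x) ` S)"
    by (simp add: lborel_distr_plus)
  also have "\<dots> = ennreal \<bar>det T\<bar> * emeasure lborel ((\<lambda>x. T *v x) -` ((\<lambda>x. T *v x) ` S))"
    by (rule emeasure_lborel_vimage_matrix[OF T TSb])
  also have "(\<lambda>x. T *v x) -` ((\<lambda>x. T *v x) ` S) = S"
    by (rule inj_vimage_image_eq) (metis I(1) injI)
  finally show "emeasure lborel ((\<lambda>x. c + T *v x) ` S) = ennreal \<bar>det T\<bar> * emeasure lborel S" .
qed

lemma measure_affine_image: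
  fixes T :: "real^'n^'n"
  assumes "invertible T" "S \<in> sets borel"
  shows "measure lborel ((\<lambda>x. c + T *v x) ` S) = \<bar>det T\<bar> * measure lborel S"
  by (simp add: measure_def emeasure_affine_image[OF assms] enn2real_mult)

text \<open>The dilation is about the origin and precedes the translation: \<open>x\<^sub>0\<close> is the image of the origin, not
the fixed point.\<close>

definition homothety :: "real^'n \<Rightarrow> real \<Rightarrow> real^'n \<Rightarrow> real^'n" where
  "homothety x\<^sub>0 r y = x\<^sub>0 + r *\<^sub>R y"

lemma matrix_scaleR_mult: "matrix ((*\<^sub>R) r) *v x = r *\<^sub>R x" for x :: "real^'n"
  using matrix_vector_mul(2)[of "(*\<^sub>R) r :: real^'n \<Rightarrow> _"] by (metis linear_scaleR)

lemma homothety_matrix: "homothety x\<^sub>0 r = (\<lambda>y. x\<^sub>0 + matrix ((*\<^sub>R) r) *v y)"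
  by (simp add: fun_eq_iff homothety_def matrix_scaleR_mult)

lemma invertible_scaling: "r \<noteq> 0 \<Longrightarrow> invertible (matrix ((*\<^sub>R) r) :: real^'n^'n)"
  by (simp add: invertible_det_nz)

lemma emeasure_homothety:
  fixes S :: "(real^'n) set"
  assumes "r > 0" "S \<in> sets borel"
  shows "emeasure lborel (homothety x\<^sub>0 r ` S) = ennreal (r ^ CARD('n)) * emeasure lborel S"
  using emeasure_affine_image[OF invertible_scaling assms(2), of r x\<^sub>0] assms(1)
  by (simp add: homothety_matrix)

lemma measure_homothety:
  fixes S :: "(real^'n) set"
  assumes "r > 0" "S \<in> sets borel"
  shows "measure lborel (homothety x\<^sub>0 r ` S) = r ^ CARD('n) * measure lborel S"
  using measure_affine_image[OF invertible_scaling assms(2), of r x\<^sub>0] assms(1)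
  by (simp add: homothety_matrix)

section \<open>The Brascamp-Lieb inequality for tight frames\<close>

text \<open>The frame identity \<open>\<Sum> c\<^sub>u u \<otimes> u = I\<close> is the decomposition of the identity that John's theorem attaches to
the contact points of a maximal ellipsoid.\<close>

locale tight_frame =
  fixes S :: "'a::euclidean_space set" and c :: "'a \<Rightarrow> real"
  assumes finite_S: "finite S" and norm_S: "u \<in> S \<Longrightarrow> norm u = 1" and c_pos: "u \<in> S \<Longrightarrow> c u > 0"
    and frame: "(\<Sum>u\<in>S. (c u * (u \<bullet> x)) *\<^sub>R u) = x"
begin

lemma frame_inner: "(\<Sum>u\<in>S. c u * (u \<bullet> x) * (u \<bullet> y)) = x \<bullet> y"
  using arg_cong[OF frame[of x], of "\<lambda>z. z \<bullet> y"] by (simp add: inner_sum_left)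

lemma inner_self_S: "u \<in> S \<Longrightarrow> u \<bullet> u = 1"
  using norm_S by (simp add: norm_eq_1)

lemma sum_c: "(\<Sum>u\<in>S. c u) = DIM('a)"
proof -
  have "real DIM('a) = (\<Sum>b\<in>(Basis::'a set). b \<bullet> b)"
    by (simp add: inner_Basis)
  also have "\<dots> = (\<Sum>b\<in>(Basis::'a set). \<Sum>u\<in>S. c u * (u \<bullet> b) * (u \<bullet> b))"
    by (simp add: frame_inner)
  also have "\<dots> = (\<Sum>u\<in>S. \<Sum>b\<in>(Basis::'a set). c u * (u \<bullet> b) * (u \<bullet> b))"
    by (rule sum.swap)
  also have "\<dots> = (\<Sum>u\<in>S. c u * (u \<bullet> u))"
    by (simp add: euclidean_inner[of u u for u] sum_distrib_left mult.assoc)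
  also have "\<dots> = (\<Sum>u\<in>S. c u)"
    by (intro sum.cong) (auto simp: inner_self_S)
  finally show ?thesis ..
qed

lemma S_nonempty: "S \<noteq> {}"
  using sum_c by auto

text \<open>Pythagoras: \<open>y \<mapsto> (u \<bullet> y)\<^sub>u\<close> embeds the space isometrically into the functions on \<open>S\<close> with weight \<open>c\<close>,
and \<open>t \<mapsto> \<Sum> c\<^sub>u t\<^sub>u u\<close> followed by this embedding is the orthogonal projection onto its range.\<close>

lemma norm_frame_sum:
  fixes t :: "'a \<Rightarrow> real"
  defines "y \<equiv> (\<Sum>u\<in>S. (c u * t u) *\<^sub>R u)"
  shows "(\<Sum>u\<in>S. c u * (t u - u \<bullet> y)\<^sup>2) = (\<Sum>u\<in>S. c u * (t u)\<^sup>2) - (norm y)\<^sup>2"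
proof -
  have "(\<Sum>u\<in>S. c u * t u * (u \<bullet> y)) = y \<bullet> y"
  proof -
    have "(\<Sum>u\<in>S. c u * t u * (u \<bullet> y)) = (\<Sum>u\<in>S. (c u * t u) *\<^sub>R u) \<bullet> y"
      by (simp only: inner_sum_left inner_scaleR_left)
    then show ?thesis
      by (simp only: y_def)
  qed
  moreover have "(\<Sum>u\<in>S. c u * (t u - u \<bullet> y)\<^sup>2) =
      (\<Sum>u\<in>S. c u * (t u)\<^sup>2) - 2 * (\<Sum>u\<in>S. c u * t u * (u \<bullet> y)) + (\<Sum>u\<in>S. c u * (u \<bullet> y) * (u \<bullet> y))"
    by (simp add: sum_distrib_left sum.distrib[symmetric] sum_subtractf[symmetric] power2_eq_square algebra_simps)
  ultimately show ?thesis
    by (simp add: frame_inner power2_norm_eq_inner)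
qed

lemma norm_frame_sum_le:
  "(norm (\<Sum>u\<in>S. (c u * t u) *\<^sub>R u))\<^sup>2 \<le> (\<Sum>u\<in>S. c u * (t u)\<^sup>2)"
proof -
  have "0 \<le> (\<Sum>u\<in>S. c u * (t u - u \<bullet> (\<Sum>u\<in>S. (c u * t u) *\<^sub>R u))\<^sup>2)"
    by (intro sum_nonneg mult_nonneg_nonneg) (auto simp: c_pos less_imp_le)
  then show ?thesis
    unfolding norm_frame_sum by simp
qed

lemma norm_frame_sum_eq:
  assumes "(norm (\<Sum>u\<in>S. (c u * t u) *\<^sub>R u))\<^sup>2 = (\<Sum>u\<in>S. c u * (t u)\<^sup>2)" "w \<in> S"
  shows "t w = w \<bullet> (\<Sum>u\<in>S. (c u * t u) *\<^sub>R u)"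
proof -
  have "(\<Sum>u\<in>S. c u * (t u - u \<bullet> (\<Sum>u\<in>S. (c u * t u) *\<^sub>R u))\<^sup>2) = 0"
    unfolding norm_frame_sum using assms(1) by simp
  then have "\<forall>u\<in>S. c u * (t u - u \<bullet> (\<Sum>u\<in>S. (c u * t u) *\<^sub>R u))\<^sup>2 = 0"
    by (subst (asm) sum_nonneg_eq_0_iff[OF finite_S]) (auto simp: c_pos less_imp_le)
  then have "c w * (t w - w \<bullet> (\<Sum>u\<in>S. (c u * t u) *\<^sub>R u))\<^sup>2 = 0"
    using assms(2) by (rule bspec)
  then show ?thesis
    using c_pos[OF assms(2)] by simp
qed

end

lemma (in tight_frame) tight_frame_image:
  fixes I :: "'a \<Rightarrow> 'b::euclidean_space"
  assumes I: "linear I" "linear K" "\<And>x y. I x \<bullet> I y = x \<bullet> y" "\<And>x. K (I x) = x" "\<And>y. I (K y) = y"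
  shows "tight_frame (I ` S) (\<lambda>u. c (K u))"
proof
  have inj: "inj_on I S"
    using I(4) by (metis inj_on_inverseI)
  show "finite (I ` S)" using finite_S by simp
  show "norm u = 1" "0 < c (K u)" if "u \<in> I ` S" for u
    using that norm_S c_pos I(3,4) by (auto simp: norm_eq_sqrt_inner norm_eq_1)
  fix x
  have "I v \<bullet> x = v \<bullet> K x" for v
    using I(3)[of v "K x"] I(5)[of x] by simp
  then have "(\<Sum>u\<in>I ` S. (c (K u) * (u \<bullet> x)) *\<^sub>R u) = (\<Sum>v\<in>S. (c v * (v \<bullet> K x)) *\<^sub>R I v)"
    by (simp add: sum.reindex[OF inj] I)
  also have "\<dots> = I (\<Sum>v\<in>S. (c v * (v \<bullet> K x)) *\<^sub>R v)"
    using I(1) by (simp add: linear_sum linear_cmul)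
  finally show "(\<Sum>u\<in>I ` S. (c (K u) * (u \<bullet> x)) *\<^sub>R u) = x"
    by (simp add: frame I)
qed

text \<open>The operator is self-adjoint. Its eigenvalue in direction \<open>e k\<close> is the mean of the \<open>l u\<close> with weights
\<open>c u * (u \<bullet> e k)\<^sup>2\<close>, which sum to one, so it is at least the corresponding geometric mean. In the
product over \<open>k\<close> the exponents of \<open>l u\<close> add up to \<open>c u\<close>, because \<open>u\<close> is a unit vector.\<close>

lemma det_frame_operator_ge:
  fixes S :: "(real^'n) set"
  assumes "tight_frame S c" and l: "\<And>u. u \<in> S \<Longrightarrow> l u > 0"
  shows "exp (\<Sum>u\<in>S. c u * ln (l u)) \<le> det (matrix (\<lambda>x. \<Sum>u\<in>S. (c u * l u * (u \<bullet> x)) *\<^sub>R u))"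
proof -
  interpret tight_frame S c by fact
  define A where "A x = (\<Sum>u\<in>S. (c u * l u * (u \<bullet> x)) *\<^sub>R u)" for x
  have lin: "linear A"
    unfolding A_def by (rule linearI) (auto simp: inner_simps algebra_simps sum.distrib scaleR_sum_right)
  have adj: "A x \<bullet> y = x \<bullet> A y" for x y
    by (simp add: A_def inner_sum_left inner_sum_right inner_commute mult_ac)
  obtain e \<mu> where e: "orthobasis e" and A: "A = diag_op e \<mu>"
    using spectral_theorem[OF lin adj] by blast
  define L where "L k = (\<Sum>u\<in>S. c u * (u \<bullet> e k)\<^sup>2 * ln (l u))" for k
  have \<mu>: "exp (L k) \<le> \<mu> k" for k
  proof -
    have a1: "(\<Sum>u\<in>S. c u * (u \<bullet> e k)\<^sup>2) = 1"
      using frame_inner[of "e k" "e k"] by (simp add: power2_eq_square mult.assoc orthobasis_inner[OF e])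
    have "\<mu> k = A (e k) \<bullet> e k"
      by (simp add: A diag_op_inner[OF e] orthobasis_inner[OF e])
    also have "\<dots> = (\<Sum>u\<in>S. c u * (u \<bullet> e k)\<^sup>2 * l u)"
      by (simp add: A_def inner_sum_left power2_eq_square mult_ac)
    finally have "\<mu> k * exp (- L k) = (\<Sum>u\<in>S. c u * (u \<bullet> e k)\<^sup>2 * exp (ln (l u) - L k))"
      using l by (auto simp: sum_distrib_right exp_diff exp_minus divide_inverse intro!: sum.cong)
    also have "\<dots> \<ge> (\<Sum>u\<in>S. c u * (u \<bullet> e k)\<^sup>2 * (1 + (ln (l u) - L k)))"
      using c_pos by (intro sum_mono mult_left_mono) (auto simp: less_imp_le)
    also have "(\<Sum>u\<in>S. c u * (u \<bullet> e k)\<^sup>2 * (1 + (ln (l u) - L k))) =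
        (\<Sum>u\<in>S. c u * (u \<bullet> e k)\<^sup>2) + L k - L k * (\<Sum>u\<in>S. c u * (u \<bullet> e k)\<^sup>2)"
      unfolding L_def sum_distrib_left
      by (simp add: sum.distrib[symmetric] sum_subtractf[symmetric] algebra_simps)
    finally show ?thesis
      unfolding a1 by (simp add: exp_minus divide_simps)
  qed
  have "(\<Sum>u\<in>S. c u * ln (l u)) = (\<Sum>u\<in>S. c u * (u \<bullet> u) * ln (l u))"
    by (intro sum.cong) (auto simp: inner_self_S)
  also have "\<dots> = (\<Sum>u\<in>S. \<Sum>k\<in>UNIV. c u * (u \<bullet> e k)\<^sup>2 * ln (l u))"
    unfolding orthobasis_inner_expand[OF e, of u u for u]
    by (simp add: sum_distrib_left sum_distrib_right power2_eq_square)
  also have "\<dots> = (\<Sum>k\<in>UNIV. L k)"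
    unfolding L_def by (rule sum.swap)
  finally have "exp (\<Sum>u\<in>S. c u * ln (l u)) = (\<Prod>k\<in>UNIV. exp (L k))"
    by (simp add: exp_sum)
  also have "\<dots> \<le> prod \<mu> UNIV"
    by (intro prod_mono) (auto simp: \<mu>)
  also have "\<dots> = det (matrix A)"
    by (simp add: A det_matrix_diag_op[OF e])
  finally show ?thesis
    by (simp add: A_def[abs_def])
qed

definition gaussian :: "'a::euclidean_space \<Rightarrow> real" where
  "gaussian x = (\<Prod>b\<in>Basis. std_normal_density (x \<bullet> b))"

lemma gaussian_eq: "gaussian (x :: 'a::euclidean_space) = (1 / sqrt (2 * pi)) ^ DIM('a) * exp (- (norm x)\<^sup>2 / 2)"
proof -
  have "(\<Sum>b\<in>(Basis::'a set). (x \<bullet> b)\<^sup>2) = (norm x)\<^sup>2"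
    unfolding power2_norm_eq_inner by (simp add: euclidean_inner[of x x] power2_eq_square)
  then show ?thesis
    by (simp add: gaussian_def std_normal_density_def prod.distrib prod_dividef exp_sum[symmetric] power_one_over
        sum_negf sum_divide_distrib[symmetric])
qed

lemma gaussian_pos: "gaussian x > 0"
  by (simp add: gaussian_eq)

lemma continuous_on_gaussian: "continuous_on A gaussian"
  unfolding gaussian_eq by (intro continuous_intros) auto

lemma borel_measurable_gaussian [measurable]: "gaussian \<in> borel_measurable borel"
  by (intro borel_measurable_continuous_onI continuous_on_gaussian)

lemma nn_integral_gaussian: "(\<integral>\<^sup>+x. ennreal (gaussian (x :: 'a::euclidean_space)) \<partial>lborel) = 1"
proof -
  have "(\<integral>\<^sup>+x. ennreal (gaussian (x :: 'a)) \<partial>lborel) =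
      (\<integral>\<^sup>+x. (\<Prod>b\<in>(Basis::'a set). ennreal (std_normal_density (x \<bullet> b))) \<partial>lborel)"
    by (simp add: gaussian_def prod_ennreal)
  also have "\<dots> = (\<Prod>b\<in>(Basis::'a set). (\<integral>\<^sup>+t. ennreal (std_normal_density t) \<partial>lborel))"
    by (rule nn_integral_lborel_prod) auto
  also have "(\<integral>\<^sup>+t. ennreal (std_normal_density t) \<partial>lborel) = 1"
    by (subst nn_integral_eq_integral) auto
  finally show ?thesis by simp
qed

lemma lebesgue_integrable_gaussian: "integrable lebesgue (gaussian :: 'a::euclidean_space \<Rightarrow> real)"
  and lebesgue_integral_gaussian: "integral\<^sup>L lebesgue (gaussian :: 'a \<Rightarrow> real) = 1"
proof -
  have "has_bochner_integral lborel (gaussian :: 'a \<Rightarrow> real) 1"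
    by (rule has_bochner_integral_nn_integral) (auto simp: nn_integral_gaussian gaussian_pos less_imp_le)
  then have "has_bochner_integral lebesgue (gaussian :: 'a \<Rightarrow> real) 1"
    by (simp add: has_bochner_integral_iff integrable_completion integral_completion)
  then show "integrable lebesgue (gaussian :: 'a \<Rightarrow> real)" "integral\<^sup>L lebesgue (gaussian :: 'a \<Rightarrow> real) = 1"
    by (auto simp: has_bochner_integral_iff)
qed

text \<open>The map \<open>T\<close> moves the density \<open>T' * (std_normal_density \<circ> T)\<close> on \<open>J\<close> to the Gaussian one. Applied in all the
frame directions at once, it gives the map \<open>\<Phi>\<close>, which is compared with the Gaussian on the whole space.\<close>

locale frame_transport = tight_frame S c
  for S :: "'a::euclidean_space set" and c +
  fixes J :: "real set" and T T' :: "real \<Rightarrow> real"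
  assumes J: "open J" "is_interval J"
    and T_deriv: "s \<in> J \<Longrightarrow> (T has_real_derivative T' s) (at s)"
    and T'_pos: "s \<in> J \<Longrightarrow> T' s > 0" and T'_cont: "continuous_on J T'"
begin

definition U :: "'a set" where "U = {x. \<forall>u\<in>S. u \<bullet> x \<in> J}"

definition \<Phi> :: "'a \<Rightarrow> 'a" where "\<Phi> x = (\<Sum>u\<in>S. (c u * T (u \<bullet> x)) *\<^sub>R u)"

definition D\<Phi> :: "'a \<Rightarrow> 'a \<Rightarrow> 'a" where "D\<Phi> x h = (\<Sum>u\<in>S. (c u * T' (u \<bullet> x) * (u \<bullet> h)) *\<^sub>R u)"

lemma open_U: "open U"
proof -
  have "open ((\<lambda>x. u \<bullet> x) -` J)" for u :: 'a
    by (intro open_vimage J continuous_intros)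
  moreover have "U = (\<Inter>u\<in>S. (\<lambda>x. u \<bullet> x) -` J)"
    by (auto simp: U_def)
  ultimately show ?thesis
    using finite_S by auto
qed

lemma T_strict_mono:
  assumes "s \<in> J" "t \<in> J" "s < t" shows "T s < T t"
proof (rule DERIV_pos_imp_increasing[OF assms(3)])
  fix x assume "s \<le> x" "x \<le> t"
  then have "x \<in> J"
    using J(2) assms by (meson mem_is_interval_1_I)
  then show "\<exists>y. DERIV T x :> y \<and> y > 0"
    using T_deriv T'_pos by blast
qed

lemma T_cont: "continuous_on J T"
  using T_deriv J(1) by (metis DERIV_isCont continuous_at_imp_continuous_on)

lemma continuous_on_compose_inner:
  assumes "continuous_on J f" "u \<in> S"
  shows "continuous_on U (\<lambda>x. f (u \<bullet> x))"
  by (rule continuous_on_compose2[OF assms(1)]) (use assms(2) in \<open>auto simp: U_def intro!: continuous_intros\<close>)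

lemma \<Phi>_cont: "continuous_on U \<Phi>"
  unfolding \<Phi>_def by (intro continuous_intros continuous_on_compose_inner T_cont)

lemma \<Phi>_deriv:
  assumes "x \<in> U" shows "(\<Phi> has_derivative D\<Phi> x) (at x within X)"
proof -
  have "((\<lambda>x. T (u \<bullet> x)) has_derivative (\<lambda>h. T' (u \<bullet> x) * (u \<bullet> h))) (at x within X)" if "u \<in> S" for u
  proof -
    have "(T has_derivative (*) (T' (u \<bullet> x))) (at (u \<bullet> x))"
      using T_deriv[of "u \<bullet> x"] assms that by (simp add: has_field_derivative_def U_def)
    then show ?thesis
      by (intro has_derivative_compose[of "\<lambda>x. u \<bullet> x" _ _ _ T]) (auto intro!: derivative_eq_intros)
  qed
  then show ?thesis
    unfolding \<Phi>_def D\<Phi>_def by (auto intro!: derivative_eq_intros sum.cong simp: mult.assoc)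
qed

text \<open>\<open>\<Phi>\<close> is strictly monotone: \<open>(\<Phi> x - \<Phi> y) \<bullet> (x - y)\<close> is a sum of nonnegative terms, and it has a
positive one as the frame separates points.\<close>

lemma \<Phi>_inj: "inj_on \<Phi> U"
proof (rule inj_onI, rule ccontr)
  fix x y assume xy: "x \<in> U" "y \<in> U" "\<Phi> x = \<Phi> y" "x \<noteq> y"
  let ?t = "\<lambda>u. c u * ((T (u \<bullet> x) - T (u \<bullet> y)) * (u \<bullet> x - u \<bullet> y))"
  have mono: "(T s - T t) * (s - t) > 0" if "s \<in> J" "t \<in> J" "s \<noteq> t" for s t
    using T_strict_mono[of s t] T_strict_mono[of t s] that
    by (cases "s < t") (auto intro: mult_pos_pos mult_neg_neg)
  have nn: "?t u \<ge> 0" if "u \<in> S" for u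
    using mono[of "u \<bullet> x" "u \<bullet> y"] xy(1,2) c_pos[OF that] that
    by (cases "u \<bullet> x = u \<bullet> y") (auto simp: U_def less_imp_le)
  obtain u where u: "u \<in> S" "u \<bullet> x \<noteq> u \<bullet> y"
    by (metis (no_types, lifting) frame xy(4) sum.cong)
  then have "?t u > 0"
    using mono[of "u \<bullet> x" "u \<bullet> y"] xy(1,2) c_pos[OF u(1)] by (auto simp: U_def)
  then have "0 < (\<Sum>u\<in>S. ?t u)"
    using nn u(1) finite_S by (intro sum_pos2) auto
  also have "\<dots> = (\<Phi> x - \<Phi> y) \<bullet> (x - y)"
    by (simp add: \<Phi>_def inner_diff_left inner_diff_right inner_sum_left sum_subtractf[symmetric] algebra_simps)
  finally show False
    using xy(3) by simp
qed

text \<open>\<open>W\<close> separates the two estimates of the transport argument: it is at most the Jacobian of \<open>\<Phi>\<close> times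
\<open>gaussian \<circ> \<Phi>\<close>, by the determinant inequality for frames, and at least \<open>W0\<close>, by the norm inequality.\<close>

definition W :: "'a \<Rightarrow> real" where
  "W x = exp (\<Sum>u\<in>S. c u * ln (T' (u \<bullet> x))) * gaussian (\<Phi> x)"

text \<open>The integrand of the Brascamp-Lieb inequality: the product over the frame of the transported densities
at \<open>u \<bullet> x\<close>, each to the power \<open>c u\<close>.\<close>

definition W0 :: "'a \<Rightarrow> real" where
  "W0 x = exp (\<Sum>u\<in>S. c u * ln (T' (u \<bullet> x) * std_normal_density (T (u \<bullet> x))))"

lemma W_cont: "continuous_on U W"
  unfolding W_def
  by (intro continuous_intros continuous_on_compose_inner T'_cont continuous_on_compose2[OF continuous_on_gaussian \<Phi>_cont])
     (auto simp: U_def dest!: T'_pos)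

lemma W0_eq:
  assumes "x \<in> U"
  shows "W0 x = exp (\<Sum>u\<in>S. c u * ln (T' (u \<bullet> x))) *
    ((1 / sqrt (2 * pi)) ^ DIM('a) * exp (- (\<Sum>u\<in>S. c u * (T (u \<bullet> x))\<^sup>2) / 2))"
proof -
  let ?K = "1 / sqrt (2 * pi)"
  have "(\<Sum>u\<in>S. c u * ln (T' (u \<bullet> x) * std_normal_density (T (u \<bullet> x)))) =
      (\<Sum>u\<in>S. c u * ln (T' (u \<bullet> x)) + c u * ln ?K + - (c u * (T (u \<bullet> x))\<^sup>2) / 2)"
  proof (rule sum.cong)
    fix u assume "u \<in> S"
    then have "T' (u \<bullet> x) > 0"
      using assms T'_pos by (auto simp: U_def)
    then have *: "ln (T' (u \<bullet> x) * std_normal_density (T (u \<bullet> x))) = ln (T' (u \<bullet> x)) + ln ?K - (T (u \<bullet> x))\<^sup>2 / 2"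
      by (simp add: std_normal_density_def ln_mult ln_div)
    show "c u * ln (T' (u \<bullet> x) * std_normal_density (T (u \<bullet> x))) =
        c u * ln (T' (u \<bullet> x)) + c u * ln ?K + - (c u * (T (u \<bullet> x))\<^sup>2) / 2"
      unfolding * by (simp add: algebra_simps)
  qed simp
  also have "\<dots> = (\<Sum>u\<in>S. c u * ln (T' (u \<bullet> x))) + DIM('a) * ln ?K - (\<Sum>u\<in>S. c u * (T (u \<bullet> x))\<^sup>2) / 2"
    by (simp add: sum.distrib sum_subtractf sum_c flip: sum_distrib_right sum_divide_distrib)
  finally have *: "(\<Sum>u\<in>S. c u * ln (T' (u \<bullet> x) * std_normal_density (T (u \<bullet> x)))) =
      (\<Sum>u\<in>S. c u * ln (T' (u \<bullet> x))) + DIM('a) * ln ?K - (\<Sum>u\<in>S. c u * (T (u \<bullet> x))\<^sup>2) / 2" .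
  have K: "exp (DIM('a) * ln ?K) = ?K ^ DIM('a)"
    by (subst exp_of_nat_mult) simp
  show ?thesis
    unfolding W0_def * by (simp only: diff_conv_add_uminus exp_add K) simp
qed

lemma W0_le: "x \<in> U \<Longrightarrow> W0 x \<le> W x"
  using norm_frame_sum_le[of "\<lambda>u. T (u \<bullet> x)"]
  by (simp add: W0_eq W_def gaussian_eq \<Phi>_def)

lemma W0_eq_W_imp:
  assumes "x \<in> U" "W0 x = W x" "u \<in> S"
  shows "T (u \<bullet> x) = u \<bullet> \<Phi> x"
proof -
  have "(norm (\<Phi> x))\<^sup>2 = (\<Sum>u\<in>S. c u * (T (u \<bullet> x))\<^sup>2)"
    using assms(2) unfolding W0_eq[OF assms(1)] W_def gaussian_eq by simp
  then show ?thesis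
    unfolding \<Phi>_def by (intro norm_frame_sum_eq assms(3)) simp
qed

lemma W0_cont: "continuous_on U W0"
  unfolding W0_def std_normal_density_def
  by (intro continuous_intros continuous_on_compose_inner T'_cont T_cont)
     (auto simp: U_def dest!: T'_pos)

text \<open>Differentiating \<open>T (u \<bullet> x) = u \<bullet> \<Phi> x\<close> shows that \<open>u\<close> is an eigenvector of the self-adjoint map \<open>D\<Phi> x\<close>
with eigenvalue \<open>T' (u \<bullet> x)\<close>, and eigenvectors to different eigenvalues are orthogonal.\<close>

lemma orthogonal_of_distinct_derivatives:
  assumes eq: "\<And>x u. x \<in> U \<Longrightarrow> u \<in> S \<Longrightarrow> T (u \<bullet> x) = u \<bullet> \<Phi> x"
    and "x \<in> U" "u \<in> S" "w \<in> S" "T' (u \<bullet> x) \<noteq> T' (w \<bullet> x)"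
  shows "u \<bullet> w = 0"
proof -
  have D: "T' (v \<bullet> x) * (v \<bullet> h) = v \<bullet> D\<Phi> x h" if "v \<in> S" for v h
  proof -
    have "(T has_derivative (*) (T' (v \<bullet> x))) (at (v \<bullet> x))"
      using T_deriv[of "v \<bullet> x"] assms(2) that by (simp add: has_field_derivative_def U_def)
    then have "((\<lambda>x. T (v \<bullet> x)) has_derivative (\<lambda>h. T' (v \<bullet> x) * (v \<bullet> h))) (at x)"
      by (intro has_derivative_compose[of "\<lambda>x. v \<bullet> x" _ _ _ T]) (auto intro!: derivative_eq_intros)
    then have "((\<lambda>x. v \<bullet> \<Phi> x) has_derivative (\<lambda>h. T' (v \<bullet> x) * (v \<bullet> h))) (at x)"
      by (rule has_derivative_transform_within_open[OF _ open_U assms(2)]) (use eq that in auto)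
    moreover have "((\<lambda>x. v \<bullet> \<Phi> x) has_derivative (\<lambda>h. v \<bullet> D\<Phi> x h)) (at x)"
      by (intro has_derivative_inner_right \<Phi>_deriv assms(2))
    ultimately show ?thesis
      using has_derivative_unique by (metis (no_types))
  qed
  have "u \<bullet> D\<Phi> x w = w \<bullet> D\<Phi> x u"
    by (simp add: D\<Phi>_def inner_sum_right inner_commute mult_ac)
  then have "T' (u \<bullet> x) * (u \<bullet> w) = T' (w \<bullet> x) * (u \<bullet> w)"
    using D[OF assms(3), of w] D[OF assms(4), of u] by (simp add: inner_commute)
  then show ?thesis
    using assms(5) by simp
qed

text \<open>A small step from \<open>x\<close> along the component of \<open>w\<close> orthogonal to \<open>u\<close> changes \<open>w \<bullet> x\<close> but not \<open>u \<bullet> x\<close>, and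
it can be chosen such that the derivatives of \<open>T\<close> at the two values become different.\<close>

lemma orthogonal_of_common_value:
  assumes eq: "\<And>x u. x \<in> U \<Longrightarrow> u \<in> S \<Longrightarrow> T (u \<bullet> x) = u \<bullet> \<Phi> x"
    and nonconst: "\<And>s \<delta>. s \<in> J \<Longrightarrow> \<delta> > 0 \<Longrightarrow> \<exists>r. \<bar>r - s\<bar> < \<delta> \<and> T' r \<noteq> T' s"
    and x: "x \<in> U" and uw: "u \<in> S" "w \<in> S" "u \<noteq> w" "u \<noteq> - w" "u \<bullet> x = w \<bullet> x"
  shows "u \<bullet> w = 0"
proof -
  define h where "h = w - (u \<bullet> w) *\<^sub>R u"
  have uu: "u \<bullet> u = 1" "w \<bullet> w = 1"
    using uw by (auto simp: inner_self_S)
  have uh: "u \<bullet> h = 0"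
    by (simp add: h_def inner_diff_right uu)
  have "h \<noteq> 0"
  proof
    assume "h = 0"
    then have w: "w = (u \<bullet> w) *\<^sub>R u"
      by (simp add: h_def)
    then have "w \<bullet> w = (u \<bullet> w)\<^sup>2"
      by (metis inner_commute inner_scaleR_right power2_eq_square)
    then have "u \<bullet> w = 1 \<or> u \<bullet> w = -1"
      using uu(2) by (simp add: power2_eq_1_iff)
    then show False
      using w uw(3,4) by auto
  qed
  moreover have wh: "w \<bullet> h = h \<bullet> h"
    using uh by (simp add: h_def inner_diff_left inner_commute)
  ultimately have whp: "w \<bullet> h > 0"
    by simp
  obtain \<epsilon> where \<epsilon>: "\<epsilon> > 0" "ball x \<epsilon> \<subseteq> U"
    using open_U x open_contains_ball by blast
  have nh: "norm h > 0"
    using \<open>h \<noteq> 0\<close> by simp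
  obtain r where r: "\<bar>r - u \<bullet> x\<bar> < \<epsilon> / norm h * (w \<bullet> h)" "T' r \<noteq> T' (u \<bullet> x)"
    using nonconst[of "u \<bullet> x" "\<epsilon> / norm h * (w \<bullet> h)"] x uw(1) whp nh \<epsilon>(1) by (auto simp: U_def)
  define d where "d = (r - u \<bullet> x) / (w \<bullet> h)"
  have "\<bar>d\<bar> < \<epsilon> / norm h"
    using r(1) whp by (simp add: d_def abs_divide pos_divide_less_eq)
  then have "x + d *\<^sub>R h \<in> U"
    using \<epsilon>(2) nh by (auto simp: dist_norm pos_less_divide_eq)
  moreover have "u \<bullet> (x + d *\<^sub>R h) = u \<bullet> x" "w \<bullet> (x + d *\<^sub>R h) = r"
    using uh whp uw(5) by (auto simp: inner_add_right d_def)
  ultimately show ?thesis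
    using orthogonal_of_distinct_derivatives[OF eq, of "x + d *\<^sub>R h" u w] uw(1,2) r(2) by auto
qed

end

text \<open>By injectivity of \<open>\<Phi>\<close> the integral of the Jacobian times \<open>gaussian \<circ> \<Phi>\<close> is that of the Gaussian over the
image of \<open>\<Phi>\<close>.\<close>

lemma nn_integral_W_le_1_cart:
  fixes S :: "(real^'m::{finite,wellorder}) set"
  assumes "frame_transport S c J T T'"
  shows "(\<integral>\<^sup>+x. ennreal (indicator (frame_transport.U S J) x * frame_transport.W S c T T' x) \<partial>lborel) \<le> 1"
proof -
  interpret frame_transport S c J T T' by fact
  have U: "U \<in> sets lebesgue"
    using borel_open[OF open_U] by (simp add: sets_completionI_sets)
  define h where "h x = \<bar>det (matrix (D\<Phi> x))\<bar> * gaussian (\<Phi> x)" for x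
  have im: "\<Phi> ` U \<in> sets lebesgue"
    by (rule differentiable_image_in_sets_lebesgue[OF U])
       (auto simp: differentiable_on_def differentiable_def intro: \<Phi>_deriv)
  have g_abs: "gaussian absolutely_integrable_on (\<Phi> ` U)"
    using lebesgue_integrable_gaussian im unfolding set_integrable_def
    by (intro integrable_mult_indicator)
  have g_le: "integral (\<Phi> ` U) gaussian \<le> 1"
  proof -
    have "integral (\<Phi> ` U) gaussian = (LINT x:\<Phi> ` U|lebesgue. gaussian x)"
      by (rule set_lebesgue_integral_eq_integral(2)[symmetric, OF g_abs])
    also have "\<dots> \<le> integral\<^sup>L lebesgue (gaussian :: (real, 'm) vec \<Rightarrow> real)"
      unfolding set_lebesgue_integral_def
      by (rule integral_mono_AE[OF g_abs[unfolded set_integrable_def] lebesgue_integrable_gaussian])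
         (auto simp: indicator_def gaussian_pos less_imp_le)
    finally show ?thesis
      by (simp add: lebesgue_integral_gaussian)
  qed
  have "(\<lambda>x. h x) absolutely_integrable_on U \<and> integral U h = integral (\<Phi> ` U) gaussian"
    using has_absolute_integral_change_of_variables[OF U \<Phi>_deriv \<Phi>_inj,
        of "\<lambda>y. vec (gaussian y) :: real^1" "vec (integral (\<Phi> ` U) gaussian)"] g_abs
    unfolding absolutely_integrable_on_1_iff integral_on_1_eq
    by (simp add: h_def[abs_def] vec_eq_iff)
  then have h: "integrable lebesgue (\<lambda>x. indicator U x * h x)"
      and h_int: "(LINT x:U|lebesgue. h x) = integral (\<Phi> ` U) gaussian"
    using set_lebesgue_integral_eq_integral(2)[of U h]
    by (auto simp: set_integrable_def)
  have "W x \<le> h x" if "x \<in> U" for x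
  proof -
    have "exp (\<Sum>u\<in>S. c u * ln (T' (u \<bullet> x))) \<le> det (matrix (D\<Phi> x))"
      unfolding D\<Phi>_def using that
      by (intro det_frame_operator_ge T'_pos) (unfold_locales, auto simp: U_def)
    then show ?thesis
      unfolding W_def h_def by (intro mult_right_mono) (auto simp: gaussian_pos less_imp_le)
  qed
  then have "(\<integral>\<^sup>+x. ennreal (indicator U x * W x) \<partial>lebesgue) \<le> (\<integral>\<^sup>+x. ennreal (indicator U x * h x) \<partial>lebesgue)"
    by (intro nn_integral_mono ennreal_leI) (auto simp: indicator_def)
  also have "\<dots> = ennreal (\<integral>x. indicator U x * h x \<partial>lebesgue)"
    using h by (intro nn_integral_eq_integral) (auto simp: h_def gaussian_pos less_imp_le)
  also have "\<dots> \<le> 1"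
    using h_int g_le by (simp add: set_lebesgue_integral_def)
  finally show ?thesis
    by (simp add: nn_integral_completion)
qed

context frame_transport
begin

lemma borel_measurable_on_U:
  "continuous_on U f \<Longrightarrow> (\<lambda>x. indicator U x * f x) \<in> borel_measurable borel" for f :: "'a \<Rightarrow> real"
  using borel_measurable_continuous_on_indicator[of U f] open_U by simp

lemma nn_integral_W_le_1: "(\<integral>\<^sup>+x. ennreal (indicator U x * W x) \<partial>lborel) \<le> 1"
proof -
  let ?I = "cart_coords :: 'a \<Rightarrow> _" and ?K = "of_cart_coords :: _ \<Rightarrow> 'a"
  let ?S = "?I ` S" and ?c = "\<lambda>u. c (?K u)"
  have tf: "tight_frame ?S ?c"
    by (rule tight_frame_image) (auto simp: linear_cart_coords linear_of_cart_coords)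
  have ft: "frame_transport ?S ?c J T T'"
    using tf J T_deriv T'_pos T'_cont by (simp add: frame_transport_def frame_transport_axioms_def)
  interpret C: frame_transport ?S ?c J T T' by (rule ft)
  have inj: "inj_on ?I S"
    by (metis inj_on_inverseI of_cart_coords_cart_coords)
  have IK: "?I v \<bullet> y = v \<bullet> ?K y" for v y
    using inner_cart_coords[of v "?K y"] by simp
  have U: "y \<in> C.U \<longleftrightarrow> ?K y \<in> U" for y
    by (auto simp: C.U_def U_def IK)
  have \<Phi>: "C.\<Phi> y = ?I (\<Phi> (?K y))" for y
    by (simp add: C.\<Phi>_def \<Phi>_def sum.reindex[OF inj] IK linear_sum[OF linear_cart_coords] linear_cmul[OF linear_cart_coords])
  have g: "gaussian (?I z) = gaussian z" for z
    by (simp add: gaussian_eq norm_eq_sqrt_inner CARD_basis_index)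
  have W: "C.W y = W (?K y)" for y
    by (simp add: C.W_def W_def sum.reindex[OF inj] IK \<Phi> g)
  have [measurable]: "?K \<in> borel_measurable borel"
    by (intro borel_measurable_linear linear_of_cart_coords)
  have [measurable]: "(\<lambda>x. indicator U x * W x) \<in> borel_measurable borel"
    by (intro borel_measurable_on_U W_cont)
  have "(\<integral>\<^sup>+x. ennreal (indicator U x * W x) \<partial>lborel) =
      (\<integral>\<^sup>+x. ennreal (indicator U x * W x) \<partial>(distr lborel borel ?K))"
    by (simp add: distr_lborel_of_cart_coords)
  also have "\<dots> = (\<integral>\<^sup>+y. ennreal (indicator U (?K y) * W (?K y)) \<partial>lborel)"
    by (subst nn_integral_distr) auto
  also have "\<dots> = (\<integral>\<^sup>+y. ennreal (indicator C.U y * C.W y) \<partial>lborel)"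
    by (intro nn_integral_cong) (simp add: W U indicator_def)
  also have "\<dots> \<le> 1"
    by (rule nn_integral_W_le_1_cart[OF ft])
  finally show ?thesis .
qed

theorem brascamp_lieb: "(\<integral>\<^sup>+x. ennreal (indicator U x * W0 x) \<partial>lborel) \<le> 1"
proof -
  have "(\<integral>\<^sup>+x. ennreal (indicator U x * W0 x) \<partial>lborel) \<le> (\<integral>\<^sup>+x. ennreal (indicator U x * W x) \<partial>lborel)"
    by (intro nn_integral_mono ennreal_leI) (auto simp: indicator_def W0_le)
  with nn_integral_W_le_1 show ?thesis
    by (rule order_trans[rotated])
qed

text \<open>\<open>W0\<close> and \<open>W\<close> are continuous with integral at most one, so a strict inequality at one point would leave a
gap over a whole ball.\<close>

lemma brascamp_lieb_equality:
  assumes eq: "(\<integral>\<^sup>+x. ennreal (indicator U x * W0 x) \<partial>lborel) = 1"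
    and x: "x \<in> U" and u: "u \<in> S"
  shows "T (u \<bullet> x) = u \<bullet> \<Phi> x"
proof (rule W0_eq_W_imp[OF x _ u], rule ccontr)
  assume "W0 x \<noteq> W x"
  then have less: "W0 x < W x"
    using W0_le[OF x] by simp
  define \<epsilon> where "\<epsilon> = (W x - W0 x) / 2"
  have \<epsilon>: "\<epsilon> > 0"
    using less by (simp add: \<epsilon>_def)
  let ?V = "U \<inter> (\<lambda>x. W x - W0 x) -` {\<epsilon><..}"
  have "open ?V"
    by (intro continuous_open_preimage continuous_intros W_cont W0_cont open_U)
  moreover have "x \<in> ?V"
    using x less by (simp add: \<epsilon>_def)
  ultimately obtain r where r: "r > 0" "ball x r \<subseteq> ?V"
    using open_contains_ball by blast
  have [measurable]: "(\<lambda>x. indicator U x * W0 x) \<in> borel_measurable borel"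
    by (intro borel_measurable_on_U W0_cont)
  have "1 + ennreal \<epsilon> * emeasure lborel (ball x r) =
      (\<integral>\<^sup>+y. ennreal (indicator U y * W0 y) + ennreal \<epsilon> * indicator (ball x r) y \<partial>lborel)"
    by (subst nn_integral_add)
       (auto simp: eq nn_integral_cmult_indicator intro!: borel_measurable_times_ennreal borel_measurable_indicator)
  also have "\<dots> \<le> (\<integral>\<^sup>+y. ennreal (indicator U y * W y) \<partial>lborel)"
  proof (rule nn_integral_mono)
    fix y
    show "ennreal (indicator U y * W0 y) + ennreal \<epsilon> * indicator (ball x r) y \<le> ennreal (indicator U y * W y)"
    proof (cases "y \<in> ball x r")
      case True
      then have "y \<in> U" "W0 y + \<epsilon> \<le> W y"
        using r(2) by auto
      moreover have "0 \<le> W0 y"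
        by (simp add: W0_def)
      ultimately show ?thesis
        using True \<epsilon> by (simp add: ennreal_leI flip: ennreal_plus)
    next
      case False
      then show ?thesis
        using W0_le[of y] by (auto simp: indicator_def intro!: ennreal_leI)
    qed
  qed
  also have "\<dots> \<le> 1"
    by (rule nn_integral_W_le_1)
  finally have "ennreal \<epsilon> * emeasure lborel (ball x r) = 0"
    using ennreal_add_left_cancel_le[of 1 "ennreal \<epsilon> * emeasure lborel (ball x r)" 0] by simp
  moreover have "emeasure lborel (ball x r) \<noteq> 0"
  proof
    assume "emeasure lborel (ball x r) = 0"
    then have "measure lborel (ball x r) = 0"
      by (simp add: measure_def)
    then show False
      using r(1) by simp
  qed
  ultimately show False
    using \<epsilon> by simp
qed

end

section \<open>Transporting the uniform and the exponential distribution to the Gaussian\<close>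

definition gauss_cdf :: "real \<Rightarrow> real" where
  "gauss_cdf = cdf std_normal_distribution"

lemma gauss_cdf_diff:
  assumes "a < b"
  shows "gauss_cdf b - gauss_cdf a = integral {a..b} std_normal_density"
proof -
  interpret real_distribution std_normal_distribution
    by (rule real_dist_normal_dist)
  have int: "set_integrable lborel {a<..b} std_normal_density"
    unfolding set_integrable_def by (intro integrable_mult_indicator) auto
  have "gauss_cdf b - gauss_cdf a = measure std_normal_distribution {a<..b}"
    unfolding gauss_cdf_def by (rule cdf_diff_eq[OF assms])
  also have "\<dots> = (\<integral>x. indicator {a<..b} x \<partial>std_normal_distribution)"
    by simp
  also have "\<dots> = (LINT x:{a<..b}|lborel. std_normal_density x)"
    unfolding set_lebesgue_integral_def
    by (subst integral_density) (auto simp: mult.commute)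
  also have "\<dots> = integral {a<..b} std_normal_density"
    by (rule set_borel_integral_eq_integral(2)[OF int])
  also have "\<dots> = integral {a..b} std_normal_density"
  proof (rule integral_subset_negligible)
    have "{a..b} - {a<..b} \<subseteq> {a}"
      by auto
    then show "negligible ({a..b} - {a<..b})"
      by (rule negligible_subset[OF negligible_sing])
  qed auto
  finally show ?thesis .
qed

lemma std_normal_density_pos: "std_normal_density x > 0"
  by (simp add: normal_density_pos)

lemma continuous_on_std_normal_density: "continuous_on A std_normal_density"
  unfolding std_normal_density_def by (intro continuous_intros) auto

lemma gauss_cdf_deriv: "(gauss_cdf has_real_derivative std_normal_density x) (at x)"
proof -
  have "((\<lambda>t. integral {x - 1..t} std_normal_density) has_real_derivative std_normal_density x) (at x within {x - 1..x + 1})"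
    by (rule integral_has_real_derivative[OF continuous_on_std_normal_density]) auto
  then have "((\<lambda>t. integral {x - 1..t} std_normal_density) has_real_derivative std_normal_density x) (at x)"
    by (subst (asm) at_within_interior) (auto simp: interior_atLeastAtMost_real)
  then have "((\<lambda>t. gauss_cdf (x - 1) + integral {x - 1..t} std_normal_density) has_real_derivative std_normal_density x) (at x)"
    by (auto intro!: derivative_eq_intros)
  then show ?thesis
    by (rule has_field_derivative_transform_within_open[of _ _ _ "{x - 1<..}"])
       (auto simp: gauss_cdf_diff[symmetric])
qed

lemma gauss_cdf_strict_mono: "x < y \<Longrightarrow> gauss_cdf x < gauss_cdf y"
  by (erule DERIV_pos_imp_increasing) (blast intro: gauss_cdf_deriv std_normal_density_pos)

lemma gauss_cdf_inj: "inj gauss_cdf"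
  by (rule injI) (metis gauss_cdf_strict_mono less_irrefl linorder_neqE)

lemma gauss_cdf_surj:
  assumes "0 < p" "p < 1"
  shows "\<exists>t. gauss_cdf t = p"
proof -
  interpret real_distribution std_normal_distribution
    by (rule real_dist_normal_dist)
  have "\<forall>\<^sub>F t in at_bot. gauss_cdf t < p" "\<forall>\<^sub>F t in at_top. gauss_cdf t > p"
    unfolding gauss_cdf_def using order_tendstoD(2)[OF cdf_lim_at_bot assms(1)]
      order_tendstoD(1)[OF cdf_lim_at_top_prob assms(2)] by auto
  then obtain a b where ab: "gauss_cdf a < p" "gauss_cdf b > p"
    by (metis eventually_at_bot_linorder eventually_at_top_linorder order_refl)
  then have "a < b"
    using gauss_cdf_strict_mono[of b a] by (cases a b rule: linorder_cases) auto
  then show ?thesis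
    using IVT'[of gauss_cdf a p b] ab
    by (auto intro!: continuous_at_imp_continuous_on DERIV_isCont gauss_cdf_deriv)
qed

definition gauss_quantile :: "real \<Rightarrow> real" where
  "gauss_quantile = inv gauss_cdf"

lemma gauss_quantile_cdf: "gauss_quantile (gauss_cdf t) = t"
  by (simp add: gauss_quantile_def inv_f_f gauss_cdf_inj)

lemma gauss_cdf_quantile: "0 < p \<Longrightarrow> p < 1 \<Longrightarrow> gauss_cdf (gauss_quantile p) = p"
  unfolding gauss_quantile_def by (metis f_inv_into_f gauss_cdf_surj rangeI)

lemma gauss_quantile_deriv:
  assumes p: "0 < p" "p < 1"
  shows "(gauss_quantile has_real_derivative 1 / std_normal_density (gauss_quantile p)) (at p)"
proof -
  let ?t = "gauss_quantile p"
  have "isCont gauss_quantile (gauss_cdf ?t)"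
    by (rule isCont_inverse_function2[of "?t - 1" _ "?t + 1"])
       (auto simp: gauss_quantile_cdf intro!: DERIV_isCont gauss_cdf_deriv)
  then have "isCont gauss_quantile p"
    by (simp add: gauss_cdf_quantile p)
  then have "DERIV gauss_quantile p :> inverse (std_normal_density ?t)"
    using DERIV_inverse_function[OF gauss_cdf_deriv, of gauss_quantile p 0 1] p gauss_cdf_quantile
      std_normal_density_pos[of ?t] by simp
  then show ?thesis
    by (simp add: inverse_eq_divide)
qed

text \<open>The monotone map from the uniform distribution on \<open>(-1, 1)\<close> to the Gaussian one.\<close>

definition unif_transport :: "real \<Rightarrow> real" where
  "unif_transport s = gauss_quantile ((s + 1) / 2)"

definition unif_transport' :: "real \<Rightarrow> real" where
  "unif_transport' s = 1 / (2 * std_normal_density (unif_transport s))"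

lemma unif_transport_deriv:
  "s \<in> {-1<..<1} \<Longrightarrow> (unif_transport has_real_derivative unif_transport' s) (at s)"
  unfolding unif_transport_def[abs_def] unif_transport'_def
  by (rule DERIV_cong, rule DERIV_chain2[OF gauss_quantile_deriv])
     (auto intro!: derivative_eq_intros simp: field_simps)

text \<open>The monotone map from the exponential distribution to the Gaussian one.\<close>

definition exp_transport :: "real \<Rightarrow> real" where
  "exp_transport s = gauss_quantile (1 - exp (- s))"

definition exp_transport' :: "real \<Rightarrow> real" where
  "exp_transport' s = exp (- s) / std_normal_density (exp_transport s)"

lemma exp_transport_deriv:
  "s \<in> {0<..} \<Longrightarrow> (exp_transport has_real_derivative exp_transport' s) (at s)"
  unfolding exp_transport_def[abs_def] exp_transport'_def
  by (rule DERIV_cong, rule DERIV_chain2[OF gauss_quantile_deriv])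
     (auto intro!: derivative_eq_intros simp: field_simps)

lemma frame_transport_unif:
  assumes "tight_frame S c"
  shows "frame_transport S c {-1<..<1} unif_transport unif_transport'"
proof -
  have "continuous_on {-1<..<1} unif_transport"
    using unif_transport_deriv DERIV_isCont by (intro continuous_at_imp_continuous_on) blast
  then have "continuous_on {-1<..<1} (\<lambda>s. std_normal_density (unif_transport s))"
    by (intro continuous_on_compose2[OF continuous_on_std_normal_density]) auto
  then have "continuous_on {-1<..<1} unif_transport'"
    unfolding unif_transport'_def using std_normal_density_pos
    by (intro continuous_intros) (auto simp: less_imp_neq[symmetric])
  then show ?thesis
    using assms unif_transport_deriv
    by (auto simp: frame_transport_def frame_transport_axioms_def is_interval_1 unif_transport'_def std_normal_density_pos)
qed

lemma frame_transport_exp: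
  assumes "tight_frame S c"
  shows "frame_transport S c {0<..} exp_transport exp_transport'"
proof -
  have "continuous_on {0<..} exp_transport"
    using exp_transport_deriv DERIV_isCont by (intro continuous_at_imp_continuous_on) blast
  then have "continuous_on {0<..} (\<lambda>s. std_normal_density (exp_transport s))"
    by (intro continuous_on_compose2[OF continuous_on_std_normal_density]) auto
  then have "continuous_on {0<..} exp_transport'"
    unfolding exp_transport'_def using std_normal_density_pos
    by (intro continuous_intros) (auto simp: less_imp_neq[symmetric])
  then show ?thesis
    using assms exp_transport_deriv
    by (auto simp: frame_transport_def frame_transport_axioms_def is_interval_1 exp_transport'_def std_normal_density_pos)
qed

lemma std_normal_density_eq_iff: "std_normal_density x = std_normal_density y \<longleftrightarrow> x\<^sup>2 = y\<^sup>2"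
  by (simp add: std_normal_density_def)

text \<open>The derivative determines the square of the transport map, and a strictly increasing function takes a
given square at most twice.\<close>

lemma unif_transport'_nonconst:
  assumes s: "s \<in> {-1<..<1}" and "\<delta> > 0"
  shows "\<exists>r. \<bar>r - s\<bar> < \<delta> \<and> unif_transport' r \<noteq> unif_transport' s"
proof (rule ccontr)
  assume "\<not> ?thesis"
  then have const: "unif_transport' r = unif_transport' s" if "\<bar>r - s\<bar> < \<delta>" for r
    using that by blast
  define h where "h = min (\<delta> / 2) (min ((1 - s) / 2) ((s + 1) / 2))"
  have h: "0 < h" "h < \<delta>" "s + h < 1" "-1 < s - h"
    using assms by (auto simp: h_def min_def field_simps)
  have mono: "unif_transport x < unif_transport y" if "-1 < x" "x < y" "y < 1" for x y
  proof (rule DERIV_pos_imp_increasing[OF that(2)])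
    fix z assume "x \<le> z" "z \<le> y"
    then show "\<exists>d. DERIV unif_transport z :> d \<and> d > 0"
      using unif_transport_deriv[of z] that by (auto simp: unif_transport'_def std_normal_density_pos)
  qed
  have sq: "(unif_transport r)\<^sup>2 = (unif_transport s)\<^sup>2" if "\<bar>r - s\<bar> < \<delta>" for r
    using const[OF that] by (simp add: unif_transport'_def std_normal_density_eq_iff)
  have "unif_transport (s - h) < unif_transport s" "unif_transport s < unif_transport (s + h)"
    using h s by (auto intro!: mono)
  moreover have "\<bar>unif_transport (s - h)\<bar> = \<bar>unif_transport s\<bar>" "\<bar>unif_transport (s + h)\<bar> = \<bar>unif_transport s\<bar>"
    using sq[of "s - h"] sq[of "s + h"] h by (auto simp: power2_eq_iff)
  ultimately show False
    by linarith
qed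

text \<open>Where the derivative is constant, the transport map is affine with positive slope. By the formula for
its derivative, its square is then affine as well, which is impossible.\<close>

lemma exp_transport'_nonconst:
  assumes s: "s \<in> {0<..}" and "\<delta> > 0"
  shows "\<exists>r. \<bar>r - s\<bar> < \<delta> \<and> exp_transport' r \<noteq> exp_transport' s"
proof (rule ccontr)
  assume "\<not> ?thesis"
  then have const: "exp_transport' r = exp_transport' s" if "\<bar>r - s\<bar> < \<delta>" for r
    using that by blast
  define k where "k = exp_transport' s"
  define h where "h = min (\<delta> / 2) (s / 2)"
  have h: "0 < h" "h < \<delta>" "0 < s - h"
    using assms by (auto simp: h_def min_def field_simps)
  have kpos: "k > 0"
    by (simp add: k_def exp_transport'_def std_normal_density_pos)
  have lin: "exp_transport r = exp_transport s + k * (r - s)" if r: "r \<in> {s - h..s + h}" for r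
  proof -
    have "((\<lambda>x. exp_transport x - k * x) has_real_derivative 0) (at x within {s - h..s + h})" if "x \<in> {s - h..s + h}" for x
    proof -
      have "(exp_transport has_real_derivative k) (at x)"
        using exp_transport_deriv[of x] const[of x] that h by (auto simp: k_def)
      then have "((\<lambda>x. exp_transport x - k * x) has_real_derivative 0) (at x)"
        by (auto intro!: derivative_eq_intros)
      then show ?thesis
        by (rule has_field_derivative_at_within)
    qed
    then have "\<exists>C. \<forall>x\<in>{s - h..s + h}. exp_transport x - k * x = C"
      by (intro has_field_derivative_zero_constant) auto
    then have "exp_transport r - k * r = exp_transport s - k * s"
      using r h(1) by auto
    then show ?thesis
      by (simp add: algebra_simps)
  qed
  have sq: "(exp_transport r)\<^sup>2 = 2 * r + 2 * ln (k / sqrt (2 * pi))" if "\<bar>r - s\<bar> < \<delta>" for r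
  proof -
    have "exp (- r) = k * std_normal_density (exp_transport r)"
      using const[OF that] std_normal_density_pos[of "exp_transport r"]
      unfolding k_def by (simp add: exp_transport'_def[of r] field_simps)
    also have "\<dots> = exp (ln (k / sqrt (2 * pi)) - (exp_transport r)\<^sup>2 / 2)"
    proof -
      have "exp (ln (k / sqrt (2 * pi)) - y) = k / sqrt (2 * pi) * exp (- y)" for y
        using kpos by (simp add: exp_diff exp_minus divide_inverse)
      from this[of "(exp_transport r)\<^sup>2 / 2"] show ?thesis
        by (simp add: std_normal_density_def)
    qed
    finally show ?thesis
      by simp
  qed
  have "(exp_transport s + k * h)\<^sup>2 = 2 * (s + h) + 2 * ln (k / sqrt (2 * pi))"
    "(exp_transport s - k * h)\<^sup>2 = 2 * (s - h) + 2 * ln (k / sqrt (2 * pi))"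
    "(exp_transport s)\<^sup>2 = 2 * s + 2 * ln (k / sqrt (2 * pi))"
    using lin[of "s + h"] lin[of "s - h"] sq[of "s + h"] sq[of "s - h"] sq[of s] h assms(2) by auto
  moreover have "(x + y)\<^sup>2 + (x - y)\<^sup>2 = 2 * x\<^sup>2 + 2 * y\<^sup>2" for x y :: real
    by (simp add: power2_eq_square algebra_simps)
  from this[of "exp_transport s" "k * h"] have "(exp_transport s + k * h)\<^sup>2 + (exp_transport s - k * h)\<^sup>2 =
      2 * (exp_transport s)\<^sup>2 + 2 * (k * h)\<^sup>2" .
  moreover have "2 * e = 0" if "p = 2 * (s + h) + l" "q = 2 * (s - h) + l" "t = 2 * s + l"
      "p + q = 2 * t + 2 * e" for p q t e l :: real
    using that(4) unfolding that(1-3) by simp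
  ultimately have "2 * (k * h)\<^sup>2 = 0"
    by blast
  then show False
    using kpos h by simp
qed

section \<open>John's decomposition of the identity\<close>

abbreviation unit_ball :: "(real^'n) set" where "unit_ball \<equiv> cball 0 1"

lemma trace_orthobasis:
  fixes H :: "real^'n^'n"
  assumes e: "orthobasis e"
  shows "(\<Sum>k\<in>UNIV. e k \<bullet> (H *v e k)) = trace H"
proof -
  have "trace H = (\<Sum>i\<in>UNIV. axis i 1 \<bullet> (H *v axis i 1))"
    by (simp add: trace_def inner_axis' matrix_vector_mul_component inner_axis)
  also have "\<dots> = (\<Sum>i\<in>UNIV. \<Sum>k\<in>UNIV. (axis i 1 \<bullet> e k) * ((H *v axis i 1) \<bullet> e k))"
    by (simp add: orthobasis_inner_expand[OF e, of "axis i 1" "H *v axis i 1" for i])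
  also have "\<dots> = (\<Sum>k\<in>UNIV. \<Sum>i\<in>UNIV. (e k $ i) * ((transpose H *v e k) $ i))"
    by (subst sum.swap) (simp add: inner_matrix_transpose inner_axis' )
  also have "\<dots> = (\<Sum>k\<in>UNIV. e k \<bullet> (transpose H *v e k))"
    by (simp add: inner_vec_def)
  also have "\<dots> = (\<Sum>k\<in>UNIV. e k \<bullet> (H *v e k))"
    by (simp add: inner_matrix_transpose[symmetric] inner_commute)
  finally show ?thesis ..
qed

definition outer :: "real^'n \<Rightarrow> real^'n^'n" where
  "outer u = (\<chi> i j. u $ i * u $ j)"

lemma outer_mult: "outer u *v x = (u \<bullet> x) *\<^sub>R u"
  by (simp add: outer_def vec_eq_iff matrix_vector_mult_def inner_vec_def sum_distrib_left mult_ac)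

lemma inner_outer: "H \<bullet> outer u = u \<bullet> (H *v u)"
  by (simp add: outer_def inner_vec_def matrix_vector_mult_def sum_distrib_left mult_ac)

lemma inner_mat_1: "H \<bullet> (mat 1 :: real^'n^'n) = trace H"
  by (simp add: inner_vec_def mat_def trace_def if_distrib cong: if_cong)

lemma continuous_on_outer: "continuous_on A outer"
  unfolding outer_def by (intro continuous_intros)

lemma sphere_sequence_limit:
  assumes "\<And>m. norm (\<theta> m :: 'a::euclidean_space) = 1"
  obtains l r where "norm l = 1" "strict_mono (r :: nat \<Rightarrow> nat)" "(\<lambda>m. \<theta> (r m)) \<longlonglongrightarrow> l"
proof -
  have "\<forall>m. \<theta> m \<in> sphere 0 1"
    using assms by simp
  then have "\<exists>l\<in>sphere 0 1. \<exists>r. strict_mono r \<and> (\<theta> \<circ> r) \<longlonglongrightarrow> l"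
    using compact_sphere[of "0::'a" 1] unfolding compact_def by blast
  then show ?thesis
    using that by (auto simp: o_def)
qed

text \<open>For small \<open>\<delta> > 0\<close> the ellipsoid \<open>- \<delta> z + (I - \<delta> A) B\<close> has larger volume than the ball \<open>B\<close>, because the
trace of \<open>A\<close> is negative. So it contains a point outside \<open>K\<close>, which is cut off by a hyperplane with unit
normal \<open>\<theta>\<close>. A limit \<open>u\<close> of the \<open>\<theta>\<close> for \<open>\<delta> \<rightarrow> 0\<close> is normal to a common supporting hyperplane of \<open>K\<close> and \<open>B\<close>,
and the separation inequality, divided by \<open>\<delta>\<close>, turns into the last claim.\<close>

lemma ball_perturbation_not_improving:
  fixes K :: "(real^'n) set" and A :: "real^'n \<Rightarrow> real^'n"
  assumes K: "compact K" "convex K" and B: "unit_ball \<subseteq> K"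
    and max: "\<And>c (T :: real^'n^'n). invertible T \<Longrightarrow> (\<lambda>x. c + T *v x) ` unit_ball \<subseteq> K \<Longrightarrow> \<bar>det T\<bar> \<le> 1"
    and e: "orthobasis e" and A: "A = diag_op e \<mu>" and tr: "sum \<mu> UNIV < 0"
  shows "\<exists>u. norm u = 1 \<and> (\<forall>x\<in>K. u \<bullet> x \<le> 1) \<and> u \<bullet> A u + z \<bullet> u \<le> 0"
proof -
  define T where "T \<delta> = matrix (diag_op e (\<lambda>k. 1 - \<delta> * \<mu> k))" for \<delta>
  have T: "T \<delta> *v x = x - \<delta> *\<^sub>R A x" for \<delta> x
    unfolding T_def matrix_diag_op_mult A
    by (rule orthobasis_eqI[OF e]) (simp add: diag_op_inner[OF e] inner_diff_left algebra_simps)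
  have det_T: "det (T \<delta>) = (\<Prod>k\<in>UNIV. 1 - \<delta> * \<mu> k)" for \<delta>
    by (simp add: T_def det_matrix_diag_op[OF e])
  have "((\<lambda>\<delta>. \<Prod>k\<in>UNIV. 1 - \<delta> * \<mu> k) has_real_derivative
      (\<Sum>k\<in>UNIV. (- \<mu> k) * (\<Prod>j\<in>UNIV - {k}. 1 - 0 * \<mu> j))) (at 0)"
    by (rule has_field_derivative_prod) (auto intro!: derivative_eq_intros)
  then have "((\<lambda>\<delta>. \<Prod>k\<in>UNIV. 1 - \<delta> * \<mu> k) has_real_derivative - sum \<mu> UNIV) (at 0)"
    by (simp add: sum_negf)
  from DERIV_pos_inc_right[OF this] tr obtain d where d: "d > 0"
      "\<And>h. 0 < h \<Longrightarrow> h < d \<Longrightarrow> 1 < (\<Prod>k\<in>UNIV. 1 - h * \<mu> k)"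
    by auto
  have bl: "bounded_linear A"
    by (simp add: A linear_diag_op linear_conv_bounded_linear[symmetric])
  \<comment> \<open>A null sequence in the interval where the determinant exceeds one.\<close>
  define \<delta> where "\<delta> m = d / 2 * inverse (real (Suc m))" for m :: nat
  have \<delta>: "0 < \<delta> m" "\<delta> m < d" for m
    using d(1) by (auto simp: \<delta>_def field_simps add_pos_nonneg)
  have "\<exists>\<theta>. norm \<theta> = 1 \<and> (\<forall>y\<in>K. \<theta> \<bullet> y \<le> - \<delta> m * (z \<bullet> \<theta>) + norm (\<theta> - \<delta> m *\<^sub>R A \<theta>))" for m
  proof -
    have "det (T (\<delta> m)) > 1"
      using d(2)[OF \<delta>] by (simp add: det_T)
    moreover from this have "invertible (T (\<delta> m))"
      by (simp add: invertible_det_nz)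
    ultimately have "\<not> (\<lambda>x. - \<delta> m *\<^sub>R z + T (\<delta> m) *v x) ` unit_ball \<subseteq> K"
      using max[of "T (\<delta> m)" "- \<delta> m *\<^sub>R z"] by auto
    then obtain w where "w \<in> unit_ball" and w_out: "- \<delta> m *\<^sub>R z + T (\<delta> m) *v w \<notin> K"
      by blast
    then have w: "norm w \<le> 1"
      by simp
    define x where "x = - \<delta> m *\<^sub>R z + T (\<delta> m) *v w"
    obtain a b where ab: "a \<bullet> x < b" "\<forall>y\<in>K. a \<bullet> y > b"
      using separating_hyperplane_closed_point[OF K(2) compact_imp_closed[OF K(1)], of x] w_out unfolding x_def by blast
    have "a \<noteq> 0"
      using ab B by (metis centre_in_cball inner_zero_left less_asym subsetD zero_le_one)
    define \<theta> where "\<theta> = - (a /\<^sub>R norm a)"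
    have n\<theta>: "norm \<theta> = 1"
      using \<open>a \<noteq> 0\<close> by (simp add: \<theta>_def)
    have "A \<theta> \<bullet> w = \<theta> \<bullet> A w"
      by (simp add: A diag_op_self_adjoint[OF e])
    then have "\<theta> \<bullet> x = - \<delta> m * (z \<bullet> \<theta>) + (\<theta> - \<delta> m *\<^sub>R A \<theta>) \<bullet> w"
      by (simp add: x_def T inner_simps inner_commute)
    also have "(\<theta> - \<delta> m *\<^sub>R A \<theta>) \<bullet> w \<le> norm (\<theta> - \<delta> m *\<^sub>R A \<theta>) * norm w"
      by (rule norm_cauchy_schwarz)
    also have "\<dots> \<le> norm (\<theta> - \<delta> m *\<^sub>R A \<theta>)"
      using w by (simp add: mult_left_le)
    finally have x\<theta>: "\<theta> \<bullet> x \<le> - \<delta> m * (z \<bullet> \<theta>) + norm (\<theta> - \<delta> m *\<^sub>R A \<theta>)"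
      by simp
    have "\<theta> \<bullet> y \<le> \<theta> \<bullet> x" if "y \<in> K" for y
    proof -
      have "a \<bullet> x \<le> a \<bullet> y"
        using ab that by fastforce
      then have "(a \<bullet> x) / norm a \<le> (a \<bullet> y) / norm a"
        by (rule divide_right_mono) simp
      then show ?thesis
        by (simp add: \<theta>_def divide_inverse mult.commute)
    qed
    then show ?thesis
      using n\<theta> x\<theta> by (intro exI[of _ \<theta>]) (auto intro: order_trans)
  qed
  then obtain \<theta> where \<theta>: "\<And>m. norm (\<theta> m) = 1"
      "\<And>m y. y \<in> K \<Longrightarrow> \<theta> m \<bullet> y \<le> - \<delta> m * (z \<bullet> \<theta> m) + norm (\<theta> m - \<delta> m *\<^sub>R A (\<theta> m))"
    by metis
  obtain u r where u: "norm u = 1" "strict_mono r" "(\<lambda>m. \<theta> (r m)) \<longlonglongrightarrow> u"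
    using sphere_sequence_limit[of \<theta>] \<theta>(1) by blast
  have "(\<lambda>m. \<delta> m) \<longlonglongrightarrow> d / 2 * 0"
    unfolding \<delta>_def by (intro tendsto_intros LIMSEQ_inverse_real_of_nat)
  then have \<delta>r: "(\<lambda>m. \<delta> (r m)) \<longlonglongrightarrow> 0"
    using LIMSEQ_subseq_LIMSEQ[OF _ u(2), of \<delta> 0] by (simp add: o_def)
  have A\<theta>: "(\<lambda>m. A (\<theta> (r m))) \<longlonglongrightarrow> A u"
    by (rule bounded_linear.tendsto[OF bl u(3)])
  have "u \<bullet> x \<le> 1" if "x \<in> K" for x
  proof (rule LIMSEQ_le)
    show "(\<lambda>m. \<theta> (r m) \<bullet> x) \<longlonglongrightarrow> u \<bullet> x"
      by (intro tendsto_intros u)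
    have "(\<lambda>m. - \<delta> (r m) * (z \<bullet> \<theta> (r m)) + norm (\<theta> (r m) - \<delta> (r m) *\<^sub>R A (\<theta> (r m)))) \<longlonglongrightarrow>
        - 0 * (z \<bullet> u) + norm (u - 0 *\<^sub>R A u)"
      by (intro tendsto_intros u \<delta>r A\<theta>)
    then show "(\<lambda>m. - \<delta> (r m) * (z \<bullet> \<theta> (r m)) + norm (\<theta> (r m) - \<delta> (r m) *\<^sub>R A (\<theta> (r m)))) \<longlonglongrightarrow> 1"
      by (simp add: u)
  qed (use \<theta>(2)[OF that] in auto)
  moreover have "u \<bullet> A u + z \<bullet> u \<le> 0"
  proof (rule LIMSEQ_le)
    show "(\<lambda>m. \<theta> (r m) \<bullet> A (\<theta> (r m)) + z \<bullet> \<theta> (r m)) \<longlonglongrightarrow> u \<bullet> A u + z \<bullet> u"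
      by (intro tendsto_intros u A\<theta>)
    have "(\<lambda>m. \<delta> (r m) * (norm (A (\<theta> (r m))))\<^sup>2 / 2) \<longlonglongrightarrow> 0 * (norm (A u))\<^sup>2 / 2"
      by (intro tendsto_intros u \<delta>r A\<theta>) auto
    then show "(\<lambda>m. \<delta> (r m) * (norm (A (\<theta> (r m))))\<^sup>2 / 2) \<longlonglongrightarrow> 0"
      by simp
    have "\<theta> m \<bullet> A (\<theta> m) + z \<bullet> \<theta> m \<le> \<delta> m * (norm (A (\<theta> m)))\<^sup>2 / 2" for m
    proof -
      let ?t = "\<theta> m" and ?d = "\<delta> m"
      define q where "q = 2 * ?d * (?t \<bullet> A ?t) - ?d\<^sup>2 * (norm (A ?t))\<^sup>2"
      have tt: "?t \<bullet> ?t = 1"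
        using \<theta>(1)[of m] by (simp add: norm_eq_1)
      have *: "(norm (?t - ?d *\<^sub>R A ?t))\<^sup>2 = 1 - q"
      proof -
        have "(?t - ?d *\<^sub>R v) \<bullet> (?t - ?d *\<^sub>R v) = ?t \<bullet> ?t - 2 * ?d * (?t \<bullet> v) + ?d\<^sup>2 * (v \<bullet> v)" for v
          by (simp add: inner_diff_left inner_diff_right inner_commute[of v ?t] power2_eq_square right_diff_distrib)
        from this[of "A ?t"] show ?thesis
          unfolding q_def power2_norm_eq_inner tt by simp
      qed
      have "norm (?t - ?d *\<^sub>R A ?t) \<le> 1 - q / 2"
      proof (rule power2_le_imp_le)
        have "1 - q + (q / 2)\<^sup>2 = (1 - q / 2)\<^sup>2"
          by (simp add: power2_eq_square field_simps)
        with * show "(norm (?t - ?d *\<^sub>R A ?t))\<^sup>2 \<le> (1 - q / 2)\<^sup>2"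
          by (metis add_increasing2 order_refl zero_le_power2)
        have "0 \<le> 1 - q"
          by (metis * zero_le_power2)
        then show "0 \<le> 1 - q / 2"
          by simp
      qed
      moreover have "1 \<le> - ?d * (z \<bullet> ?t) + norm (?t - ?d *\<^sub>R A ?t)"
      proof -
        have "?t \<in> unit_ball"
          using \<theta>(1)[of m] by simp
        then have "?t \<in> K"
          using B by blast
        then show ?thesis
          using \<theta>(2)[of ?t m] tt by simp
      qed
      moreover have "q / 2 = ?d * (?t \<bullet> A ?t) - ?d * (?d * (norm (A ?t))\<^sup>2 / 2)"
        by (simp add: q_def power2_eq_square field_simps)
      ultimately have "?d * (z \<bullet> ?t) + ?d * (?t \<bullet> A ?t) - ?d * (?d * (norm (A ?t))\<^sup>2 / 2) \<le> 0"
        by linarith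
      then have "?d * (?t \<bullet> A ?t + z \<bullet> ?t - ?d * (norm (A ?t))\<^sup>2 / 2) \<le> 0"
        by (simp add: algebra_simps)
      then show ?thesis
        using \<delta>(1)[of m] by (simp add: mult_le_0_iff)
    qed
    then show "\<exists>N. \<forall>m\<ge>N. \<theta> (r m) \<bullet> A (\<theta> (r m)) + z \<bullet> \<theta> (r m) \<le> \<delta> (r m) * (norm (A (\<theta> (r m))))\<^sup>2 / 2"
      by blast
  qed
  ultimately show ?thesis
    using u(1) by blast
qed

text \<open>Let \<open>C\<close> be the set of the contact directions. The claim is that \<open>(I / n, 0)\<close> lies in the convex hull of the
points \<open>(u \<otimes> u, u)\<close> with \<open>u \<in> C\<close>. Otherwise a hyperplane separates it from this compact hull, and the
separating functional \<open>(H, z)\<close> gives a perturbation of the ball that increases the volume and moves all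
contact points into \<open>K\<close>, contrary to \<open>ball_perturbation_not_improving\<close>.\<close>

theorem john_decomposition:
  fixes K :: "(real^'n) set"
  assumes K: "compact K" "convex K" and B: "unit_ball \<subseteq> K"
    and max: "\<And>c (T :: real^'n^'n). invertible T \<Longrightarrow> (\<lambda>x. c + T *v x) ` unit_ball \<subseteq> K \<Longrightarrow> \<bar>det T\<bar> \<le> 1"
  shows "\<exists>S c. tight_frame S c \<and> (\<Sum>u\<in>S. c u *\<^sub>R u) = 0 \<and> (\<forall>u\<in>S. \<forall>x\<in>K. u \<bullet> x \<le> 1)"
proof -
  define n where "n = real CARD('n)"
  have n: "n > 0" by (simp add: n_def)
  define C where "C = {u. norm u = 1 \<and> (\<forall>x\<in>K. u \<bullet> x \<le> 1)}"
  have "closed (\<Inter>x\<in>K. {u. u \<bullet> x \<le> 1})"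
    by (intro closed_INT ballI closed_Collect_le continuous_intros)
  moreover have "(\<Inter>x\<in>K. {u. u \<bullet> x \<le> 1}) = {u. \<forall>x\<in>K. u \<bullet> x \<le> 1}"
    by auto
  ultimately have "closed {u. \<forall>x\<in>K. u \<bullet> x \<le> 1}"
    by simp
  then have "compact (sphere 0 1 \<inter> {u. \<forall>x\<in>K. u \<bullet> x \<le> 1})"
    by (intro compact_Int_closed) auto
  also have "sphere 0 1 \<inter> {u. \<forall>x\<in>K. u \<bullet> x \<le> 1} = C"
    by (auto simp: C_def)
  finally have "compact C" .
  define X where "X = (\<lambda>u. (outer u, u)) ` C"
  have "compact (convex hull X)"
    unfolding X_def by (intro compact_convex_hull compact_continuous_image \<open>compact C\<close> continuous_intros continuous_on_outer)
  define p :: "(real^'n^'n) \<times> (real^'n)" where "p = ((1 / n) *\<^sub>R mat 1, 0)"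
  have "p \<in> convex hull X"
  proof (rule ccontr)
    assume "p \<notin> convex hull X"
    then obtain a b where ab: "a \<bullet> p < b" "\<forall>x\<in>convex hull X. a \<bullet> x > b"
      using separating_hyperplane_closed_point[of "convex hull X" p] \<open>compact (convex hull X)\<close>
      by (auto simp: compact_imp_closed)
    obtain H z where a: "a = (H, z)" by (cases a)
    \<comment> \<open>Symmetrised, and shifted such that the separating constant becomes zero: the trace of \<open>A\<close> is
      negative, whereas \<open>u \<bullet> A u + z \<bullet> u\<close> is positive for all \<open>u \<in> C\<close>.\<close>
    define A where "A x = (1/2) *\<^sub>R (H *v x + transpose H *v x) - b *\<^sub>R x" for x
    have lin: "linear A"
      unfolding A_def by (rule linearI) (auto simp: matrix_vector_right_distrib matrix_vector_mult_scaleR algebra_simps)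
    have adj: "A x \<bullet> y = x \<bullet> A y" for x y
      using inner_matrix_transpose[of H x y] inner_matrix_transpose[of H y x]
      by (simp add: A_def inner_simps inner_commute)
    have quad: "u \<bullet> A u = u \<bullet> (H *v u) - b * (u \<bullet> u)" for u
      using inner_matrix_transpose[of H u u] by (simp add: A_def inner_simps inner_commute)
    obtain e \<mu> where e: "orthobasis e" and A: "A = diag_op e \<mu>"
      using spectral_theorem[OF lin adj] by blast
    have "\<mu> k = e k \<bullet> (H *v e k) - b" for k
      using quad[of "e k"] diag_op_inner[OF e, of \<mu> "e k" k]
      by (simp add: A orthobasis_inner[OF e] inner_commute)
    then have "sum \<mu> UNIV = trace H - n * b"
      by (simp add: sum_subtractf trace_orthobasis[OF e] n_def)
    also have "\<dots> < 0"
      using ab(1) n by (simp add: a p_def inner_mat_1 field_simps)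
    finally have tr: "sum \<mu> UNIV < 0" .
    have "\<exists>u. norm u = 1 \<and> (\<forall>x\<in>K. u \<bullet> x \<le> 1) \<and> u \<bullet> A u + z \<bullet> u \<le> 0"
      by (rule ball_perturbation_not_improving[OF K B _ e A tr]) (rule max)
    then obtain u where u: "norm u = 1" "\<And>x. x \<in> K \<Longrightarrow> u \<bullet> x \<le> 1" "u \<bullet> A u + z \<bullet> u \<le> 0"
      by auto
    then have "(outer u, u) \<in> convex hull X"
      by (intro hull_inc) (auto simp: X_def C_def)
    then have "b < u \<bullet> (H *v u) + z \<bullet> u"
      using ab(2) by (force simp: a inner_outer)
    then show False
      using u(1,3) by (simp add: quad norm_eq_1)
  qed
  then obtain F w where F: "finite F" "F \<subseteq> X" "\<forall>x\<in>F. 0 \<le> w x" "sum w F = 1" "(\<Sum>v\<in>F. w v *\<^sub>R v) = p"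
    unfolding convex_hull_explicit by blast
  \<comment> \<open>Points of weight zero are dropped, as the weights of a frame are positive.\<close>
  define S where "S = snd ` {v \<in> F. w v > 0}"
  define c where "c u = n * w (outer u, u)" for u
  have inj: "inj_on snd {v \<in> F. w v > 0}"
    using F(2) by (auto simp: inj_on_def X_def)
  have fst_eq: "v \<in> F \<Longrightarrow> (outer (snd v), snd v) = v" for v
    using F(2) by (auto simp: X_def)
  have sum_S: "(\<Sum>u\<in>S. w (outer u, u) *\<^sub>R g (outer u, u)) = (\<Sum>v\<in>F. w v *\<^sub>R g v)" for g :: "_ \<Rightarrow> 'b::real_vector"
  proof -
    have "(\<Sum>v\<in>F. w v *\<^sub>R g v) = (\<Sum>v\<in>{v \<in> F. w v > 0}. w v *\<^sub>R g v)"
      using F(1,3) by (intro sum.mono_neutral_right) (auto simp: order_less_le)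
    also have "\<dots> = (\<Sum>u\<in>S. w (outer u, u) *\<^sub>R g (outer u, u))"
      unfolding S_def by (subst sum.reindex[OF inj]) (auto simp: fst_eq intro!: sum.cong)
    finally show ?thesis ..
  qed
  have SC: "u \<in> S \<Longrightarrow> u \<in> C \<and> w (outer u, u) > 0" for u
    using F(2) fst_eq by (fastforce simp: S_def X_def)
  have "(\<Sum>u\<in>S. w (outer u, u) *\<^sub>R outer u) = (1 / n) *\<^sub>R mat 1"
    using sum_S[of fst] arg_cong[OF F(5), of fst] by (simp add: fst_sum p_def)
  then have "n *\<^sub>R (\<Sum>u\<in>S. w (outer u, u) *\<^sub>R outer u) = mat 1"
    using n by simp
  then have outer_sum: "(\<Sum>u\<in>S. c u *\<^sub>R outer u) = mat 1"
    by (simp add: scaleR_sum_right c_def)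
  have "(\<Sum>u\<in>S. w (outer u, u) *\<^sub>R u) = 0"
    using sum_S[of snd] arg_cong[OF F(5), of snd] by (simp add: snd_sum p_def)
  then have "n *\<^sub>R (\<Sum>u\<in>S. w (outer u, u) *\<^sub>R u) = 0"
    by simp
  then have centred: "(\<Sum>u\<in>S. c u *\<^sub>R u) = 0"
    by (simp only: scaleR_sum_right c_def scaleR_scaleR)
  have "tight_frame S c"
  proof
    show "finite S" using F(1) by (simp add: S_def)
    show "norm u = 1" "0 < c u" if "u \<in> S" for u
      using SC[OF that] n by (auto simp: C_def c_def)
    fix x
    have "(\<Sum>u\<in>S. (c u * (u \<bullet> x)) *\<^sub>R u) = (\<Sum>u\<in>S. c u *\<^sub>R outer u) *v x"
    proof -
      have "linear (\<lambda>M :: real^'n^'n. M *v x)"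
        by (rule linearI) (simp_all add: matrix_vector_mult_add_rdistrib scaleR_matrix_vector_assoc)
      then show ?thesis
        using linear_sum[of "\<lambda>M :: real^'n^'n. M *v x" "\<lambda>u. c u *\<^sub>R outer u" S]
        by (simp add: scaleR_matrix_vector_assoc[symmetric] outer_mult)
    qed
    then show "(\<Sum>u\<in>S. (c u * (u \<bullet> x)) *\<^sub>R u) = x"
      by (simp add: outer_sum)
  qed
  then show ?thesis
    using centred SC by (auto simp: C_def)
qed

section \<open>Volumes of circumscribed polytopes\<close>

definition polar_polytope :: "(real^'n) set \<Rightarrow> (real^'n) set" where
  "polar_polytope S = {x. \<forall>u\<in>S. u \<bullet> x \<le> 1}"

definition polar_interior :: "(real^'n) set \<Rightarrow> (real^'n) set" where
  "polar_interior S = {x. \<forall>u\<in>S. u \<bullet> x < 1}"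

lemma closed_polar_polytope: "closed (polar_polytope S)"
proof -
  have "polar_polytope S = (\<Inter>u\<in>S. {x. u \<bullet> x \<le> 1})"
    by (auto simp: polar_polytope_def)
  then show ?thesis
    by (auto intro!: closed_INT closed_Collect_le continuous_intros)
qed

lemma convex_polar_polytope: "convex (polar_polytope S)"
proof -
  have "polar_polytope S = (\<Inter>u\<in>S. {x. u \<bullet> x \<le> 1})"
    by (auto simp: polar_polytope_def)
  then show ?thesis
    by (auto intro!: convex_INT convex_halfspace_le)
qed

lemma open_polar_interior:
  assumes "finite S" shows "open (polar_interior S)"
proof -
  have "polar_interior S = (\<Inter>u\<in>S. {x. u \<bullet> x < 1})"
    by (auto simp: polar_interior_def)
  then show ?thesis
    using assms by (auto intro!: open_INT open_Collect_less continuous_intros)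
qed

lemma emeasure_polar_polytope:
  assumes fin: "finite S" and ne: "\<And>u. u \<in> S \<Longrightarrow> u \<noteq> 0"
  shows "emeasure lborel (polar_polytope S) = emeasure lborel (polar_interior S)"
proof -
  let ?N = "\<Union>u\<in>S. {x. u \<bullet> x = 1}"
  have "negligible ?N"
    using fin ne by (intro negligible_Union) (auto intro!: negligible_hyperplane)
  moreover have "closed ?N"
    using fin by (intro closed_UN ballI closed_hyperplane) auto
  ultimately have N: "?N \<in> null_sets lborel"
    using negligible_iff_null_sets null_sets_completion_iff[of ?N lborel] by auto
  have "emeasure lborel (polar_interior S \<union> (polar_polytope S \<inter> ?N)) = emeasure lborel (polar_interior S)"
    using N open_polar_interior[OF fin] closed_polar_polytope[of S] \<open>closed ?N\<close>
    by (intro emeasure_Un_null_set null_set_Int1) auto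
  also have "polar_interior S \<union> (polar_polytope S \<inter> ?N) = polar_polytope S"
    by (fastforce simp: polar_interior_def polar_polytope_def)
  finally show ?thesis .
qed

text \<open>The unit vector in direction \<open>(- u, 1 / sqrt n)\<close>. A centred tight frame lifts to a tight frame of the larger
space, and the half-spaces \<open>0 < lift u \<bullet> x\<close> cut out the open cone over the polytope \<open>u \<bullet> y < 1\<close>, placed at
height \<open>sqrt n\<close>.\<close>

definition lift :: "real^'n \<Rightarrow> (real^'n) \<times> real" where
  "lift u = sqrt (real CARD('n) / (real CARD('n) + 1)) *\<^sub>R (- u, 1 / sqrt (real CARD('n)))"

text \<open>A linear left inverse of \<open>lift\<close>, by which weights on the frame are carried to the lifted vectors.\<close>

definition unlift :: "(real^'n) \<times> real \<Rightarrow> real^'n" where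
  "unlift v = - (1 / sqrt (real CARD('n) / (real CARD('n) + 1))) *\<^sub>R fst v"

lemma lift_const_pos: "sqrt (real CARD('n::finite) / (real CARD('n) + 1)) > 0"
  by simp

lemma unlift_lift [simp]: "unlift (lift u) = u" for u :: "real^'n"
proof -
  have "sqrt (real CARD('n) / (real CARD('n) + 1)) \<noteq> 0"
    by (metis lift_const_pos less_irrefl)
  then show ?thesis
    by (simp only: unlift_def lift_def) simp
qed

lemma inj_lift: "inj_on lift S"
  by (rule inj_on_inverseI[of _ unlift]) simp

lemma inner_lift:
  "lift u \<bullet> (y, r) = sqrt (real CARD('n) / (real CARD('n) + 1)) * (r / sqrt (real CARD('n)) - u \<bullet> y)" for u :: "real^'n"
  by (simp add: lift_def inner_simps algebra_simps)

lemma inner_lift_lift: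
  "lift u \<bullet> lift w = (real CARD('n) * (u \<bullet> w) + 1) / (real CARD('n) + 1)" for u w :: "real^'n"
proof -
  let ?n = "real CARD('n)"
  have "lift u \<bullet> lift w = (sqrt (?n / (?n + 1)) * sqrt (?n / (?n + 1))) * (u \<bullet> w + (1 / sqrt ?n) * (1 / sqrt ?n))"
    by (simp only: lift_def inner_scaleR_left inner_scaleR_right inner_Pair inner_minus_left inner_minus_right
        minus_minus inner_real_def mult.assoc)
  also have "\<dots> = ?n / (?n + 1) * (u \<bullet> w + 1 / ?n)"
    by (simp only: real_sqrt_mult_self times_divide_times_eq) simp
  also have "?n / m * (x + 1 / ?n) = (?n * x + 1) / m" for m x
    by (simp add: distrib_left add_divide_distrib)
  finally show ?thesis .
qed

text \<open>The factor makes the weights add up to the dimension \<open>n + 1\<close> of the larger space.\<close>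

definition lift_weight :: "(real^'n \<Rightarrow> real) \<Rightarrow> (real^'n) \<times> real \<Rightarrow> real" where
  "lift_weight c v = (real CARD('n) + 1) / real CARD('n) * c (unlift v)"

text \<open>A weighted mean of slacks does not see \<open>y\<close>. This is where the centring of the frame enters, both for the
lifted frame identity and for the exponent of the integrand over the cone.\<close>

lemma (in tight_frame) centred_slack_sum:
  assumes "(\<Sum>u\<in>S. c u *\<^sub>R u) = 0"
  shows "(\<Sum>u\<in>S. c u * (s - u \<bullet> y)) = real DIM('a) * s"
proof -
  have "(\<Sum>u\<in>S. c u * (s - u \<bullet> y)) = (\<Sum>u\<in>S. c u) * s - (\<Sum>u\<in>S. c u *\<^sub>R u) \<bullet> y"
    by (simp only: right_diff_distrib sum_subtractf sum_distrib_right[symmetric] inner_sum_left inner_scaleR_left)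
  then show ?thesis
    by (simp add: assms sum_c)
qed

lemma tight_frame_lift:
  fixes S :: "(real^'n) set"
  assumes tf: "tight_frame S c" and centred: "(\<Sum>u\<in>S. c u *\<^sub>R u) = 0"
  shows "tight_frame (lift ` S) (lift_weight c)"
proof -
  interpret tight_frame S c by fact
  let ?n = "real CARD('n)"
  have n: "?n > 0" by simp
  show ?thesis
  proof
    show "finite (lift ` S)" using finite_S by simp
    show "norm v = 1" if "v \<in> lift ` S" for v
      using that by (auto simp: norm_eq_1 inner_lift_lift inner_self_S)
    show "0 < lift_weight c v" if "v \<in> lift ` S" for v
      using that n by (auto simp: lift_weight_def c_pos)
    fix x :: "(real^'n) \<times> real"
    obtain y r where x: "x = (y, r)" by (cases x)
    let ?k = "sqrt (?n / (?n + 1))"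
    have coef: "lift_weight c (lift u) * (lift u \<bullet> (y, r)) * ?k = c u * (r / sqrt ?n - u \<bullet> y)" for u
    proof -
      have "lift_weight c (lift u) * (lift u \<bullet> (y, r)) * ?k = (?n + 1) / ?n * (?k * ?k) * (c u * (r / sqrt ?n - u \<bullet> y))"
        by (simp only: lift_weight_def unlift_lift inner_lift mult_ac)
      also have "(?n + 1) / ?n * (?k * ?k) = 1"
        using n by (simp only: real_sqrt_mult_self) (simp add: add_pos_pos)
      finally show ?thesis by simp
    qed
    have "(\<Sum>v\<in>lift ` S. (lift_weight c v * (v \<bullet> x)) *\<^sub>R v) =
        (\<Sum>u\<in>S. (lift_weight c (lift u) * (lift u \<bullet> (y, r))) *\<^sub>R lift u)"
      by (simp add: x sum.reindex[OF inj_lift])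
    also have "\<dots> = (\<Sum>u\<in>S. (c u * (r / sqrt ?n - u \<bullet> y)) *\<^sub>R (- u, 1 / sqrt ?n))"
      by (simp only: lift_def[of u for u] scaleR_scaleR coef flip: coef)
    also have "\<dots> = (- (\<Sum>u\<in>S. (c u * (r / sqrt ?n - u \<bullet> y)) *\<^sub>R u), (\<Sum>u\<in>S. c u * (r / sqrt ?n - u \<bullet> y)) / sqrt ?n)"
      by (rule prod_eqI) (simp_all add: fst_sum snd_sum sum_negf sum_divide_distrib)
    also have "(\<Sum>u\<in>S. (c u * (r / sqrt ?n - u \<bullet> y)) *\<^sub>R u) = (r / sqrt ?n) *\<^sub>R (\<Sum>u\<in>S. c u *\<^sub>R u) - (\<Sum>u\<in>S. (c u * (u \<bullet> y)) *\<^sub>R u)"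
      by (simp add: scaleR_sum_right sum_subtractf[symmetric] algebra_simps)
    also have "\<dots> = - y"
      by (simp add: centred frame)
    also have "(\<Sum>u\<in>S. c u * (r / sqrt ?n - u \<bullet> y)) = r * (?n / sqrt ?n)"
      unfolding centred_slack_sum[OF centred] by simp
    also have "?n / sqrt ?n = sqrt ?n"
      by (rule real_div_sqrt) simp
    finally show "(\<Sum>v\<in>lift ` S. (lift_weight c v * (v \<bullet> x)) *\<^sub>R v) = x"
      by (simp add: x)
  qed
qed

text \<open>The integral of the exponential integrand over the cone over a polytope of volume one.\<close>

definition cone_constant :: "'n::finite itself \<Rightarrow> ennreal" where
  "cone_constant _ = (\<integral>\<^sup>+r. ennreal (indicator {0<..} r * exp (- sqrt (real CARD('n) + 1) * r) *
     (r / sqrt (real CARD('n))) ^ CARD('n)) \<partial>lborel)"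

lemma emeasure_scaled_polar_interior:
  fixes S :: "(real^'n) set"
  assumes "finite S" "s > 0"
  shows "emeasure lborel {y. \<forall>u\<in>S. u \<bullet> y < s} = ennreal (s ^ CARD('n)) * emeasure lborel (polar_interior S)"
proof -
  have "{y. \<forall>u\<in>S. u \<bullet> y < s} = homothety 0 s ` polar_interior S"
  proof (intro equalityI subsetI)
    fix y assume "y \<in> {y. \<forall>u\<in>S. u \<bullet> y < s}"
    then have "y /\<^sub>R s \<in> polar_interior S" "y = homothety 0 s (y /\<^sub>R s)"
      using assms(2) by (auto simp: polar_interior_def homothety_def field_simps)
    then show "y \<in> homothety 0 s ` polar_interior S" by blast
  qed (use assms(2) in \<open>auto simp: homothety_def polar_interior_def\<close>)
  then show ?thesis
    using open_polar_interior[OF assms(1)] by (simp add: emeasure_homothety[OF assms(2)])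
qed

lemma lift_frame_cone:
  fixes S :: "(real^'n) set"
  assumes tf: "tight_frame S c" and centred: "(\<Sum>u\<in>S. c u *\<^sub>R u) = 0"
  shows "(\<forall>v\<in>lift ` S. v \<bullet> (y, r) \<in> {0<..}) \<longleftrightarrow> r > 0 \<and> (\<forall>u\<in>S. u \<bullet> y < r / sqrt (real CARD('n)))"
proof -
  interpret tight_frame S c by fact
  have pos: "0 < sqrt (real CARD('n) / (real CARD('n) + 1)) * x \<longleftrightarrow> 0 < x" for x
    using lift_const_pos[where ?'n = 'n] by (metis mult_zero_right zero_less_mult_pos mult_pos_pos)
  have "(\<forall>v\<in>lift ` S. v \<bullet> (y, r) \<in> {0<..}) \<longleftrightarrow> (\<forall>u\<in>S. u \<bullet> y < r / sqrt (real CARD('n)))"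
    by (simp only: Set.ball_simps(9) inner_lift greaterThan_iff pos diff_gt_0_iff_gt)
  moreover have "r > 0" if *: "\<forall>u\<in>S. u \<bullet> y < r / sqrt (real CARD('n))"
  proof -
    have "0 = (\<Sum>u\<in>S. c u *\<^sub>R u) \<bullet> y"
      by (simp add: centred)
    also have "\<dots> = (\<Sum>u\<in>S. c u * (u \<bullet> y))"
      by (simp add: inner_sum_left)
    also have "\<dots> < (\<Sum>u\<in>S. c u * (r / sqrt (real CARD('n))))"
      using * finite_S S_nonempty by (intro sum_strict_mono mult_strict_left_mono) (auto simp: c_pos)
    also have "\<dots> = real CARD('n) * (r / sqrt (real CARD('n)))"
      by (simp only: sum_distrib_right[symmetric] sum_c DIM_cart DIM_real mult_1_right)
    finally show "r > 0"
      by (simp add: zero_less_mult_iff zero_less_divide_iff)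
  qed
  ultimately show ?thesis by blast
qed

lemma lift_weighted_sum:
  fixes S :: "(real^'n) set"
  assumes tf: "tight_frame S c" and centred: "(\<Sum>u\<in>S. c u *\<^sub>R u) = 0"
  shows "(\<Sum>v\<in>lift ` S. lift_weight c v * (v \<bullet> (y, r))) = sqrt (real CARD('n) + 1) * r"
proof -
  interpret tight_frame S c by fact
  let ?n = "real CARD('n)" and ?k = "sqrt (real CARD('n) / (real CARD('n) + 1))"
  have n: "?n > 0" by simp
  have "(\<Sum>v\<in>lift ` S. lift_weight c v * (v \<bullet> (y, r))) =
      (\<Sum>u\<in>S. (?n + 1) / ?n * c u * (?k * (r / sqrt ?n - u \<bullet> y)))"
    by (simp add: sum.reindex[OF inj_lift] lift_weight_def inner_lift)
  also have "\<dots> = (?n + 1) / ?n * ?k * (\<Sum>u\<in>S. c u * (r / sqrt ?n - u \<bullet> y))"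
    by (simp only: sum_distrib_left mult_ac)
  also have "\<dots> = ((?n + 1) / ?n * ?k * (?n / sqrt ?n)) * r"
    unfolding centred_slack_sum[OF centred] by simp
  also have "(?n + 1) / ?n * ?k * (?n / sqrt ?n) = sqrt (?n + 1)"
  proof -
    have "(?n + 1) / ?n * ?k * (?n / sqrt ?n) = (?n + 1) * ?k / sqrt ?n"
      using n by simp
    also have "\<dots> = (?n + 1) / sqrt (?n + 1)"
      using n by (simp only: real_sqrt_divide) simp
    also have "\<dots> = sqrt (?n + 1)"
      by (rule real_div_sqrt) simp
    finally show ?thesis .
  qed
  finally show ?thesis .
qed

locale centred_frame = tight_frame S c for S :: "(real^'n) set" and c +
  assumes centred: "(\<Sum>u\<in>S. c u *\<^sub>R u) = 0"
begin

sublocale L: frame_transport "lift ` S" "lift_weight c" "{0<..}" exp_transport exp_transport'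
  by (intro frame_transport_exp tight_frame_lift centred tight_frame_axioms)

lemma L_U_iff: "(y, r) \<in> L.U \<longleftrightarrow> r > 0 \<and> (\<forall>u\<in>S. u \<bullet> y < r / sqrt (real CARD('n)))"
  unfolding L.U_def using lift_frame_cone[OF tight_frame_axioms centred] by simp

lemma L_W0: "L.W0 x = exp (- (\<Sum>v\<in>lift ` S. lift_weight c v * (v \<bullet> x)))"
  by (simp add: L.W0_def exp_transport'_def less_imp_neq[OF std_normal_density_pos, symmetric] sum_negf)

text \<open>Fubini along the axis of the cone: the slice at height \<open>r\<close> is a dilate of the polytope, and the integrand
depends on \<open>r\<close> only.\<close>

lemma nn_integral_cone:
  "(\<integral>\<^sup>+x. ennreal (indicator L.U x * L.W0 x) \<partial>lborel) = cone_constant TYPE('n) * emeasure lborel (polar_polytope S)"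
proof -
  let ?n = "real CARD('n)" and ?f = "\<lambda>x. ennreal (indicator L.U x * L.W0 x)"
  have meas: "(\<lambda>x. indicator L.U x * L.W0 x) \<in> borel_measurable borel"
    by (rule L.borel_measurable_on_U[OF L.W0_cont])
  have f_eq: "?f (y, r) = ennreal (indicator {0<..} r * exp (- sqrt (?n + 1) * r)) *
      indicator {y. \<forall>u\<in>S. u \<bullet> y < r / sqrt ?n} y" for y r
    by (auto simp: indicator_def L_U_iff L_W0 lift_weighted_sum[OF tight_frame_axioms centred])
  have open_s: "open {y. \<forall>u\<in>S. u \<bullet> y < s}" for s
  proof -
    have "{y. \<forall>u\<in>S. u \<bullet> y < s} = (\<Inter>u\<in>S. {y. u \<bullet> y < s})" by auto
    then show ?thesis
      using finite_S by (auto intro!: open_INT open_Collect_less continuous_intros)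
  qed
  have "(\<integral>\<^sup>+x. ?f x \<partial>lborel) = (\<integral>\<^sup>+x. ?f x \<partial>((lborel :: (real^'n) measure) \<Otimes>\<^sub>M (lborel :: real measure)))"
    by (simp add: lborel_prod)
  also have "\<dots> = (\<integral>\<^sup>+r. \<integral>\<^sup>+y. ?f (y, r) \<partial>lborel \<partial>lborel)"
    using meas by (intro lborel_pair.nn_integral_snd[symmetric]) (simp add: lborel_prod)
  also have "\<dots> = (\<integral>\<^sup>+r. ennreal (indicator {0<..} r * exp (- sqrt (?n + 1) * r)) *
      emeasure lborel {y. \<forall>u\<in>S. u \<bullet> y < r / sqrt ?n} \<partial>lborel)"
    unfolding f_eq using open_s by (intro nn_integral_cong nn_integral_cmult_indicator) auto
  also have "\<dots> = (\<integral>\<^sup>+r. ennreal (indicator {0<..} r * exp (- sqrt (?n + 1) * r) * (r / sqrt ?n) ^ CARD('n)) *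
      emeasure lborel (polar_interior S) \<partial>lborel)"
  proof (rule nn_integral_cong)
    fix r :: real
    show "ennreal (indicator {0<..} r * exp (- sqrt (?n + 1) * r)) * emeasure lborel {y. \<forall>u\<in>S. u \<bullet> y < r / sqrt ?n} =
      ennreal (indicator {0<..} r * exp (- sqrt (?n + 1) * r) * (r / sqrt ?n) ^ CARD('n)) * emeasure lborel (polar_interior S)"
    proof (cases "r > 0")
      case True
      then show ?thesis
        using emeasure_scaled_polar_interior[OF finite_S, of "r / sqrt ?n"]
        by (simp add: ennreal_mult mult.assoc)
    qed simp
  qed
  also have "\<dots> = cone_constant TYPE('n) * emeasure lborel (polar_interior S)"
    unfolding cone_constant_def by (intro nn_integral_multc) measurable
  also have "emeasure lborel (polar_interior S) = emeasure lborel (polar_polytope S)"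
    using emeasure_polar_polytope[OF finite_S] norm_S by force
  finally show ?thesis .
qed

lemma cone_bound: "cone_constant TYPE('n) * emeasure lborel (polar_polytope S) \<le> 1"
  using L.brascamp_lieb by (simp add: nn_integral_cone)

text \<open>All lifted vectors have the same inner product with the axis \<open>(0, 1)\<close> of the cone.\<close>

lemma cone_equality:
  assumes eq: "cone_constant TYPE('n) * emeasure lborel (polar_polytope S) = 1"
    and uw: "u \<in> S" "w \<in> S" "u \<noteq> w"
  shows "lift u \<bullet> lift w = 0"
proof (rule L.orthogonal_of_common_value[of "(0, 1)"])
  show "exp_transport (v \<bullet> x) = v \<bullet> L.\<Phi> x" if "x \<in> L.U" "v \<in> lift ` S" for x v
    by (rule L.brascamp_lieb_equality[OF _ that]) (simp add: nn_integral_cone eq)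
  show "(0, 1) \<in> L.U"
    by (simp add: L_U_iff)
  show "lift u \<noteq> lift w"
    using uw(3) by (metis unlift_lift)
  have "snd (lift u) > 0" "snd (lift w) > 0"
    by (simp_all add: lift_def)
  then show "lift u \<noteq> - lift w"
    by (metis less_asym neg_0_less_iff_less snd_uminus)
  show "lift u \<bullet> (0, 1) = lift w \<bullet> (0, 1)"
    by (simp add: inner_lift)
qed (use uw exp_transport'_nonconst in auto)

end

section \<open>Simplex frames\<close>

text \<open>The outer unit normals of the facets of a regular simplex circumscribed about the unit ball.\<close>

definition simplex_frame :: "(real^'n) set \<Rightarrow> bool" where
  "simplex_frame S \<longleftrightarrow> tight_frame S (\<lambda>_. real CARD('n) / (real CARD('n) + 1)) \<and>
     (\<forall>u\<in>S. \<forall>w\<in>S. u \<noteq> w \<longrightarrow> u \<bullet> w = - 1 / real CARD('n))"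

lemma simplex_frame_inner:
  fixes S :: "(real^'n) set"
  assumes "simplex_frame S" "u \<in> S" "w \<in> S"
  shows "u \<bullet> w = (if u = w then 1 else - 1 / real CARD('n))"
  using assms tight_frame.inner_self_S by (auto simp: simplex_frame_def)

lemma simplex_frame_card:
  fixes S :: "(real^'n) set"
  assumes "simplex_frame S" shows "card S = CARD('n) + 1" "finite S"
proof -
  interpret tight_frame S "\<lambda>_. real CARD('n) / (real CARD('n) + 1)"
    using assms by (simp add: simplex_frame_def)
  have "real (card S) * (real CARD('n) / (real CARD('n) + 1)) = real CARD('n)"
    using sum_c by simp
  then have "real CARD('n) * real (card S) = real CARD('n) * (real CARD('n) + 1)"
    by (simp add: field_simps)
  then have "real (card S) = real CARD('n) + 1"
    unfolding mult_cancel_left by simp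
  then show "card S = CARD('n) + 1" by linarith
  show "finite S" by (rule finite_S)
qed

lemma simplex_frame_sum_mult:
  fixes S :: "(real^'n) set"
  assumes S: "simplex_frame S" and "u \<in> S"
  shows "(\<Sum>w\<in>S. f w * (u \<bullet> w)) = ((real CARD('n) + 1) * f u - sum f S) / real CARD('n)"
proof -
  have "(\<Sum>w\<in>S. f w * (u \<bullet> w)) = f u + (\<Sum>w\<in>S - {u}. f w * (u \<bullet> w))"
    using simplex_frame_card(2)[OF S] assms by (subst sum.remove[of S u]) (auto simp: simplex_frame_inner[OF S])
  also have "(\<Sum>w\<in>S - {u}. f w * (u \<bullet> w)) = (\<Sum>w\<in>S - {u}. f w * (- 1 / real CARD('n)))"
    using assms(2) by (intro sum.cong) (auto simp: simplex_frame_inner[OF S])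
  also have "\<dots> = - (sum f S - f u) / real CARD('n)"
    using simplex_frame_card(2)[OF S] assms(2)
    by (simp add: sum_diff1 sum_distrib_right[symmetric] sum_negf sum_divide_distrib[symmetric] diff_divide_distrib)
  finally show ?thesis
    by (simp add: field_simps)
qed

lemma simplex_frame_sum:
  fixes S :: "(real^'n) set"
  assumes S: "simplex_frame S" shows "(\<Sum>u\<in>S. u) = 0"
proof -
  interpret tight_frame S "\<lambda>_. real CARD('n) / (real CARD('n) + 1)"
    using assms by (simp add: simplex_frame_def)
  have "u \<bullet> (\<Sum>w\<in>S. w) = 0" if "u \<in> S" for u
    using simplex_frame_sum_mult[OF S that, of "\<lambda>_. 1"] simplex_frame_card[OF S]
    by (simp add: inner_sum_right)
  then show ?thesis
    using frame[of "\<Sum>w\<in>S. w"] by simp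
qed

lemma simplex_frame_centred:
  fixes S :: "(real^'n) set"
  assumes S: "simplex_frame S"
  shows "centred_frame S (\<lambda>_. real CARD('n) / (real CARD('n) + 1))"
  using S simplex_frame_sum[OF S]
  by (simp add: centred_frame_def centred_frame_axioms_def simplex_frame_def scaleR_sum_right[symmetric])

text \<open>The lifted vectors are orthonormal. Their inner products give those of the frame, and the frame identity
for the lifted vector of \<open>u\<close> gives the weight of \<open>u\<close>.\<close>

lemma (in centred_frame) simplex_frame_of_equality:
  assumes eq: "cone_constant TYPE('n) * emeasure lborel (polar_polytope S) = 1"
  shows "simplex_frame S"
proof -
  let ?n = "real CARD('n)"
  have ip: "u \<bullet> w = - 1 / ?n" if "u \<in> S" "w \<in> S" "u \<noteq> w" for u w
    using cone_equality[OF eq that] by (simp add: inner_lift_lift field_simps add_pos_pos)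
  have cu: "c u = ?n / (?n + 1)" if u: "u \<in> S" for u
  proof -
    have "lift u = (\<Sum>v\<in>lift ` S. (lift_weight c v * (v \<bullet> lift u)) *\<^sub>R v)"
      by (rule L.frame[symmetric])
    also have "\<dots> = (\<Sum>w\<in>S. (lift_weight c (lift w) * (lift w \<bullet> lift u)) *\<^sub>R lift w)"
      by (simp add: sum.reindex[OF inj_lift])
    also have "\<dots> = (\<Sum>w\<in>S. if w = u then lift_weight c (lift w) *\<^sub>R lift w else 0)"
      using cone_equality[OF eq _ u] L.inner_self_S u by (intro sum.cong) auto
    also have "\<dots> = lift_weight c (lift u) *\<^sub>R lift u"
      using finite_S u by simp
    finally have "lift_weight c (lift u) = 1"
      using L.norm_S[of "lift u"] u
      by (metis imageI norm_zero scaleR_cancel_right scaleR_one zero_neq_one)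
    then show ?thesis
      by (simp add: lift_weight_def field_simps)
  qed
  have "tight_frame S (\<lambda>_. ?n / (?n + 1))"
  proof
    show "(\<Sum>u\<in>S. (?n / (?n + 1) * (u \<bullet> x)) *\<^sub>R u) = x" for x
      using frame[of x] cu by (simp cong: sum.cong)
  qed (use finite_S norm_S in auto)
  then show ?thesis
    using ip by (simp add: simplex_frame_def)
qed

lemma nn_integral_exp_Ioi: "(\<integral>\<^sup>+t. ennreal (indicator {0<..} t * exp (- t)) \<partial>lborel) = 1"
proof -
  have "(\<integral>\<^sup>+t. ennreal (indicator {0<..} t * exp (- t)) \<partial>lborel) =
      (\<integral>\<^sup>+t. ennreal (t ^ 0 * exp (- t)) * indicator {0..} t \<partial>lborel)"
    using AE_lborel_singleton[of "0::real"]
    by (intro nn_integral_cong_AE) (auto simp: indicator_def elim!: eventually_mono)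
  also have "\<dots> = 1"
    by (subst nn_intergal_power_times_exp_Ici) simp
  finally show ?thesis .
qed

text \<open>The lifted frame is an orthonormal basis, so the cone over the simplex is an isometric image of the
positive orthant, and the integral is a product of integrals of \<open>exp (- t)\<close> over the positive half-line.\<close>

lemma simplex_frame_volume:
  fixes S :: "(real^'n) set"
  assumes S: "simplex_frame S"
  shows "cone_constant TYPE('n) * emeasure lborel (polar_polytope S) = 1"
proof -
  let ?n = "real CARD('n)"
  let ?c = "\<lambda>_ :: real^'n. ?n / (?n + 1)"
  interpret centred_frame S ?c by (rule simplex_frame_centred[OF S])
  have w1: "lift_weight ?c v = 1" for v
    by (simp add: lift_weight_def add_pos_pos)
  have "card (lift ` S) = card (Basis :: ((real^'n) \<times> real) set)"
    using simplex_frame_card(1)[OF S] by (simp add: card_image[OF inj_lift])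
  then obtain \<beta> where \<beta>: "bij_betw \<beta> (Basis :: ((real^'n) \<times> real) set) (lift ` S)"
    using finite_same_card_bij[OF finite_Basis finite_imageI[OF finite_S]] by metis
  have ip: "\<beta> b \<bullet> \<beta> b' = (if b = b' then 1 else 0)" if b: "b \<in> Basis" "b' \<in> Basis" for b b'
  proof -
    have "\<beta> b \<in> lift ` S" "\<beta> b' \<in> lift ` S"
      using bij_betwE[OF \<beta>] b by auto
    then obtain u w where u: "u \<in> S" "\<beta> b = lift u" and w: "w \<in> S" "\<beta> b' = lift w"
      by blast
    have "b = b' \<longleftrightarrow> u = w"
      using \<beta> b u w by (metis bij_betw_imp_inj_on inj_on_def unlift_lift)
    then show ?thesis
      using u w by (auto simp: inner_lift_lift simplex_frame_inner[OF S])
  qed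
  define Q where "Q x = (\<Sum>b\<in>Basis. (x \<bullet> b) *\<^sub>R \<beta> b)" for x
  have linQ: "linear Q"
    unfolding Q_def by (rule linearI) (auto simp: inner_simps scaleR_add_left sum.distrib scaleR_sum_right)
  have \<beta>Q: "\<beta> b \<bullet> Q x = x \<bullet> b" if "b \<in> Basis" for b x
  proof -
    have "\<beta> b \<bullet> Q x = (\<Sum>b'\<in>Basis. (x \<bullet> b') * (\<beta> b \<bullet> \<beta> b'))"
      by (simp add: Q_def inner_sum_right)
    also have "\<dots> = (\<Sum>b'\<in>Basis. if b = b' then x \<bullet> b' else 0)"
      by (intro sum.cong) (auto simp: ip that)
    finally show ?thesis
      using that by simp
  qed
  have "Q x \<bullet> Q y = x \<bullet> y" for x y
  proof -
    have "Q x \<bullet> Q y = (\<Sum>b\<in>Basis. (x \<bullet> b) * (\<beta> b \<bullet> Q y))"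
      by (simp add: Q_def[of x] inner_sum_left)
    then show ?thesis
      by (simp add: \<beta>Q euclidean_inner[of x y])
  qed
  then have Q: "orthogonal_transformation Q"
    using linQ by (simp add: orthogonal_transformation_def)
  have [measurable]: "Q \<in> borel_measurable borel"
    by (rule borel_measurable_linear[OF linQ])
  have [measurable]: "(\<lambda>x. indicator L.U x * L.W0 x) \<in> borel_measurable borel"
    by (rule L.borel_measurable_on_U[OF L.W0_cont])
  have U: "Q x \<in> L.U \<longleftrightarrow> (\<forall>b\<in>Basis. 0 < x \<bullet> b)" for x
  proof -
    have "Q x \<in> L.U \<longleftrightarrow> (\<forall>v\<in>lift ` S. 0 < v \<bullet> Q x)"
      by (simp add: L.U_def)
    also have "\<dots> \<longleftrightarrow> (\<forall>b\<in>Basis. 0 < \<beta> b \<bullet> Q x)"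
      unfolding bij_betw_imp_surj_on[OF \<beta>, symmetric] by (simp only: Set.ball_simps(9))
    finally show ?thesis
      by (simp add: \<beta>Q)
  qed
  have W0: "L.W0 (Q x) = (\<Prod>b\<in>Basis. exp (- (x \<bullet> b)))" for x
    unfolding L_W0 w1 using sum.reindex_bij_betw[OF \<beta>, of "\<lambda>v. v \<bullet> Q x"]
    by (simp add: \<beta>Q exp_sum[symmetric] sum_negf)
  have "(\<integral>\<^sup>+x. ennreal (indicator L.U x * L.W0 x) \<partial>lborel) =
      (\<integral>\<^sup>+x. ennreal (indicator L.U x * L.W0 x) \<partial>(distr lborel borel Q))"
    by (simp add: distr_lborel_orthogonal_transformation[OF Q])
  also have "\<dots> = (\<integral>\<^sup>+x. ennreal (indicator L.U (Q x) * L.W0 (Q x)) \<partial>lborel)"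
    by (subst nn_integral_distr) auto
  also have "\<dots> = (\<integral>\<^sup>+x. (\<Prod>b\<in>(Basis :: ((real^'n) \<times> real) set). ennreal (indicator {0<..} (x \<bullet> b) * exp (- (x \<bullet> b)))) \<partial>lborel)"
  proof (rule nn_integral_cong)
    fix x :: "(real^'n) \<times> real"
    have "indicator L.U (Q x) = (\<Prod>b\<in>(Basis :: ((real^'n) \<times> real) set). indicator {0<..} (x \<bullet> b) :: real)"
    proof (cases "Q x \<in> L.U")
      case True
      then show ?thesis
        by (simp add: U)
    next
      case False
      then obtain b where "b \<in> Basis" "\<not> 0 < x \<bullet> b"
        using U by blast
      then have "(\<Prod>b\<in>(Basis :: ((real^'n) \<times> real) set). indicator {0<..} (x \<bullet> b) :: real) = 0"
        by (intro prod_zero finite_Basis bexI[of _ b]) (auto simp: indicator_def)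
      with False show ?thesis by simp
    qed
    then have "indicator L.U (Q x) * L.W0 (Q x) =
        (\<Prod>b\<in>(Basis :: ((real^'n) \<times> real) set). indicator {0<..} (x \<bullet> b) * exp (- (x \<bullet> b)))"
      by (simp add: W0 prod.distrib)
    then show "ennreal (indicator L.U (Q x) * L.W0 (Q x)) =
        (\<Prod>b\<in>(Basis :: ((real^'n) \<times> real) set). ennreal (indicator {0<..} (x \<bullet> b) * exp (- (x \<bullet> b))))"
      by (simp add: prod_ennreal)
  qed
  also have "\<dots> = (\<Prod>b\<in>(Basis :: ((real^'n) \<times> real) set). (\<integral>\<^sup>+t. ennreal (indicator {0<..} t * exp (- t)) \<partial>lborel))"
    by (rule nn_integral_lborel_prod) auto
  also have "\<dots> = 1"
    by (simp add: nn_integral_exp_Ioi)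
  finally show ?thesis
    by (simp add: nn_integral_cone)
qed

text \<open>A bijection between two simplex frames preserves inner products and therefore extends, by the frame
expansion, to a linear bijection of the space.\<close>

lemma simplex_frames_equivalent:
  fixes S R :: "(real^'n) set"
  assumes S: "simplex_frame S" and R: "simplex_frame R"
  shows "\<exists>A :: real^'n^'n. invertible A \<and> (\<lambda>x. A *v x) ` polar_polytope S = polar_polytope R"
proof -
  define k where "k = real CARD('n) / (real CARD('n) + 1)"
  interpret S: tight_frame S "\<lambda>_. k" using S by (simp add: simplex_frame_def k_def)
  obtain \<beta> where \<beta>: "bij_betw \<beta> S R"
    using finite_same_card_bij[of S R] simplex_frame_card[OF S] simplex_frame_card[OF R] by auto
  define f where "f x = (\<Sum>u\<in>S. (k * (u \<bullet> x)) *\<^sub>R \<beta> u)" for x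
  have lin: "linear f"
    unfolding f_def by (rule linearI) (auto simp: inner_simps scaleR_add_left sum.distrib scaleR_sum_right algebra_simps)
  have \<beta>f: "\<beta> u \<bullet> f x = u \<bullet> x" if u: "u \<in> S" for u x
  proof -
    have inn: "\<beta> u \<bullet> \<beta> w = u \<bullet> w" if w: "w \<in> S" for w
    proof -
      have "\<beta> u \<in> R" "\<beta> w \<in> R" "\<beta> u = \<beta> w \<longleftrightarrow> u = w"
        using \<beta> u w by (auto simp: bij_betw_def inj_on_def)
      then show ?thesis
        using u w by (simp add: simplex_frame_inner[OF S] simplex_frame_inner[OF R])
    qed
    have "\<beta> u \<bullet> f x = (\<Sum>w\<in>S. k * (w \<bullet> x) * (u \<bullet> w))"
      by (simp add: f_def inner_sum_right inn)
    also have "\<dots> = u \<bullet> x"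
      using S.frame_inner[of x u] by (simp add: inner_commute)
    finally show ?thesis .
  qed
  have "inj f"
  proof (rule injI)
    fix x y assume "f x = f y"
    then have "u \<bullet> x = u \<bullet> y" if "u \<in> S" for u
      using \<beta>f[OF that, of x] \<beta>f[OF that, of y] by simp
    then have "(\<Sum>u\<in>S. (k * (u \<bullet> x)) *\<^sub>R u) = (\<Sum>u\<in>S. (k * (u \<bullet> y)) *\<^sub>R u)"
      by (intro sum.cong) auto
    then show "x = y"
      by (simp only: S.frame)
  qed
  then have surj: "surj f"
    by (rule linear_inj_imp_surj[OF lin])
  have mf: "matrix f *v x = f x" for x
    using matrix_vector_mul(2)[OF lin] by metis
  have iff: "f x \<in> polar_polytope R \<longleftrightarrow> x \<in> polar_polytope S" for x
    unfolding polar_polytope_def bij_betw_imp_surj_on[OF \<beta>, symmetric] by (simp add: \<beta>f)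
  have "f ` polar_polytope S = polar_polytope R"
  proof (intro equalityI subsetI)
    fix y assume y: "y \<in> polar_polytope R"
    obtain x where "y = f x"
      using surj by (rule surjE)
    with y show "y \<in> f ` polar_polytope S"
      using iff by blast
  qed (use iff in blast)
  then have "(\<lambda>x. matrix f *v x) ` polar_polytope S = polar_polytope R"
    by (simp add: mf)
  moreover have "invertible (matrix f)"
    using \<open>inj f\<close> lin by (simp add: invertible_det_nz det_nz_iff_inj)
  ultimately show ?thesis by blast
qed

section \<open>Circumscribed polytopes with maximal inscribed unit ball\<close>

text \<open>The isometric factor of the polar decomposition maps the unit ball onto itself.\<close>

lemma ellipsoid_normal_form:
  fixes T :: "real^'n^'n"
  assumes "invertible T"
  obtains e \<mu> where "orthobasis e" "\<And>i. \<mu> i > 0" "\<bar>det T\<bar> = prod \<mu> UNIV"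
    "(\<lambda>x. T *v x) ` unit_ball = diag_op e \<mu> ` unit_ball"
proof -
  obtain e \<mu> Q where e: "orthobasis e" "\<And>i. \<mu> i > 0" and Q: "orthogonal_matrix Q" "T = matrix (diag_op e \<mu>) ** Q"
    using invertible_matrix_polar[OF assms] by blast
  have "\<bar>det T\<bar> = \<bar>prod \<mu> UNIV\<bar>"
    using det_orthogonal_matrix[OF Q(1)] by (auto simp: Q(2) det_mul det_matrix_diag_op[OF e(1)])
  also have "\<dots> = prod \<mu> UNIV"
    using e(2) by (simp add: prod_nonneg less_imp_le)
  finally have det: "\<bar>det T\<bar> = prod \<mu> UNIV" .
  have ot: "orthogonal_transformation (\<lambda>x. Q *v x)"
    using Q(1) by (simp add: orthogonal_transformation_matrix)
  have "(\<lambda>x. Q *v x) ` unit_ball = unit_ball"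
    using image_orthogonal_transformation_cball[OF ot, of 0 1] by simp
  then have "diag_op e \<mu> ` unit_ball = diag_op e \<mu> ` (\<lambda>x. Q *v x) ` unit_ball"
    by simp
  also have "\<dots> = (\<lambda>x. T *v x) ` unit_ball"
    by (simp add: image_image Q(2) matrix_vector_mul_assoc[symmetric] matrix_diag_op_mult)
  finally show ?thesis
    using that e det by metis
qed

lemma prod_le_exp_sum_minus_one:
  assumes "\<And>i. i \<in> A \<Longrightarrow> (0::real) < \<mu> i" "finite A"
  shows "prod \<mu> A \<le> exp (\<Sum>i\<in>A. \<mu> i - 1)"
proof -
  have "prod \<mu> A \<le> (\<Prod>i\<in>A. exp (\<mu> i - 1))"
    using assms by (intro prod_mono) (use exp_ge_add_one_self[of "\<mu> _ - 1"] in \<open>auto simp: less_imp_le\<close>)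
  then show ?thesis
    using assms by (simp add: exp_sum)
qed

lemma (in tight_frame) frame_trace:
  fixes e :: "'b::finite \<Rightarrow> 'a"
  assumes "\<And>u. u \<bullet> u = (\<Sum>k\<in>UNIV. (u \<bullet> e k)\<^sup>2)" "\<And>k. norm (e k) = 1"
  shows "(\<Sum>u\<in>S. c u * (\<Sum>k\<in>UNIV. \<mu> k * (u \<bullet> e k)\<^sup>2)) = sum \<mu> UNIV"
proof -
  have "(\<Sum>u\<in>S. c u * (\<Sum>k\<in>UNIV. \<mu> k * (u \<bullet> e k)\<^sup>2)) = (\<Sum>k\<in>UNIV. \<mu> k * (\<Sum>u\<in>S. c u * (u \<bullet> e k) * (u \<bullet> e k)))"
    unfolding sum_distrib_left by (subst sum.swap) (simp add: power2_eq_square mult_ac)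
  then show ?thesis
    using assms(2) by (simp add: frame_inner norm_eq_1)
qed

text \<open>Let \<open>q u = \<Sum> \<mu> k * (u \<bullet> e k)\<^sup>2\<close>, the quadratic form of the positive factor \<open>diag_op e \<mu>\<close>. The point of the
ellipsoid given by \<open>u\<close> itself shows that \<open>u \<bullet> z + q u \<le> 1\<close>. Summing with the weights bounds the trace
\<open>sum \<mu> UNIV\<close> by \<open>n\<close>, hence the product of the \<open>\<mu> k\<close> by one. The centre \<open>z\<close> drops out in either case: its
terms sum to zero over a centred frame, and they cancel between \<open>u\<close> and \<open>- u\<close> if \<open>K\<close> lies in symmetric
slabs.\<close>

lemma ball_maximal_of_frame:
  fixes K :: "(real^'n) set" and T :: "real^'n^'n"
  assumes "tight_frame S c" and T: "invertible T" and sub: "(\<lambda>x. z + T *v x) ` unit_ball \<subseteq> K"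
    and K: "\<And>u x. u \<in> S \<Longrightarrow> x \<in> K \<Longrightarrow> u \<bullet> x \<le> 1"
    and z: "(\<Sum>u\<in>S. c u *\<^sub>R u) = 0 \<or> (\<forall>u\<in>S. \<forall>x\<in>K. - (u \<bullet> x) \<le> 1)"
  shows "\<bar>det T\<bar> \<le> 1"
proof -
  interpret tight_frame S c by fact
  obtain e \<mu> where e: "orthobasis e" "\<And>i. \<mu> i > 0" and det: "\<bar>det T\<bar> = prod \<mu> UNIV"
    and im: "(\<lambda>x. T *v x) ` unit_ball = diag_op e \<mu> ` unit_ball"
    using ellipsoid_normal_form[OF T] by blast
  let ?q = "\<lambda>u. \<Sum>k\<in>UNIV. \<mu> k * (u \<bullet> e k)\<^sup>2"
  have mem: "z + diag_op e \<mu> x \<in> K" if "norm x \<le> 1" for x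
  proof -
    have "diag_op e \<mu> x \<in> (\<lambda>x. T *v x) ` unit_ball"
      unfolding im using that by auto
    then show ?thesis
      using sub by auto
  qed
  have quad: "u \<bullet> diag_op e \<mu> u = ?q u" for u
    by (simp add: orthobasis_inner_expand[OF e(1), of u "diag_op e \<mu> u"] diag_op_inner[OF e(1)] power2_eq_square mult_ac)
  have le: "u \<bullet> z + ?q u \<le> 1" if "u \<in> S" for u
    using K[OF that mem[of u]] that by (simp add: norm_S inner_add_right quad)
  have "(\<Sum>u\<in>S. c u * ?q u) \<le> (\<Sum>u\<in>S. c u)"
    using z
  proof
    assume "(\<Sum>u\<in>S. c u *\<^sub>R u) = 0"
    moreover have "(\<Sum>u\<in>S. c u * (u \<bullet> z)) = (\<Sum>u\<in>S. c u *\<^sub>R u) \<bullet> z"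
      by (simp only: inner_sum_left inner_scaleR_left)
    ultimately have "(\<Sum>u\<in>S. c u * (u \<bullet> z)) = 0"
      by simp
    moreover have "(\<Sum>u\<in>S. c u * (u \<bullet> z + ?q u)) \<le> (\<Sum>u\<in>S. c u * 1)"
      using le c_pos by (intro sum_mono mult_left_mono) (auto simp: less_imp_le)
    ultimately show ?thesis
      by (simp only: distrib_left sum.distrib) simp
  next
    assume neg: "\<forall>u\<in>S. \<forall>x\<in>K. - (u \<bullet> x) \<le> 1"
    have "?q u \<le> 1" if "u \<in> S" for u
    proof -
      have "- (u \<bullet> (z + diag_op e \<mu> (- u))) \<le> 1"
        using neg that mem[of "- u"] by (simp add: norm_S)
      then have "- (u \<bullet> z) + ?q u \<le> 1"
        using linear_neg[OF linear_diag_op[of e \<mu>]] by (simp add: inner_add_right inner_diff_right quad)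
      with le[OF that] show ?thesis by linarith
    qed
    then have "(\<Sum>u\<in>S. c u * ?q u) \<le> (\<Sum>u\<in>S. c u * 1)"
      using c_pos by (intro sum_mono mult_left_mono) (auto simp: less_imp_le)
    then show ?thesis by simp
  qed
  moreover have "(\<Sum>u\<in>S. c u * ?q u) = sum \<mu> UNIV"
    by (rule frame_trace) (auto simp: orthobasis_norm_expand[OF e(1), symmetric] power2_norm_eq_inner e(1))
  ultimately have "sum \<mu> UNIV \<le> real CARD('n)"
    by (simp add: sum_c)
  then have "(\<Sum>k\<in>UNIV. \<mu> k - 1) \<le> 0"
    by (simp add: sum_subtractf)
  then have "exp (\<Sum>k\<in>UNIV. \<mu> k - 1) \<le> 1"
    by simp
  with prod_le_exp_sum_minus_one[of UNIV \<mu>] e(2) show ?thesis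
    unfolding det by (meson finite_code order_trans)
qed

section \<open>Ellipsoids of maximal volume\<close>

lemma measure_unit_ball_pos: "measure lborel (unit_ball :: (real^'n) set) > 0"
  by simp

lemma measure_ellipsoid:
  fixes T :: "real^'n^'n"
  assumes "invertible T"
  shows "measure lborel ((\<lambda>u. z + T *v u) ` unit_ball) = \<bar>det T\<bar> * measure lborel (unit_ball :: (real^'n) set)"
  by (rule measure_affine_image[OF assms]) simp

lemma ellipsoid_affine_image:
  fixes A :: "real^'n^'n"
  assumes A: "invertible A" and E: "ellipsoid E"
  shows "ellipsoid ((\<lambda>x. b + A *v x) ` E)"
proof -
  obtain z T where T: "invertible (T :: real^'n^'n)" "E = (\<lambda>u. z + T *v u) ` unit_ball"
    using E by (auto simp: ellipsoid_def)
  have "(\<lambda>x. b + A *v x) ` E = (\<lambda>u. (b + A *v z) + (A ** T) *v u) ` unit_ball"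
    by (simp add: T(2) image_image matrix_vector_right_distrib matrix_vector_mul_assoc add.assoc)
  moreover have "invertible (A ** T)"
    using A T(1) by (rule invertible_mult)
  ultimately show ?thesis
    unfolding ellipsoid_def by blast
qed

lemma sets_borel_ellipsoid: "ellipsoid E \<Longrightarrow> E \<in> sets borel"
  using sets_borel_affine_image[of _ unit_ball] by (auto simp: ellipsoid_def)

lemma measure_ellipsoid_pos:
  fixes E :: "(real^'n) set"
  assumes "ellipsoid E" shows "measure lborel E > 0"
proof -
  obtain z T where T: "invertible (T :: real^'n^'n)" "E = (\<lambda>u. z + T *v u) ` unit_ball"
    using assms by (auto simp: ellipsoid_def)
  then show ?thesis
    using measure_ellipsoid[OF T(1), of z] invertible_det_nz[of T] measure_unit_ball_pos by simp
qed

lemma ellipsoid_unit_ball: "ellipsoid (unit_ball :: (real^'n) set)"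
  unfolding ellipsoid_def
  by (rule exI[of _ 0], rule exI[of _ "mat 1"]) (simp add: invertible_det_nz)

definition max_ellipsoid :: "(real^'n) set \<Rightarrow> (real^'n) set \<Rightarrow> bool" where
  "max_ellipsoid K E \<longleftrightarrow> ellipsoid E \<and> E \<subseteq> K \<and>
     (\<forall>E'. ellipsoid E' \<longrightarrow> E' \<subseteq> K \<longrightarrow> measure lborel E' \<le> measure lborel E)"

lemma affine_image_inverse:
  fixes A :: "real^'n^'n"
  assumes "invertible A"
  shows "\<exists>A' b' . invertible (A' :: real^'n^'n) \<and> (\<forall>x. b' + A' *v (b + A *v x) = x) \<and> (\<forall>x. b + A *v (b' + A' *v x) = x)"
proof -
  obtain A' where A': "invertible A'" "\<And>x. A' *v (A *v x) = x" "\<And>x. A *v (A' *v x) = x"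
    using invertible_matrix_inverse[OF assms] by metis
  show ?thesis
    by (rule exI[of _ A'], rule exI[of _ "- (A' *v b)"]) (simp add: A' matrix_vector_right_distrib matrix_vector_mult_diff_distrib)
qed

lemma max_ellipsoid_affine_image:
  fixes A :: "real^'n^'n"
  assumes A: "invertible A" and K: "max_ellipsoid K E"
  shows "max_ellipsoid ((\<lambda>x. b + A *v x) ` K) ((\<lambda>x. b + A *v x) ` E)"
proof -
  obtain A' b' where A': "invertible (A' :: real^'n^'n)" "\<And>x. b' + A' *v (b + A *v x) = x" "\<And>x. b + A *v (b' + A' *v x) = x"
    using affine_image_inverse[OF A, of b] by metis
  have E: "ellipsoid E" "E \<subseteq> K" using K by (auto simp: max_ellipsoid_def)
  have "measure lborel E' \<le> measure lborel ((\<lambda>x. b + A *v x) ` E)"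
    if E': "ellipsoid E'" "E' \<subseteq> (\<lambda>x. b + A *v x) ` K" for E'
  proof -
    let ?F = "(\<lambda>x. b' + A' *v x) ` E'"
    have "ellipsoid ?F" "?F \<subseteq> K"
      using ellipsoid_affine_image[OF A'(1) E'(1)] E'(2) A'(2) by auto
    then have "measure lborel ?F \<le> measure lborel E"
      using K by (simp add: max_ellipsoid_def)
    then have "\<bar>det A\<bar> * measure lborel ?F \<le> \<bar>det A\<bar> * measure lborel E"
      by (rule mult_left_mono) simp
    moreover have "(\<lambda>x. b + A *v x) ` ?F = E'"
      by (simp add: image_image A'(3))
    then have "measure lborel E' = \<bar>det A\<bar> * measure lborel ?F"
      using measure_affine_image[OF A, of ?F b] sets_borel_ellipsoid[OF \<open>ellipsoid ?F\<close>] by simp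
    moreover have "measure lborel ((\<lambda>x. b + A *v x) ` E) = \<bar>det A\<bar> * measure lborel E"
      by (rule measure_affine_image[OF A sets_borel_ellipsoid[OF E(1)]])
    ultimately show ?thesis by simp
  qed
  then show ?thesis
    using ellipsoid_affine_image[OF A E(1)] E(2) unfolding max_ellipsoid_def by blast
qed

lemma upper_semicont_closed_hypograph:
  fixes f :: "'a::topological_space \<Rightarrow> real"
  assumes "upper_semicont f"
  shows "closed {(a, x). a \<le> f x}"
proof -
  have "open (- {(a, x). a \<le> f x})"
    unfolding open_subopen[of "- {(a, x). a \<le> f x}"]
  proof
    fix p assume "p \<in> - {(a, x). a \<le> f x}"
    then obtain a x where p: "p = (a, x)" "f x < a"
      by (cases p) (auto simp: not_le)
    then obtain y where y: "f x < y" "y < a"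
      using dense by blast
    have "\<forall>\<^sub>F z in nhds x. f z < y"
      using assms y(1) by (simp add: upper_semicont_def)
    then obtain V where V: "open V" "x \<in> V" "\<And>z. z \<in> V \<Longrightarrow> f z < y"
      by (auto simp: eventually_nhds)
    have "open ({y<..} \<times> V)" "p \<in> {y<..} \<times> V"
      using V y p by (auto intro: open_Times)
    moreover have "{y<..} \<times> V \<subseteq> - {(a, x). a \<le> f x}"
      using V(3) by fastforce
    ultimately show "\<exists>T. open T \<and> p \<in> T \<and> T \<subseteq> - {(a, x). a \<le> f x}"
      by blast
  qed
  then show ?thesis
    by (simp add: closed_def)
qed

lemma upper_semicont_closed_levels:
  fixes f :: "'a::topological_space \<Rightarrow> real"
  assumes "upper_semicont f" shows "closed {x. a \<le> f x}"
proof -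
  have "closed ((\<lambda>x. (a, x)) -` {(a, x). a \<le> f x})"
    by (intro closed_vimage upper_semicont_closed_hypograph assms continuous_intros)
  then show ?thesis
    by (simp add: vimage_def)
qed

lemma norm_matrix_le:
  fixes T :: "real^'n^'n"
  assumes "\<And>j. norm (T *v axis j 1) \<le> C"
  shows "norm T \<le> real CARD('n) * (real CARD('n) * C)"
proof -
  have comp: "\<bar>T $ i $ j\<bar> \<le> C" for i j
  proof -
    have "T $ i $ j = (T *v axis j 1) $ i"
      by (simp add: matrix_vector_mul_component inner_axis)
    then show ?thesis
      using component_le_norm_cart[of "T *v axis j 1" i] assms[of j] by simp
  qed
  have "norm (T $ i) \<le> real CARD('n) * C" for i
  proof -
    have "norm (T $ i) \<le> (\<Sum>j\<in>UNIV. \<bar>T $ i $ j\<bar>)"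
      by (rule norm_le_l1_cart)
    also have "\<dots> \<le> real CARD('n) * C"
      using sum_bounded_above[of UNIV "\<lambda>j. \<bar>T $ i $ j\<bar>" C] comp by simp
    finally show ?thesis .
  qed
  moreover have "norm T \<le> (\<Sum>i\<in>UNIV. norm (T $ i))"
    unfolding norm_vec_def by (rule L2_set_le_sum) simp
  ultimately show ?thesis
    using sum_bounded_above[of UNIV "\<lambda>i. norm (T $ i)" "real CARD('n) * C"] by simp
qed

lemma continuous_on_det: "continuous_on A (\<lambda>x. det (g x))"
  if "continuous_on A g" for g :: "'b::topological_space \<Rightarrow> real^'n^'n"
  unfolding det_def by (intro continuous_intros that)

text \<open>Upper semicontinuity makes the set of admissible triples \<open>(a, z, T)\<close> closed, and the bounded level makes
it bounded. Singular matrices \<open>T\<close> are admitted here because otherwise the set would not be closed.\<close>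

lemma maximal_ellipsoid_below_exists:
  fixes f :: "real^'n \<Rightarrow> real" and T\<^sub>0 :: "real^'n^'n"
  assumes usc: "upper_semicont f" and bd: "bounded {x. \<tau> \<le> f x}" and M: "\<And>x. f x \<le> M"
    and feas: "\<tau> \<le> a\<^sub>0" "\<And>w. norm w \<le> 1 \<Longrightarrow> a\<^sub>0 \<le> f (z\<^sub>0 + T\<^sub>0 *v w)"
  shows "\<exists>a z (T :: real^'n^'n). \<tau> \<le> a \<and> (\<forall>w. norm w \<le> 1 \<longrightarrow> a \<le> f (z + T *v w)) \<and>
    (\<forall>a' z' (T' :: real^'n^'n). \<tau> \<le> a' \<longrightarrow> (\<forall>w. norm w \<le> 1 \<longrightarrow> a' \<le> f (z' + T' *v w)) \<longrightarrow> a' * \<bar>det T'\<bar> \<le> a * \<bar>det T\<bar>)"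
proof -
  define X :: "(real \<times> (real^'n) \<times> (real^'n^'n)) set" where
    "X = {(a, z, T). \<tau> \<le> a \<and> (\<forall>w. norm w \<le> 1 \<longrightarrow> a \<le> f (z + T *v w))}"
  have "X = {p. \<tau> \<le> fst p} \<inter> (\<Inter>w\<in>unit_ball. (\<lambda>p. (fst p, fst (snd p) + snd (snd p) *v w)) -` {(a, x). a \<le> f x})"
    by (auto simp: X_def)
  moreover have cl: "closed ((\<lambda>p :: real \<times> (real^'n) \<times> (real^'n^'n). (fst p, fst (snd p) + snd (snd p) *v w)) -` {(a, x). a \<le> f x})" for w
  proof (intro closed_vimage upper_semicont_closed_hypograph usc)
    have "(\<lambda>p :: real \<times> (real^'n) \<times> (real^'n^'n). (fst p, fst (snd p) + snd (snd p) *v w)) =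
        (\<lambda>p. (fst p, fst (snd p) + (\<chi> i. \<Sum>j\<in>UNIV. snd (snd p) $ i $ j * w $ j)))"
      by (simp add: matrix_vector_mult_def)
    then show "continuous_on UNIV (\<lambda>p :: real \<times> (real^'n) \<times> (real^'n^'n). (fst p, fst (snd p) + snd (snd p) *v w))"
      by (simp only:) (intro continuous_intros)
  qed
  have "closed {p :: real \<times> (real^'n) \<times> (real^'n^'n). \<tau> \<le> fst p}"
    by (intro closed_Collect_le continuous_intros)
  then have "closed ({p. \<tau> \<le> fst p} \<inter> (\<Inter>w\<in>unit_ball. (\<lambda>p :: real \<times> (real^'n) \<times> (real^'n^'n). (fst p, fst (snd p) + snd (snd p) *v w)) -` {(a, x). a \<le> f x}))"
    by (rule closed_Int[OF _ closed_INT]) (intro ballI cl)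
  ultimately have "closed X"
    by (simp only:)
  moreover have "bounded X"
  proof -
    obtain C where C: "\<And>x. \<tau> \<le> f x \<Longrightarrow> norm x \<le> C"
      using bd by (auto simp: bounded_iff)
    have "X \<subseteq> {\<tau>..M} \<times> cball 0 C \<times> cball 0 (real CARD('n) * (real CARD('n) * (C + C)))"
    proof
      fix p assume "p \<in> X"
      then obtain a z and T :: "real^'n^'n" where p: "p = (a, z, T)"
        and a: "\<tau> \<le> a" "\<forall>w. norm w \<le> 1 \<longrightarrow> a \<le> f (z + T *v w)"
        by (auto simp: X_def)
      have z: "norm z \<le> C"
        using a(2)[rule_format, of 0] a(1) by (intro C) simp
      have "norm (T *v axis j 1) \<le> C + C" for j
      proof -
        have "norm (z + T *v axis j 1) \<le> C"
          using a(2)[rule_format, of "axis j 1"] a(1) by (intro C) simp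
        then show ?thesis
          using z norm_triangle_ineq4[of "z + T *v axis j 1" z] by simp
      qed
      then have "norm T \<le> real CARD('n) * (real CARD('n) * (C + C))"
        by (rule norm_matrix_le)
      moreover have "a \<le> M"
        using a(2)[rule_format, of 0] M[of z] by simp
      ultimately show "p \<in> {\<tau>..M} \<times> cball 0 C \<times> cball 0 (real CARD('n) * (real CARD('n) * (C + C)))"
        using z a(1) by (simp add: p)
    qed
    then show ?thesis
      by (rule bounded_subset[rotated]) (intro bounded_Times bounded_closed_interval bounded_cball)
  qed
  ultimately have "compact X"
    by (simp add: compact_eq_bounded_closed)
  moreover have "(a\<^sub>0, z\<^sub>0, T\<^sub>0) \<in> X"
    using feas by (simp add: X_def)
  then have "X \<noteq> {}" by blast
  moreover have "continuous_on X (\<lambda>p. fst p * \<bar>det (snd (snd p))\<bar>)"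
    by (intro continuous_intros continuous_on_det)
  ultimately obtain p where p: "p \<in> X" "\<And>q. q \<in> X \<Longrightarrow> fst q * \<bar>det (snd (snd q))\<bar> \<le> fst p * \<bar>det (snd (snd p))\<bar>"
    using continuous_attains_sup[of X "\<lambda>p. fst p * \<bar>det (snd (snd p))\<bar>"] by blast
  obtain a z T where pe: "p = (a, z, T)" by (cases p)
  show ?thesis
  proof (intro exI[of _ a] exI[of _ z] exI[of _ T] conjI allI impI)
    fix a' z' and T' :: "real^'n^'n"
    assume "\<tau> \<le> a'" "\<forall>w. norm w \<le> 1 \<longrightarrow> a' \<le> f (z' + T' *v w)"
    then have "(a', z', T') \<in> X"
      by (simp add: X_def)
    from p(2)[OF this] show "a' * \<bar>det T'\<bar> \<le> a * \<bar>det T\<bar>"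
      by (simp add: pe)
  qed (use p(1) in \<open>auto simp: pe X_def\<close>)
qed

text \<open>The special case of an indicator function, in which the height is forced to be one.\<close>

lemma max_ellipsoid_exists:
  fixes K :: "(real^'n) set"
  assumes K: "compact K" and int: "interior K \<noteq> {}"
  shows "\<exists>E. max_ellipsoid K E"
proof -
  let ?f = "indicator K :: _ \<Rightarrow> real"
  have f1: "1 \<le> ?f x \<longleftrightarrow> x \<in> K" for x
    by (simp add: indicator_def)
  have usc: "upper_semicont ?f"
    unfolding upper_semicont_def
  proof (intro allI impI)
    fix x y assume "?f x < y"
    show "\<forall>\<^sub>F z in nhds x. ?f z < y"
    proof (cases "x \<in> K")
      case True
      then show ?thesis
        using \<open>?f x < y\<close> by (auto simp: indicator_def intro!: always_eventually)
    next
      case False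
      then have "\<forall>\<^sub>F z in nhds x. z \<in> - K"
        using compact_imp_closed[OF K] by (intro eventually_nhds_in_open) auto
      then show ?thesis
        by (rule eventually_mono) (use \<open>?f x < y\<close> False in \<open>auto simp: indicator_def\<close>)
    qed
  qed
  obtain x r where r: "r > 0" "cball x r \<subseteq> K"
    using int by (meson ex_in_conv mem_interior_cball)
  let ?T = "matrix ((*\<^sub>R) r) :: real^'n^'n"
  have T: "?T *v w = r *\<^sub>R w" for w
    by (rule matrix_scaleR_mult)
  have det: "det ?T = r ^ CARD('n)"
    by (rule det_matrix_scaleR)
  have feas: "1 \<le> ?f (x + ?T *v w)" if "norm w \<le> 1" for w
  proof -
    have "x + r *\<^sub>R w \<in> cball x r"
      using r(1) that by (simp add: dist_norm mult_left_le)
    then show ?thesis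
      using r(2) unfolding f1 T by blast
  qed
  have "\<exists>a z (T :: real^'n^'n). 1 \<le> a \<and> (\<forall>w. norm w \<le> 1 \<longrightarrow> a \<le> ?f (z + T *v w)) \<and>
    (\<forall>a' z' (T' :: real^'n^'n). 1 \<le> a' \<longrightarrow> (\<forall>w. norm w \<le> 1 \<longrightarrow> a' \<le> ?f (z' + T' *v w)) \<longrightarrow> a' * \<bar>det T'\<bar> \<le> a * \<bar>det T\<bar>)"
  proof (rule maximal_ellipsoid_below_exists[OF usc])
    show "bounded {x. 1 \<le> ?f x}"
      unfolding f1 using compact_imp_bounded[OF K] by simp
    show "?f x \<le> 1" for x by (simp add: indicator_def)
    show "(1::real) \<le> 1" by simp
    show "1 \<le> ?f (x + ?T *v w)" if "norm w \<le> 1" for w by (rule feas[OF that])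
  qed
  then obtain a z and T :: "real^'n^'n" where a: "1 \<le> a" "\<And>w. norm w \<le> 1 \<Longrightarrow> a \<le> ?f (z + T *v w)"
    and max: "\<And>a' z' (T' :: real^'n^'n). 1 \<le> a' \<Longrightarrow> (\<And>w. norm w \<le> 1 \<Longrightarrow> a' \<le> ?f (z' + T' *v w)) \<Longrightarrow> a' * \<bar>det T'\<bar> \<le> a * \<bar>det T\<bar>"
    by metis
  have "a \<le> ?f z"
    using a(2)[of 0] by simp
  then have a1: "a = 1"
    using a(1) by (cases "z \<in> K") auto
  have "1 * \<bar>det ?T\<bar> \<le> a * \<bar>det T\<bar>"
    using feas by (intro max) auto
  then have "det T \<noteq> 0"
    using zero_less_power[OF r(1), of "CARD('n)"] det a1 by auto
  then have inv: "invertible T" by (simp add: invertible_det_nz)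
  let ?E = "(\<lambda>u. z + T *v u) ` unit_ball"
  have "max_ellipsoid K ?E"
    unfolding max_ellipsoid_def
  proof (intro conjI allI impI)
    show "ellipsoid ?E" using inv by (auto simp: ellipsoid_def)
    show "?E \<subseteq> K"
      using a(2) a1 f1 by auto
    fix E' :: "(real^'n) set" assume E': "ellipsoid E'" "E' \<subseteq> K"
    then obtain z' T' where T': "invertible (T' :: real^'n^'n)" "E' = (\<lambda>u. z' + T' *v u) ` unit_ball"
      by (auto simp: ellipsoid_def)
    have "1 * \<bar>det T'\<bar> \<le> a * \<bar>det T\<bar>"
    proof (rule max)
      show "1 \<le> ?f (z' + T' *v w)" if "norm w \<le> 1" for w
        using E'(2) that unfolding f1 T'(2) by auto
    qed simp
    then show "measure lborel E' \<le> measure lborel ?E"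
      by (simp add: T'(2) measure_ellipsoid[OF T'(1)] measure_ellipsoid[OF inv] a1 mult_right_mono)
  qed
  then show ?thesis by blast
qed

section \<open>The volume ratio of a convex body\<close>

text \<open>Otherwise \<open>interior C - K\<close> would be a nonempty open set of measure zero.\<close>

lemma closed_subset_eq_of_emeasure:
  fixes K C :: "'a::euclidean_space set"
  assumes K: "closed K" "K \<subseteq> C" and C: "convex C" "closed C" "interior C \<noteq> {}"
    and eq: "emeasure lborel K = emeasure lborel C" "emeasure lborel C \<noteq> \<infinity>"
  shows "K = C"
proof -
  let ?V = "interior C - K"
  have "open ?V"
    using K(1) by (simp add: open_Diff)
  have "emeasure lborel (C - K) = emeasure lborel C - emeasure lborel K"
    using K C(2) eq by (intro emeasure_Diff) auto
  also have "\<dots> = 0"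
    using eq by simp
  finally have "emeasure lborel (C - K) = 0" .
  moreover have "emeasure lborel ?V \<le> emeasure lborel (C - K)"
    using K(1) C(2) interior_subset[of C] by (intro emeasure_mono) auto
  ultimately have "emeasure lborel ?V = 0"
    by simp
  then have "?V \<in> null_sets lebesgue"
    using \<open>open ?V\<close> by (intro null_sets_completionI) (auto simp: null_sets_def)
  then have "negligible ?V"
    by (simp add: negligible_iff_null_sets)
  then have "?V = {}"
    using open_not_negligible[OF \<open>open ?V\<close>] by blast
  then have "interior C \<subseteq> K" by blast
  then have "closure (interior C) \<subseteq> K"
    using K(1) by (rule closure_minimal)
  then have "C \<subseteq> K"
    using convex_closure_interior[OF C(1,3)] C(2) by simp
  with K(2) show ?thesis by blast
qed

lemma compact_affine_image:
  fixes A :: "real^'n^'n"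
  assumes "compact K" shows "compact ((\<lambda>x. b + A *v x) ` K)"
  by (intro compact_continuous_image continuous_intros assms matrix_vector_mult_linear_continuous_on)

lemma convex_affine_image:
  fixes A :: "real^'n^'n"
  assumes "convex K" shows "convex ((\<lambda>x. b + A *v x) ` K)"
proof -
  have "convex ((+) b ` (\<lambda>x. A *v x) ` K)"
    by (intro convex_translation convex_linear_image assms) simp
  then show ?thesis
    by (simp add: image_image)
qed

lemma interior_ne_of_ball: "unit_ball \<subseteq> K \<Longrightarrow> interior K \<noteq> {}"
  by (metis centre_in_ball empty_iff interior_cball interior_mono subsetD zero_less_one)

lemma normalise_max_ellipsoid:
  fixes K :: "(real^'n) set"
  assumes K: "compact K" "convex K" and E: "max_ellipsoid K ((\<lambda>u. z + T *v u) ` unit_ball)" and T: "invertible T"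
  obtains L where "compact L" "convex L" "unit_ball \<subseteq> L" "K = (\<lambda>u. z + T *v u) ` L"
    "\<And>z' (T' :: real^'n^'n). invertible T' \<Longrightarrow> (\<lambda>x. z' + T' *v x) ` unit_ball \<subseteq> L \<Longrightarrow> \<bar>det T'\<bar> \<le> 1"
    "\<And>x. x \<in> L \<longleftrightarrow> z + T *v x \<in> K"
proof -
  obtain T' z' where I: "invertible (T' :: real^'n^'n)" "\<And>x. z' + T' *v (z + T *v x) = x" "\<And>x. z + T *v (z' + T' *v x) = x"
    using affine_image_inverse[OF T, of z] by metis
  define L where "L = (\<lambda>u. z' + T' *v u) ` K"
  have mem: "x \<in> L \<longleftrightarrow> z + T *v x \<in> K" for x
    unfolding L_def using I(2,3) by (metis (no_types, lifting) imageE image_eqI)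
  have max: "max_ellipsoid L unit_ball"
    using max_ellipsoid_affine_image[OF I(1) E, of z'] by (simp add: L_def image_image I(2))
  have "\<bar>det R\<bar> \<le> 1" if R: "invertible R" "(\<lambda>x. y + R *v x) ` unit_ball \<subseteq> L" for y and R :: "real^'n^'n"
  proof -
    have "ellipsoid ((\<lambda>x. y + R *v x) ` unit_ball)"
      using R(1) by (auto simp: ellipsoid_def)
    then have "measure lborel ((\<lambda>x. y + R *v x) ` unit_ball) \<le> measure lborel (unit_ball :: (real^'n) set)"
      using max R(2) by (simp add: max_ellipsoid_def)
    then show ?thesis
      using measure_unit_ball_pos[where 'n='n] by (simp add: measure_ellipsoid[OF R(1)] mult_le_cancel_right2)
  qed
  moreover have "K = (\<lambda>u. z + T *v u) ` L"
    by (simp add: L_def image_image I(3))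
  moreover have "compact L" "convex L"
    unfolding L_def by (intro compact_affine_image convex_affine_image K)+
  moreover have "unit_ball \<subseteq> L"
    using max by (simp add: max_ellipsoid_def)
  ultimately show ?thesis
    using that mem by blast
qed

lemma emeasure_simplex_polytope:
  fixes R :: "(real^'n) set"
  assumes R: "simplex_frame R"
  shows "emeasure lborel (polar_polytope R) \<noteq> \<infinity>" "emeasure lborel (polar_polytope R) \<noteq> 0"
    "cone_constant TYPE('n) \<noteq> 0" "cone_constant TYPE('n) \<noteq> \<infinity>"
proof -
  let ?m = "emeasure lborel (polar_polytope R)" and ?Z = "cone_constant TYPE('n)"
  have eq: "?Z * ?m = 1"
    by (rule simplex_frame_volume[OF R])
  then show "?m \<noteq> 0" "?Z \<noteq> 0" by auto
  then show "?m \<noteq> \<infinity>" "?Z \<noteq> \<infinity>"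
    using eq by (auto simp: ennreal_mult_top ennreal_top_mult)
qed

text \<open>Ball's volume ratio theorem. In the position where the unit ball is the maximal ellipsoid, the body lies in
the polytope of the contact frame, whose volume is at most that of the regular simplex by the
Brascamp-Lieb inequality on the cone. In the case of equality the frame is a simplex frame and the body
fills the polytope.\<close>

theorem volume_ratio_simplex:
  fixes K R :: "(real^'n) set"
  assumes K: "compact K" "convex K" and E: "max_ellipsoid K E" and R: "simplex_frame R"
  shows "measure lborel K * measure lborel (unit_ball :: (real^'n) set) \<le> measure lborel (polar_polytope R) * measure lborel E"
    and "measure lborel K * measure lborel (unit_ball :: (real^'n) set) = measure lborel (polar_polytope R) * measure lborel E \<Longrightarrow>
      \<exists>(A :: real^'n^'n) b. invertible A \<and> K = (\<lambda>x. b + A *v x) ` polar_polytope R"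
proof -
  obtain z T where T: "invertible (T :: real^'n^'n)" "E = (\<lambda>u. z + T *v u) ` unit_ball"
    using E by (auto simp: max_ellipsoid_def ellipsoid_def)
  obtain L where L: "compact L" "convex L" "unit_ball \<subseteq> L" "K = (\<lambda>u. z + T *v u) ` L"
    and max: "\<And>z' (T' :: real^'n^'n). invertible T' \<Longrightarrow> (\<lambda>x. z' + T' *v x) ` unit_ball \<subseteq> L \<Longrightarrow> \<bar>det T'\<bar> \<le> 1"
    by (rule normalise_max_ellipsoid[OF K E[unfolded T(2)] T(1)]) metis
  have "\<exists>S c. tight_frame S c \<and> (\<Sum>u\<in>S. c u *\<^sub>R u) = 0 \<and> (\<forall>u\<in>S. \<forall>x\<in>L. u \<bullet> x \<le> 1)"
    by (rule john_decomposition[OF L(1-3)]) (rule max)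
  then obtain S c where S: "tight_frame S c" "(\<Sum>u\<in>S. c u *\<^sub>R u) = 0" "\<And>u x. u \<in> S \<Longrightarrow> x \<in> L \<Longrightarrow> u \<bullet> x \<le> 1"
    by metis
  interpret centred_frame S c
    using S(1,2) by (simp add: centred_frame_def centred_frame_axioms_def)
  let ?PS = "polar_polytope S" and ?PR = "polar_polytope R" and ?Z = "cone_constant TYPE('n)"
  have LS: "L \<subseteq> ?PS"
    using S(3) by (auto simp: polar_polytope_def)
  note Zfin = emeasure_simplex_polytope[OF R]
  have le: "emeasure lborel ?PS \<le> emeasure lborel ?PR"
  proof -
    have "?Z * emeasure lborel ?PS \<le> ?Z * emeasure lborel ?PR"
      using cone_bound simplex_frame_volume[OF R] by simp
    then show ?thesis
      using Zfin by (simp add: ennreal_mult_le_mult_iff)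
  qed
  have LPS: "emeasure lborel L \<le> emeasure lborel ?PS"
    using LS borel_closed[OF closed_polar_polytope] by (intro emeasure_mono) auto
  then have le2: "emeasure lborel L \<le> emeasure lborel ?PR"
    using le by simp
  have fin: "emeasure lborel L \<noteq> \<infinity>"
    using le2 Zfin(1) by (auto simp: top_unique)
  have leL: "measure lborel L \<le> measure lborel ?PR"
    unfolding measure_def using le2 Zfin(1) by (intro enn2real_mono) (auto simp: less_top)
  have mK: "measure lborel K = \<bar>det T\<bar> * measure lborel L"
    using L(1,4) by (simp add: measure_affine_image[OF T(1)] compact_imp_closed)
  have mE: "measure lborel E = \<bar>det T\<bar> * measure lborel (unit_ball :: (real^'n) set)"
    by (simp add: T(2) measure_ellipsoid[OF T(1)])
  have detT: "\<bar>det T\<bar> > 0"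
    using T(1) by (simp add: invertible_det_nz)
  have Bpos: "measure lborel (unit_ball :: (real^'n) set) > 0"
    by (rule measure_unit_ball_pos)
  show "measure lborel K * measure lborel (unit_ball :: (real^'n) set) \<le> measure lborel ?PR * measure lborel E"
    using mult_left_mono[OF leL, of "\<bar>det T\<bar> * measure lborel (unit_ball :: (real^'n) set)"] detT Bpos
    unfolding mK mE by (simp add: mult_ac)
  assume "measure lborel K * measure lborel (unit_ball :: (real^'n) set) = measure lborel ?PR * measure lborel E"
  then have "measure lborel L = measure lborel ?PR"
    unfolding mK mE using detT Bpos by simp
  then have eqR: "emeasure lborel L = emeasure lborel ?PR"
    using fin Zfin(1) by (metis emeasure_eq_ennreal_measure infinity_ennreal_def)
  then have eqS: "emeasure lborel L = emeasure lborel ?PS"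
    using LPS le by simp
  have "simplex_frame S"
    by (rule simplex_frame_of_equality) (simp add: eqS[symmetric] eqR simplex_frame_volume[OF R])
  then obtain A :: "real^'n^'n" where A: "invertible A" "(\<lambda>x. A *v x) ` ?PR = ?PS"
    using simplex_frames_equivalent[OF R] by blast
  have "convex ?PS"
    by (rule convex_polar_polytope)
  moreover have "interior ?PS \<noteq> {}"
    using L(3) LS by (intro interior_ne_of_ball) blast
  ultimately have "L = ?PS"
    using closed_subset_eq_of_emeasure[OF compact_imp_closed[OF L(1)] LS _ closed_polar_polytope _ eqS] fin eqS by simp
  then have "K = (\<lambda>x. z + (T ** A) *v x) ` ?PR"
    by (simp add: L(4) A(2)[symmetric] image_image matrix_vector_mul_assoc)
  moreover have "invertible (T ** A)"
    using T(1) A(1) by (rule invertible_mult)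
  ultimately show "\<exists>(A :: real^'n^'n) b. invertible A \<and> K = (\<lambda>x. b + A *v x) ` ?PR"
    by blast
qed

lemma max_ellipsoid_simplex:
  fixes R :: "(real^'n) set"
  assumes R: "simplex_frame R"
  shows "max_ellipsoid (polar_polytope R) unit_ball"
proof -
  interpret centred_frame R "\<lambda>_. real CARD('n) / (real CARD('n) + 1)"
    by (rule simplex_frame_centred[OF R])
  have "unit_ball \<subseteq> polar_polytope R"
  proof
    fix x :: "real^'n" assume "x \<in> unit_ball"
    then have "u \<bullet> x \<le> 1" if "u \<in> R" for u
      using norm_cauchy_schwarz[of u x] norm_S[OF that] by simp
    then show "x \<in> polar_polytope R"
      by (simp add: polar_polytope_def)
  qed
  moreover have "measure lborel E \<le> measure lborel (unit_ball :: (real^'n) set)"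
    if E: "ellipsoid E" "E \<subseteq> polar_polytope R" for E
  proof -
    obtain z T where T: "invertible (T :: real^'n^'n)" "E = (\<lambda>u. z + T *v u) ` unit_ball"
      using E(1) by (auto simp: ellipsoid_def)
    have "\<bar>det T\<bar> \<le> 1"
      by (rule ball_maximal_of_frame[OF tight_frame_axioms T(1) E(2)[unfolded T(2)]])
         (use centred in \<open>auto simp: polar_polytope_def\<close>)
    then show ?thesis
      by (simp add: T(2) measure_ellipsoid[OF T(1)] mult_left_le_one_le)
  qed
  ultimately show ?thesis
    unfolding max_ellipsoid_def using ellipsoid_unit_ball by blast
qed

section \<open>Symmetric bodies and the cube\<close>

text \<open>The intersection of symmetric slabs with unit normals in \<open>S\<close>.\<close>

definition slab_body :: "(real^'n) set \<Rightarrow> (real^'n) set" where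
  "slab_body S = {x. \<forall>u\<in>S. \<bar>u \<bullet> x\<bar> \<le> 1}"

definition slab_interior :: "(real^'n) set \<Rightarrow> (real^'n) set" where
  "slab_interior S = {x. \<forall>u\<in>S. \<bar>u \<bullet> x\<bar> < 1}"

lemma slab_eq: "slab_body S = polar_polytope (S \<union> uminus ` S)"
  by (auto simp: slab_body_def polar_polytope_def abs_le_iff ball_Un)

lemma slab_interior_eq: "slab_interior S = polar_interior (S \<union> uminus ` S)"
  by (auto simp: slab_interior_def polar_interior_def abs_less_iff ball_Un)

context tight_frame
begin

sublocale C: frame_transport S c "{-1<..<1}" unif_transport unif_transport'
  by (rule frame_transport_unif[OF tight_frame_axioms])

end

text \<open>For the uniform density the Brascamp-Lieb integrand is constant, as the weights add up to the dimension.\<close>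

lemma slab_nn_integral:
  fixes S :: "(real^'n) set"
  assumes "tight_frame S c"
  defines "U \<equiv> frame_transport.U S {-1<..<1}" and "W0 \<equiv> frame_transport.W0 S c unif_transport unif_transport'"
  shows "(\<integral>\<^sup>+x. ennreal (indicator U x * W0 x) \<partial>lborel) = ennreal ((1/2) ^ CARD('n)) * emeasure lborel (slab_body S)"
proof -
  interpret tight_frame S c by fact
  have U: "C.U = slab_interior S"
    by (auto simp: C.U_def slab_interior_def abs_less_iff)
  have "C.W0 x = exp (\<Sum>u\<in>S. c u * ln (1/2))" for x
    unfolding C.W0_def unif_transport'_def using std_normal_density_pos less_imp_neq[OF std_normal_density_pos, symmetric]
    by (intro arg_cong[where f=exp] sum.cong) auto
  also have "(\<Sum>u\<in>S. c u * ln (1/2)) = real CARD('n) * ln (1/2)"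
    by (simp only: sum_distrib_right[symmetric] sum_c DIM_cart DIM_real mult_1_right)
  also have "exp (real CARD('n) * ln (1/2)) = (1/2 :: real) ^ CARD('n)"
    by (subst exp_of_nat_mult) simp
  finally have W0: "C.W0 x = (1/2) ^ CARD('n)" for x .
  have "(\<integral>\<^sup>+x. ennreal (indicator C.U x * C.W0 x) \<partial>lborel) =
      (\<integral>\<^sup>+x. ennreal ((1/2) ^ CARD('n)) * indicator (slab_interior S) x \<partial>lborel)"
    by (intro nn_integral_cong) (simp add: W0 U indicator_def)
  also have "\<dots> = ennreal ((1/2) ^ CARD('n)) * emeasure lborel (slab_interior S)"
    using C.open_U by (intro nn_integral_cmult_indicator) (simp add: U)
  also have "emeasure lborel (slab_interior S) = emeasure lborel (slab_body S)"
    unfolding slab_eq slab_interior_eq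
    by (rule emeasure_polar_polytope[symmetric]) (use finite_S norm_S in fastforce)+
  finally show ?thesis
    by (simp add: U_def W0_def)
qed

lemma slab_bound:
  fixes S :: "(real^'n) set"
  assumes "tight_frame S c"
  shows "emeasure lborel (slab_body S) \<le> ennreal (2 ^ CARD('n))"
proof -
  interpret tight_frame S c by fact
  have "ennreal ((1/2) ^ CARD('n)) * emeasure lborel (slab_body S) \<le> 1"
    using C.brascamp_lieb by (simp add: slab_nn_integral[OF assms])
  then have "ennreal (2 ^ CARD('n)) * (ennreal ((1/2) ^ CARD('n)) * emeasure lborel (slab_body S)) \<le> ennreal (2 ^ CARD('n)) * 1"
    by (rule mult_left_mono) simp
  then show ?thesis
    by (simp add: mult.assoc[symmetric] ennreal_mult[symmetric] power_mult_distrib[symmetric])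
qed

lemma slab_equality:
  fixes S :: "(real^'n) set"
  assumes tf: "tight_frame S c" and eq: "emeasure lborel (slab_body S) = ennreal (2 ^ CARD('n))"
    and "u \<in> S" "w \<in> S" "u \<noteq> w" "u \<noteq> - w"
  shows "u \<bullet> w = 0"
proof -
  interpret tight_frame S c by fact
  have "(\<integral>\<^sup>+x. ennreal (indicator C.U x * C.W0 x) \<partial>lborel) = 1"
    by (simp add: slab_nn_integral[OF tf] eq ennreal_mult[symmetric] power_mult_distrib[symmetric])
  then have "unif_transport (v \<bullet> x) = v \<bullet> C.\<Phi> x" if "x \<in> C.U" "v \<in> S" for x v
    using that by (rule C.brascamp_lieb_equality)
  then show ?thesis
    by (rule C.orthogonal_of_common_value[of 0])
       (use assms(3-) unif_transport'_nonconst in \<open>auto simp: C.U_def\<close>)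
qed

text \<open>Any two normals are orthogonal or equal up to sign, so a maximal independent set of normals is an
orthonormal basis that contains every normal up to sign.\<close>

lemma slab_orthonormal_of_equality:
  fixes S :: "(real^'n) set"
  assumes tf: "tight_frame S c" and eq: "emeasure lborel (slab_body S) = ennreal (2 ^ CARD('n))"
  shows "\<exists>e. orthobasis e \<and> slab_body S = slab_body (range e)"
proof -
  interpret tight_frame S c by fact
  obtain B where B: "B \<subseteq> S" "independent B" "S \<subseteq> span B"
    using maximal_independent_subset[of S] by metis
  have orth: "u \<bullet> w = 0" if "u \<in> B" "w \<in> B" "u \<noteq> w" for u w
  proof (rule slab_equality[OF tf eq])
    show "u \<noteq> - w"
    proof
      assume "u = - w"
      then have "u \<in> span (B - {u})"
        using that by (simp add: span_neg span_base)
      then show False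
        using B(2) that(1) by (simp add: dependent_def)
    qed
  qed (use that B(1) in auto)
  have "x \<in> span B" for x
  proof -
    have "(\<Sum>u\<in>S. (c u * (u \<bullet> x)) *\<^sub>R u) \<in> span B"
      using B(3) by (intro span_sum span_scale) blast
    then show ?thesis by (simp only: frame)
  qed
  then have spanB: "span B = UNIV" by blast
  then have "card B = CARD('n)"
    using B(2) dim_eq_card[of B UNIV] by (simp add: dim_UNIV)
  moreover have "finite B"
    using B(1) finite_S finite_subset by blast
  moreover have "pairwise orthogonal B"
    using orth by (auto simp: pairwise_def orthogonal_def)
  moreover have "norm b = 1" if "b \<in> B" for b
    using that B(1) norm_S by blast
  ultimately obtain e :: "'n \<Rightarrow> real^'n" where e: "orthobasis e" "range e = B"
    using orthobasis_of_set by metis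
  have "u \<in> B \<or> - u \<in> B" if u: "u \<in> S" for u
  proof (rule ccontr)
    assume no: "\<not> (u \<in> B \<or> - u \<in> B)"
    have "u \<bullet> b = 0" if "b \<in> B" for b
      by (rule slab_equality[OF tf eq u]) (use that no B(1) in auto)
    then have "u \<bullet> e i = 0 \<bullet> e i" for i
      using e(2) by auto
    then have "u = 0"
      by (rule orthobasis_eqI[OF e(1)])
    then show False
      using norm_S[OF u] by simp
  qed
  then have "slab_body S = slab_body B"
    using B(1) by (auto simp: slab_body_def) (metis abs_minus_cancel inner_minus_left)
  with e show ?thesis by blast
qed

lemma slab_orthobasis:
  assumes e: "orthobasis e"
  shows "\<exists>A :: real^'n^'n. invertible A \<and> slab_body (range e) = (\<lambda>x. A *v x) ` unit_cube"
proof -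
  have "slab_body (range e) = (\<lambda>x. transpose (basis_matrix e) *v x) ` unit_cube"
  proof (intro equalityI subsetI)
    fix x assume "x \<in> slab_body (range e)"
    then have "(\<chi> i. x \<bullet> e i) \<in> unit_cube"
      by (auto simp: slab_body_def unit_cube_def abs_le_iff inner_commute)
    moreover have "x = transpose (basis_matrix e) *v (\<chi> i. x \<bullet> e i)"
      by (simp add: transpose_basis_matrix_mult orthobasis_expand[OF e])
    ultimately show "x \<in> (\<lambda>x. transpose (basis_matrix e) *v x) ` unit_cube" by blast
  next
    fix x assume "x \<in> (\<lambda>x. transpose (basis_matrix e) *v x) ` unit_cube"
    then obtain y where y: "y \<in> unit_cube" "x = (\<Sum>i\<in>UNIV. (y $ i) *\<^sub>R e i)"
      by (auto simp: transpose_basis_matrix_mult)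
    have "e j \<bullet> x = y $ j" for j
      by (simp add: y(2) inner_sum_right orthobasis_inner[OF e] if_distrib cong: if_cong)
    then show "x \<in> slab_body (range e)"
      using y(1) by (auto simp: slab_body_def unit_cube_def abs_le_iff)
  qed
  moreover have "invertible (transpose (basis_matrix e))"
    using orthogonal_basis_matrix[OF e] by (simp add: orthogonal_matrix_def invertible_def) blast
  ultimately show ?thesis by blast
qed

lemma unit_cube_cbox: "(unit_cube :: (real^'n) set) = cbox (\<chi> i. -1) (\<chi> i. 1)"
  by (auto simp: unit_cube_def mem_box_cart)

lemma emeasure_unit_cube: "emeasure lborel (unit_cube :: (real^'n) set) = ennreal (2 ^ CARD('n))"
proof -
  have "measure lborel (cbox (\<chi> i. -1) (\<chi> i. 1) :: (real^'n) set) = 2 ^ CARD('n)"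
    by (subst content_cbox_cart) (auto simp: interval_ne_empty_cart)
  then show ?thesis
    unfolding unit_cube_cbox
    by (metis emeasure_eq_ennreal_measure emeasure_lborel_cbox_finite infinity_ennreal_def less_irrefl)
qed

text \<open>Ball's volume ratio theorem for symmetric bodies. Here the contact frame bounds the body by slabs, and the
Brascamp-Lieb inequality applies in the space itself, with the uniform density.\<close>

theorem volume_ratio_cube:
  fixes K :: "(real^'n) set"
  assumes K: "compact K" "convex K" and E: "max_ellipsoid K E" and sym: "\<And>x. x \<in> K \<Longrightarrow> - x \<in> K"
  shows "measure lborel K * measure lborel (unit_ball :: (real^'n) set) \<le> measure lborel (unit_cube :: (real^'n) set) * measure lborel E"
    and "measure lborel K * measure lborel (unit_ball :: (real^'n) set) = measure lborel (unit_cube :: (real^'n) set) * measure lborel E \<Longrightarrow>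
      \<exists>(A :: real^'n^'n). invertible A \<and> K = (\<lambda>x. A *v x) ` unit_cube"
proof -
  obtain z T where T: "invertible (T :: real^'n^'n)" "E = (\<lambda>u. z + T *v u) ` unit_ball"
    using E by (auto simp: max_ellipsoid_def ellipsoid_def)
  have EK: "E \<subseteq> K" using E by (simp add: max_ellipsoid_def)
  \<comment> \<open>By symmetry the ellipsoid may be centred at the origin.\<close>
  let ?E0 = "(\<lambda>u. 0 + T *v u) ` unit_ball"
  have "?E0 \<subseteq> K"
  proof
    fix x assume "x \<in> ?E0"
    then obtain w where w: "norm w \<le> 1" "x = T *v w" by auto
    have 1: "z + T *v w \<in> K" and 2: "z + T *v (- w) \<in> K"
      using EK w(1) by (auto simp: T(2))
    from 1 sym[OF 2] have "(1/2) *\<^sub>R (z + T *v w) + (1/2) *\<^sub>R (- (z + T *v (- w))) \<in> K"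
      by (intro convexD[OF K(2)]) auto
    also have "(1/2) *\<^sub>R (z + T *v w) + (1/2) *\<^sub>R (- (z + T *v (- w))) = x"
      using linear_neg[OF matrix_vector_mul_linear[of T], of w]
      by (simp add: w(2) algebra_simps flip: scaleR_add_left)
    finally show "x \<in> K" .
  qed
  moreover have mE0: "measure lborel ?E0 = measure lborel E"
    by (simp add: T(2) measure_ellipsoid[OF T(1)] measure_ellipsoid[OF T(1), of 0, simplified])
  moreover have "ellipsoid ?E0"
    using T(1) unfolding ellipsoid_def by blast
  ultimately have E0: "max_ellipsoid K ?E0"
    using E by (simp add: max_ellipsoid_def)
  obtain L where L: "compact L" "convex L" "unit_ball \<subseteq> L" "K = (\<lambda>u. 0 + T *v u) ` L"
    and max: "\<And>z' (T' :: real^'n^'n). invertible T' \<Longrightarrow> (\<lambda>x. z' + T' *v x) ` unit_ball \<subseteq> L \<Longrightarrow> \<bar>det T'\<bar> \<le> 1"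
    and mem: "\<And>x. x \<in> L \<longleftrightarrow> 0 + T *v x \<in> K"
    by (rule normalise_max_ellipsoid[OF K E0 T(1)]) metis
  have symL: "- x \<in> L" if "x \<in> L" for x
    using sym[of "T *v x"] that linear_neg[OF matrix_vector_mul_linear[of T], of x] by (simp add: mem)
  have "\<exists>S c. tight_frame S c \<and> (\<Sum>u\<in>S. c u *\<^sub>R u) = 0 \<and> (\<forall>u\<in>S. \<forall>x\<in>L. u \<bullet> x \<le> 1)"
    by (rule john_decomposition[OF L(1-3)]) (rule max)
  then obtain S c where S: "tight_frame S c" "\<And>u x. u \<in> S \<Longrightarrow> x \<in> L \<Longrightarrow> u \<bullet> x \<le> 1"
    by metis
  interpret tight_frame S c by (rule S(1))
  let ?C = "unit_cube :: (real^'n) set"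
  have LS: "L \<subseteq> slab_body S"
    using S(2) symL by (fastforce simp: slab_body_def abs_le_iff)
  have cube_fin: "emeasure lborel ?C \<noteq> \<infinity>"
    by (simp add: emeasure_unit_cube)
  have LPS: "emeasure lborel L \<le> emeasure lborel (slab_body S)"
    using LS borel_closed[OF closed_polar_polytope[of "S \<union> uminus ` S"]]
    by (intro emeasure_mono) (auto simp: slab_eq)
  have le: "emeasure lborel (slab_body S) \<le> emeasure lborel ?C"
    using slab_bound[OF S(1)] by (simp add: emeasure_unit_cube)
  have le2: "emeasure lborel L \<le> emeasure lborel ?C"
    using LPS le by simp
  have fin: "emeasure lborel L \<noteq> \<infinity>"
    using le2 cube_fin by (auto simp: top_unique)
  have leL: "measure lborel L \<le> measure lborel ?C"
    unfolding measure_def using le2 cube_fin by (intro enn2real_mono) (auto simp: less_top)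
  have mK: "measure lborel K = \<bar>det T\<bar> * measure lborel L"
    using L(1,4) measure_affine_image[OF T(1), of L 0] by (simp add: compact_imp_closed)
  have mE: "measure lborel E = \<bar>det T\<bar> * measure lborel (unit_ball :: (real^'n) set)"
    by (simp add: T(2) measure_ellipsoid[OF T(1)])
  have detT: "\<bar>det T\<bar> > 0"
    using T(1) by (simp add: invertible_det_nz)
  have Bpos: "measure lborel (unit_ball :: (real^'n) set) > 0"
    by (rule measure_unit_ball_pos)
  show "measure lborel K * measure lborel (unit_ball :: (real^'n) set) \<le> measure lborel ?C * measure lborel E"
    using mult_left_mono[OF leL, of "\<bar>det T\<bar> * measure lborel (unit_ball :: (real^'n) set)"] detT Bpos
    unfolding mK mE by (simp add: mult_ac)
  assume "measure lborel K * measure lborel (unit_ball :: (real^'n) set) = measure lborel ?C * measure lborel E"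
  then have "measure lborel L = measure lborel ?C"
    unfolding mK mE using detT Bpos by simp
  then have eqR: "emeasure lborel L = emeasure lborel ?C"
    using fin cube_fin by (metis emeasure_eq_ennreal_measure infinity_ennreal_def)
  then have eqS: "emeasure lborel L = emeasure lborel (slab_body S)"
    using LPS le by simp
  then obtain e where e: "orthobasis e" "slab_body S = slab_body (range e)"
    using slab_orthonormal_of_equality[OF S(1)] eqR emeasure_unit_cube by metis
  obtain A :: "real^'n^'n" where A: "invertible A" "slab_body (range e) = (\<lambda>x. A *v x) ` ?C"
    using slab_orthobasis[OF e(1)] by blast
  have "convex (slab_body S)"
    unfolding slab_eq by (rule convex_polar_polytope)
  moreover have "interior (slab_body S) \<noteq> {}"
    using L(3) LS by (intro interior_ne_of_ball) blast
  moreover have "closed (slab_body S)"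
    unfolding slab_eq by (rule closed_polar_polytope)
  ultimately have "L = slab_body S"
    using closed_subset_eq_of_emeasure[OF compact_imp_closed[OF L(1)] LS _ _ _ eqS] fin eqS by simp
  then have "K = (\<lambda>x. (T ** A) *v x) ` ?C"
    by (simp add: L(4) e(2) A(2) image_image matrix_vector_mul_assoc)
  moreover have "invertible (T ** A)"
    using T(1) A(1) by (rule invertible_mult)
  ultimately show "\<exists>(A :: real^'n^'n). invertible A \<and> K = (\<lambda>x. A *v x) ` ?C"
    by blast
qed

text \<open>The coordinate vectors are a tight frame with weights one.\<close>

lemma max_ellipsoid_cube: "max_ellipsoid (unit_cube :: (real^'n) set) unit_ball"
proof -
  have tf: "tight_frame (range (\<lambda>i :: 'n. axis i (1::real))) (\<lambda>_. 1)"
  proof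
    have inj: "inj (\<lambda>i :: 'n. axis i (1::real))"
      by (auto simp: inj_def axis_eq_axis)
    show "(\<Sum>u\<in>range (\<lambda>i :: 'n. axis i (1::real)). (1 * (u \<bullet> x)) *\<^sub>R u) = x" for x
      by (subst sum.reindex[OF inj])
         (use basis_expansion[of x] in \<open>simp add: inner_axis' scalar_mult_eq_scaleR\<close>)
  qed auto
  have "(unit_ball :: (real^'n) set) \<subseteq> unit_cube"
  proof
    fix x :: "real^'n" assume "x \<in> unit_ball"
    then have "\<bar>x $ i\<bar> \<le> 1" for i
      using component_le_norm_cart[of x i] by simp
    then show "x \<in> unit_cube"
      by (auto simp: unit_cube_def abs_le_iff)
  qed
  moreover have "measure lborel E \<le> measure lborel (unit_ball :: (real^'n) set)"
    if E: "ellipsoid E" "E \<subseteq> unit_cube" for E :: "(real^'n) set"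
  proof -
    obtain z T where T: "invertible (T :: real^'n^'n)" "E = (\<lambda>u. z + T *v u) ` unit_ball"
      using E(1) by (auto simp: ellipsoid_def)
    have "\<bar>det T\<bar> \<le> 1"
      by (rule ball_maximal_of_frame[OF tf T(1) E(2)[unfolded T(2)]])
         (auto simp: unit_cube_def inner_axis' minus_le_iff)
    then show ?thesis
      by (simp add: T(2) measure_ellipsoid[OF T(1)] mult_left_le_one_le)
  qed
  ultimately show ?thesis
    unfolding max_ellipsoid_def using ellipsoid_unit_ball by blast
qed

section \<open>Maximal ellipsoids below a log-concave function\<close>

text \<open>Heights are measured on a logarithmic scale, so that log-concavity becomes concavity of the levels in \<open>u\<close>.\<close>

definition level :: "('a \<Rightarrow> real) \<Rightarrow> real \<Rightarrow> 'a set" where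
  "level f u = {x. exp (- u) \<le> f x}"

text \<open>Log-concavity, expressed by levels instead of an extended-real-valued exponent.\<close>

definition level_concave :: "('a::real_vector \<Rightarrow> real) \<Rightarrow> bool" where
  "level_concave f \<longleftrightarrow> (\<forall>x. 0 \<le> f x) \<and>
     (\<forall>u w x y t. x \<in> level f u \<longrightarrow> y \<in> level f w \<longrightarrow> 0 \<le> t \<longrightarrow> t \<le> 1 \<longrightarrow>
        (1 - t) *\<^sub>R x + t *\<^sub>R y \<in> level f ((1 - t) * u + t * w))"

lemma level_concaveD:
  "level_concave f \<Longrightarrow> x \<in> level f u \<Longrightarrow> y \<in> level f w \<Longrightarrow> 0 \<le> t \<Longrightarrow> t \<le> 1 \<Longrightarrow>
    (1 - t) *\<^sub>R x + t *\<^sub>R y \<in> level f ((1 - t) * u + t * w)"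
  by (simp add: level_concave_def)

lemma level_mono: "u \<le> w \<Longrightarrow> level f u \<subseteq> level f w"
  unfolding level_def by (auto intro: order_trans[rotated])

lemma convex_level: "level_concave f \<Longrightarrow> convex (level f u)"
  unfolding convex_alt using level_concaveD[of f _ u _ u] by (simp add: algebra_simps)

lemma eq_of_levels:
  assumes "\<And>x. 0 \<le> f x" "\<And>x. 0 \<le> g x" "\<And>u. level f u = level g u"
  shows "f = g"
proof
  have le: "f x \<le> g x" if fg: "\<And>x. 0 \<le> f x" "\<And>x. 0 \<le> g x" "\<And>u. level f u = level g u" for f g :: "'a \<Rightarrow> real" and x
  proof (cases "f x = 0")
    case False
    then have "f x > 0" using fg(1)[of x] by simp
    then have "x \<in> level f (- ln (f x))"
      by (simp add: level_def)
    then have "x \<in> level g (- ln (f x))"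
      by (simp add: fg(3))
    then show ?thesis
      using \<open>f x > 0\<close> by (simp add: level_def)
  qed (simp add: fg)
  show "f x = g x" for x
    using le[of f g x] le[of g f x] assms by force
qed

lemma log_concave_level_concave:
  assumes "log_concave f" shows "level_concave f"
proof -
  obtain v where v: "\<And>x. v x \<noteq> -\<infinity>" "convex_ereal v" "f = (\<lambda>x. exp_neg (v x))"
    using assms by (auto simp: log_concave_def)
  have lev: "x \<in> level f u \<longleftrightarrow> v x \<le> ereal u" for x u
    using v(1)[of x] by (cases "v x") (auto simp: level_def v(3) exp_neg_def)
  have "(1 - t) *\<^sub>R x + t *\<^sub>R y \<in> level f ((1 - t) * u + t * w)"
    if "x \<in> level f u" "y \<in> level f w" "0 \<le> t" "t \<le> 1" for x y u w t
  proof -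
    have "v ((1 - t) *\<^sub>R x + t *\<^sub>R y) \<le> ereal (1 - t) * v x + ereal t * v y"
      using v(2) that(3,4) by (simp add: convex_ereal_def)
    also have "\<dots> \<le> ereal (1 - t) * ereal u + ereal t * ereal w"
      using that lev by (intro add_mono ereal_mult_left_mono) auto
    finally show ?thesis
      by (simp add: lev)
  qed
  moreover have "0 \<le> f x" for x
    by (simp add: v(3) exp_neg_def)
  ultimately show ?thesis
    by (auto simp: level_concave_def)
qed

lemma one_plus_sum_le_prod:
  assumes "finite A" "\<And>i. i \<in> A \<Longrightarrow> (0::real) \<le> a i"
  shows "1 + sum a A \<le> (\<Prod>i\<in>A. 1 + a i)"
  using assms
proof (induction A rule: finite_induct)
  case (insert x A)
  have "1 + sum a (insert x A) \<le> (1 + a x) * (1 + sum a A)"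
    using insert sum_nonneg[of A a] by (simp add: algebra_simps)
  also have "\<dots> \<le> (1 + a x) * (\<Prod>i\<in>A. 1 + a i)"
    using insert by (intro mult_left_mono) auto
  finally show ?case
    using insert by simp
qed simp

text \<open>Two translates of an ellipsoid are averaged with weights that depend linearly on the position along
the translation vector. This stretches the ellipsoid in that direction by the factor \<open>1 + norm d\<close>, within
the convex hull of the two. The fact rules out two different maximal ellipsoids, and it bounds the levels
of an integrable function.\<close>

lemma stretched_ellipsoid:
  fixes T :: "real^'n^'n" and C :: "(real^'n) set"
  assumes C: "convex C" and d: "d \<noteq> 0" "T *v d = (1/2) *\<^sub>R (z' - z)"
    and in1: "\<And>w. norm w \<le> 1 \<Longrightarrow> z + T *v w \<in> C" and in2: "\<And>w. norm w \<le> 1 \<Longrightarrow> z' + T *v w \<in> C"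
  shows "\<exists>R :: real^'n^'n. 1 + norm d \<le> det R \<and>
    (\<forall>w. norm w \<le> 1 \<longrightarrow> (1/2) *\<^sub>R (z + z') + (T ** R) *v w \<in> C)"
proof -
  define e where "e = d /\<^sub>R norm d"
  have ne: "norm e = 1" and de: "d = norm d *\<^sub>R e"
    using d(1) by (auto simp: e_def)
  define A where "A w = w + (e \<bullet> w) *\<^sub>R d" for w
  have lin: "linear A"
    unfolding A_def by (rule linearI) (auto simp: inner_simps algebra_simps)
  have adj: "A x \<bullet> y = x \<bullet> A y" for x y
  proof -
    have "A x \<bullet> y = x \<bullet> y + norm d * ((e \<bullet> x) * (e \<bullet> y))"
      unfolding A_def by (subst de) (simp add: inner_simps)
    moreover have "x \<bullet> A y = x \<bullet> y + norm d * ((e \<bullet> x) * (e \<bullet> y))"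
      unfolding A_def by (subst de) (simp add: inner_simps inner_commute[of x e])
    ultimately show ?thesis by simp
  qed
  obtain f \<nu> where f: "orthobasis f" and A: "A = diag_op f \<nu>"
    using spectral_theorem[OF lin adj] by blast
  have \<nu>: "\<nu> k = 1 + norm d * (e \<bullet> f k)\<^sup>2" for k
  proof -
    have "\<nu> k = A (f k) \<bullet> f k"
      by (simp add: A diag_op_inner[OF f] orthobasis_inner[OF f])
    also have "\<dots> = 1 + norm d * (e \<bullet> f k)\<^sup>2"
      unfolding A_def by (subst de) (simp add: inner_simps orthobasis_inner[OF f] power2_eq_square)
    finally show ?thesis .
  qed
  have "1 + norm d = 1 + (\<Sum>k\<in>UNIV. norm d * (e \<bullet> f k)\<^sup>2)"
    using orthobasis_norm_expand[OF f, of e] ne by (simp add: sum_distrib_left[symmetric])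
  also have "\<dots> \<le> prod \<nu> UNIV"
    unfolding \<nu> by (rule one_plus_sum_le_prod) auto
  also have "\<dots> = det (matrix A)"
    by (simp add: A det_matrix_diag_op[OF f])
  finally have "1 + norm d \<le> det (matrix A)" .
  moreover have "(1/2) *\<^sub>R (z + z') + (T ** matrix A) *v w \<in> C" if w: "norm w \<le> 1" for w
  proof -
    define s where "s = (1 + e \<bullet> w) / 2"
    have "\<bar>e \<bullet> w\<bar> \<le> 1"
      using Cauchy_Schwarz_ineq2[of e w] ne w by simp
    then have s: "0 \<le> s" "s \<le> 1"
      by (auto simp: s_def abs_le_iff)
    have "(T ** matrix A) *v w = T *v A w"
      using matrix_vector_mul(2)[OF lin] by (metis matrix_vector_mul_assoc)
    also have "\<dots> = T *v w + ((e \<bullet> w) / 2) *\<^sub>R (z' - z)"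
      by (simp add: A_def matrix_vector_right_distrib matrix_vector_mult_scaleR d(2))
    finally have TA: "(T ** matrix A) *v w = T *v w + ((e \<bullet> w) / 2) *\<^sub>R (z' - z)" .
    have "(1/2) *\<^sub>R (z + z') + (T ** matrix A) *v w = (1 - s) *\<^sub>R (z + T *v w) + s *\<^sub>R (z' + T *v w)"
      unfolding TA by (simp add: vec_eq_iff s_def field_simps)
    also have "\<dots> \<in> C"
      using C in1[OF w] in2[OF w] s by (simp add: convex_alt)
    finally show ?thesis .
  qed
  ultimately show ?thesis by blast
qed

text \<open>The function with value \<open>exp (- u)\<close> on the ellipsoid \<open>z + T B\<close> has the largest integral among the ellipsoid
functions below \<open>f\<close>; the volume of the unit ball \<open>B\<close> is a common factor of all these integrals.\<close>

definition john_pair :: "(real^'n \<Rightarrow> real) \<Rightarrow> real \<Rightarrow> real^'n \<Rightarrow> real^'n^'n \<Rightarrow> bool" where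
  "john_pair f u z T \<longleftrightarrow> invertible T \<and> (\<forall>w. norm w \<le> 1 \<longrightarrow> z + T *v w \<in> level f u) \<and>
     (\<forall>u' z' T'. invertible T' \<longrightarrow> (\<forall>w. norm w \<le> 1 \<longrightarrow> z' + T' *v w \<in> level f u') \<longrightarrow>
        exp (- u') * \<bar>det T'\<bar> \<le> exp (- u) * \<bar>det T\<bar>)"

text \<open>By concavity of the levels, the ellipsoids between the maximal one (at \<open>t = 0\<close>) and the given one (at
\<open>t = 1\<close>) are admissible. Relative to the maximum their integral is
\<open>exp (t (u - u')) \<Prod> (1 + t (\<mu> k - 1))\<close>, whose derivative at \<open>t = 0\<close> cannot be positive.\<close>

lemma john_pair_first_order:
  fixes f :: "real^'n \<Rightarrow> real"
  assumes lc: "level_concave f" and jp: "john_pair f u z T"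
    and e: "orthobasis e" and \<mu>: "\<And>k. \<mu> k > 0"
    and sub: "\<And>w. norm w \<le> 1 \<Longrightarrow> z' + T *v diag_op e \<mu> w \<in> level f u'"
  shows "(\<Sum>k\<in>UNIV. \<mu> k - 1) \<le> u' - u"
proof (rule ccontr)
  assume neg: "\<not> ?thesis"
  have T: "invertible T" "det T \<noteq> 0" "\<And>w. norm w \<le> 1 \<Longrightarrow> z + T *v w \<in> level f u"
    using jp by (auto simp: john_pair_def invertible_det_nz)
  define g where "g t = exp (t * (u - u')) * (\<Prod>k\<in>UNIV. 1 + t * (\<mu> k - 1))" for t
  have "((\<lambda>t. \<Prod>k\<in>UNIV. 1 + t * (\<mu> k - 1)) has_real_derivative
      (\<Sum>k\<in>UNIV. (\<mu> k - 1) * (\<Prod>j\<in>UNIV - {k}. 1 + 0 * (\<mu> j - 1)))) (at 0)"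
    by (rule has_field_derivative_prod) (auto intro!: derivative_eq_intros)
  then have 1: "((\<lambda>t. \<Prod>k\<in>UNIV. 1 + t * (\<mu> k - 1)) has_real_derivative (\<Sum>k\<in>UNIV. \<mu> k - 1)) (at 0)"
    by simp
  have 2: "((\<lambda>t. exp (t * (u - u'))) has_real_derivative (u - u')) (at 0)"
    by (auto intro!: derivative_eq_intros)
  have "(g has_real_derivative ((u - u') + (\<Sum>k\<in>UNIV. \<mu> k - 1))) (at 0)"
    unfolding g_def using DERIV_mult[OF 2 1] by (simp add: add.commute)
  from DERIV_pos_inc_right[OF this] neg obtain d where d: "d > 0" "\<And>h. 0 < h \<Longrightarrow> h < d \<Longrightarrow> 1 < g h"
    by (auto simp: g_def)
  define t where "t = min (d / 2) (1 / 2)"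
  have t: "0 < t" "t < d" "t < 1"
    using d(1) by (auto simp: t_def)
  define \<nu> where "\<nu> k = 1 + t * (\<mu> k - 1)" for k
  have \<nu>: "\<nu> k > 0" for k
  proof -
    have "\<nu> k = (1 - t) + t * \<mu> k" by (simp add: \<nu>_def algebra_simps)
    then show ?thesis using t \<mu>[of k] by (simp add: add_pos_pos)
  qed
  let ?R = "T ** matrix (diag_op e \<nu>)"
  have det: "det ?R = det T * prod \<nu> UNIV"
    by (simp add: det_mul det_matrix_diag_op[OF e])
  have pos: "prod \<nu> UNIV > 0"
    using \<nu> by (simp add: prod_pos)
  have "invertible ?R"
    using T(2) pos unfolding invertible_det_nz det by (metis less_irrefl mult_eq_0_iff)
  moreover have "((1 - t) *\<^sub>R z + t *\<^sub>R z') + ?R *v w \<in> level f ((1 - t) * u + t * u')" if "norm w \<le> 1" for w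
  proof -
    have "diag_op e \<nu> w = (1 - t) *\<^sub>R w + t *\<^sub>R diag_op e \<mu> w"
      by (rule orthobasis_eqI[OF e]) (simp add: diag_op_inner[OF e] inner_simps \<nu>_def algebra_simps)
    then have "((1 - t) *\<^sub>R z + t *\<^sub>R z') + ?R *v w = (1 - t) *\<^sub>R (z + T *v w) + t *\<^sub>R (z' + T *v diag_op e \<mu> w)"
      by (simp add: matrix_vector_mul_assoc[symmetric] matrix_diag_op_mult matrix_vector_right_distrib
          matrix_vector_mult_scaleR scaleR_add_right)
    also have "\<dots> \<in> level f ((1 - t) * u + t * u')"
      using level_concaveD[OF lc T(3)[OF that] sub[OF that]] t by simp
    finally show ?thesis .
  qed
  ultimately have "exp (- ((1 - t) * u + t * u')) * \<bar>det ?R\<bar> \<le> exp (- u) * \<bar>det T\<bar>"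
    using jp unfolding john_pair_def by blast
  then have "exp (- ((1 - t) * u + t * u')) * prod \<nu> UNIV * \<bar>det T\<bar> \<le> exp (- u) * \<bar>det T\<bar>"
    using pos by (simp add: det abs_mult mult_ac)
  then have "exp (- ((1 - t) * u + t * u')) * prod \<nu> UNIV \<le> exp (- u)"
    using T(2) by simp
  moreover have "exp (- ((1 - t) * u + t * u')) = exp (- u) * exp (t * (u - u'))"
    by (simp add: exp_add[symmetric] algebra_simps)
  ultimately have "g t \<le> 1"
    by (simp add: g_def \<nu>_def mult.assoc)
  then show False
    using d(2)[OF t(1,2)] by simp
qed

lemma relative_ellipsoid:
  fixes T T' :: "real^'n^'n"
  assumes T: "invertible T" "invertible T'"
  shows "\<exists>e \<mu>. orthobasis e \<and> (\<forall>k. \<mu> k > 0) \<and> \<bar>det T'\<bar> = \<bar>det T\<bar> * prod \<mu> UNIV \<and>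
    (\<lambda>x. T' *v x) ` unit_ball = (\<lambda>x. T *v diag_op e \<mu> x) ` unit_ball"
proof -
  obtain I where I: "invertible (I :: real^'n^'n)" "\<And>x. I *v (T *v x) = x" "\<And>x. T *v (I *v x) = x"
    using invertible_matrix_inverse[OF T(1)] by metis
  have "T ** (I ** T') = T'"
    by (rule matrix_eq[THEN iffD2]) (simp add: matrix_vector_mul_assoc[symmetric] I)
  moreover obtain e \<mu> where e: "orthobasis e" "\<And>k. \<mu> k > 0" "\<bar>det (I ** T')\<bar> = prod \<mu> UNIV"
    "(\<lambda>x. (I ** T') *v x) ` unit_ball = diag_op e \<mu> ` unit_ball"
    using ellipsoid_normal_form[OF invertible_mult[OF I(1) T(2)]] by metis
  ultimately have "\<bar>det T'\<bar> = \<bar>det T\<bar> * prod \<mu> UNIV"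
    by (metis abs_mult det_mul)
  moreover have "(\<lambda>x. T' *v x) ` unit_ball = (\<lambda>x. T *v x) ` (\<lambda>x. (I ** T') *v x) ` unit_ball"
    by (simp add: image_image matrix_vector_mul_assoc[symmetric] I)
  then have "(\<lambda>x. T' *v x) ` unit_ball = (\<lambda>x. T *v diag_op e \<mu> x) ` unit_ball"
    by (simp only: e(4) image_image)
  ultimately show ?thesis
    using e by blast
qed

text \<open>The inequality between the arithmetic and the geometric mean.\<close>

lemma prod_le_mean_power:
  fixes \<mu> :: "'n::finite \<Rightarrow> real"
  assumes "\<And>k. \<mu> k > 0"
  shows "prod \<mu> UNIV \<le> (sum \<mu> UNIV / real CARD('n)) ^ CARD('n)"
proof -
  define A where "A = sum \<mu> UNIV / real CARD('n)"
  have sum: "sum \<mu> UNIV > 0"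
    using assms by (simp add: sum_pos)
  then have A: "A > 0"
    by (simp add: A_def)
  have "prod (\<lambda>k. \<mu> k / A) UNIV \<le> exp (\<Sum>k\<in>UNIV. \<mu> k / A - 1)"
    using divide_pos_pos[OF assms A] by (intro prod_le_exp_sum_minus_one) auto
  also have "(\<Sum>k\<in>UNIV. \<mu> k / A - 1) = sum \<mu> UNIV / A - real CARD('n)"
    by (simp only: sum_subtractf sum_divide_distrib[symmetric]) simp
  also have "sum \<mu> UNIV / A = real CARD('n)"
    using sum by (simp add: A_def)
  finally have "prod \<mu> UNIV / A ^ CARD('n) \<le> 1"
    by (simp add: prod_dividef)
  then show ?thesis
    using A unfolding A_def[symmetric] by (simp add: divide_le_eq)
qed

lemma john_pair_ellipsoid_bound:
  fixes f :: "real^'n \<Rightarrow> real"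
  assumes lc: "level_concave f" and jp: "john_pair f u z T"
    and E: "ellipsoid E" "E \<subseteq> level f u'"
  shows "0 < 1 + (u' - u) / real CARD('n)"
    "measure lborel E \<le> \<bar>det T\<bar> * measure lborel (unit_ball :: (real^'n) set) * (1 + (u' - u) / real CARD('n)) ^ CARD('n)"
proof -
  obtain z' T' where T': "invertible (T' :: real^'n^'n)" "E = (\<lambda>u. z' + T' *v u) ` unit_ball"
    using E(1) by (auto simp: ellipsoid_def)
  have T: "invertible T"
    using jp by (simp add: john_pair_def)
  obtain e \<mu> where e: "orthobasis e" "\<And>k. \<mu> k > 0" "\<bar>det T'\<bar> = \<bar>det T\<bar> * prod \<mu> UNIV"
    "(\<lambda>x. T' *v x) ` unit_ball = (\<lambda>x. T *v diag_op e \<mu> x) ` unit_ball"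
    using relative_ellipsoid[OF T T'(1)] by metis
  have "z' + T *v diag_op e \<mu> w \<in> level f u'" if "norm w \<le> 1" for w
  proof -
    have "T *v diag_op e \<mu> w \<in> (\<lambda>x. T' *v x) ` unit_ball"
      unfolding e(4) using that by auto
    then show ?thesis
      using E(2) by (auto simp: T'(2))
  qed
  then have "(\<Sum>k\<in>UNIV. \<mu> k - 1) \<le> u' - u"
    by (rule john_pair_first_order[OF lc jp e(1,2)])
  then have "sum \<mu> UNIV / real CARD('n) \<le> (real CARD('n) + (u' - u)) / real CARD('n)"
    by (intro divide_right_mono) (auto simp: sum_subtractf)
  then have mean: "sum \<mu> UNIV / real CARD('n) \<le> 1 + (u' - u) / real CARD('n)"
    by (simp add: add_divide_distrib)
  have pos: "sum \<mu> UNIV / real CARD('n) > 0"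
    using e(2) by (simp add: sum_pos)
  show "0 < 1 + (u' - u) / real CARD('n)"
    using mean pos by linarith
  have "prod \<mu> UNIV \<le> (sum \<mu> UNIV / real CARD('n)) ^ CARD('n)"
    by (rule prod_le_mean_power[OF e(2)])
  also have "\<dots> \<le> (1 + (u' - u) / real CARD('n)) ^ CARD('n)"
    using mean pos by (intro power_mono) auto
  finally have "\<bar>det T\<bar> * prod \<mu> UNIV * measure lborel (unit_ball :: (real^'n) set) \<le>
      \<bar>det T\<bar> * (1 + (u' - u) / real CARD('n)) ^ CARD('n) * measure lborel (unit_ball :: (real^'n) set)"
    by (intro mult_right_mono mult_left_mono) auto
  then show "measure lborel E \<le> \<bar>det T\<bar> * measure lborel (unit_ball :: (real^'n) set) * (1 + (u' - u) / real CARD('n)) ^ CARD('n)"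
    by (simp add: T'(2) measure_ellipsoid[OF T'(1)] e(3) mult_ac)
qed

text \<open>For two maximisers the first-order inequality reads \<open>\<Sum> (\<mu> k - 1 - ln (\<mu> k)) \<le> 0\<close>, so all \<open>\<mu> k\<close> are one. The
ellipsoids are then translates of each other at the same height, and stretching excludes different
centres.\<close>

lemma john_pair_unique:
  fixes f :: "real^'n \<Rightarrow> real"
  assumes lc: "level_concave f" and jp: "john_pair f u z T" and jp': "john_pair f u' z' T'"
  shows "u' = u \<and> (\<lambda>w. z' + T' *v w) ` unit_ball = (\<lambda>w. z + T *v w) ` unit_ball"
proof -
  have T: "invertible T" "\<And>w. norm w \<le> 1 \<Longrightarrow> z + T *v w \<in> level f u"
    and T': "invertible T'" "\<And>w. norm w \<le> 1 \<Longrightarrow> z' + T' *v w \<in> level f u'"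
    using jp jp' by (auto simp: john_pair_def)
  have "exp (- u') * \<bar>det T'\<bar> \<le> exp (- u) * \<bar>det T\<bar>" "exp (- u) * \<bar>det T\<bar> \<le> exp (- u') * \<bar>det T'\<bar>"
    using jp jp' unfolding john_pair_def by blast+
  then have val: "exp (- u') * \<bar>det T'\<bar> = exp (- u) * \<bar>det T\<bar>"
    by simp
  have detT: "\<bar>det T\<bar> > 0"
    using T(1) by (simp add: invertible_det_nz)
  obtain e \<mu> where e: "orthobasis e" "\<And>k. \<mu> k > 0" "\<bar>det T'\<bar> = \<bar>det T\<bar> * prod \<mu> UNIV"
    "(\<lambda>x. T' *v x) ` unit_ball = (\<lambda>x. T *v diag_op e \<mu> x) ` unit_ball"
    using relative_ellipsoid[OF T(1) T'(1)] by metis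
  have sub: "z' + T *v diag_op e \<mu> w \<in> level f u'" if "norm w \<le> 1" for w
  proof -
    have "T *v diag_op e \<mu> w \<in> (\<lambda>x. T' *v x) ` unit_ball"
      unfolding e(4) using that by auto
    then show ?thesis
      using T'(2) by auto
  qed
  then have first: "(\<Sum>k\<in>UNIV. \<mu> k - 1) \<le> u' - u"
    by (rule john_pair_first_order[OF lc jp e(1,2)])
  have "exp (- u') * prod \<mu> UNIV = exp (- u)"
    using val detT by (simp add: e(3))
  then have "prod \<mu> UNIV = exp (u' - u)"
    by (simp add: exp_diff exp_minus field_simps)
  then have "(\<Sum>k\<in>UNIV. ln (\<mu> k)) = u' - u"
    using ln_prod[of UNIV \<mu>] e(2) by (simp add: less_imp_neq[symmetric])
  then have "(\<Sum>k\<in>UNIV. \<mu> k - 1 - ln (\<mu> k)) \<le> 0"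
    using first by (simp add: sum_subtractf)
  moreover have "0 \<le> \<mu> k - 1 - ln (\<mu> k)" for k
    using ln_le_minus_one[OF e(2)[of k]] by simp
  ultimately have "\<mu> k - 1 - ln (\<mu> k) = 0" for k
    using sum_nonneg_eq_0_iff[of UNIV "\<lambda>k. \<mu> k - 1 - ln (\<mu> k)"] sum_nonneg[of UNIV "\<lambda>k. \<mu> k - 1 - ln (\<mu> k)"]
    by simp
  then have "\<mu> k = 1" for k
    using ln_eq_minus_one[OF e(2)[of k]] by simp
  then have \<mu>: "\<mu> = (\<lambda>_. 1)" by auto
  have u: "u' = u"
    using \<open>(\<Sum>k\<in>UNIV. ln (\<mu> k)) = u' - u\<close> by (simp add: \<mu>)
  have sub1: "z' + T *v w \<in> level f u" if "norm w \<le> 1" for w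
    using sub[OF that] by (simp add: \<mu> diag_op_one[OF e(1)] u)
  have "z' = z"
  proof (rule ccontr)
    assume "z' \<noteq> z"
    obtain I where I: "invertible (I :: real^'n^'n)" "\<And>x. I *v (T *v x) = x" "\<And>x. T *v (I *v x) = x"
      using invertible_matrix_inverse[OF T(1)] by metis
    define d where "d = I *v ((1/2) *\<^sub>R (z' - z))"
    have d: "T *v d = (1/2) *\<^sub>R (z' - z)"
      by (simp add: d_def I)
    have d0: "d \<noteq> 0"
      using d \<open>z' \<noteq> z\<close> by auto
    obtain R :: "real^'n^'n" where R: "1 + norm d \<le> det R"
      "\<And>w. norm w \<le> 1 \<Longrightarrow> (1/2) *\<^sub>R (z + z') + (T ** R) *v w \<in> level f u"
      using stretched_ellipsoid[OF convex_level[OF lc] d0 d T(2) sub1] by metis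
    have "norm d > 0" using d0 by simp
    then have R1: "det R > 1" using R(1) by linarith
    then have "invertible (T ** R)"
      using detT by (simp add: invertible_det_nz det_mul)
    then have "exp (- u) * \<bar>det (T ** R)\<bar> \<le> exp (- u) * \<bar>det T\<bar>"
      using jp R(2) unfolding john_pair_def by blast
    then have "\<bar>det T\<bar> * det R \<le> \<bar>det T\<bar> * 1"
      using R1 by (simp add: det_mul abs_mult)
    then show False
      using detT R1 by (simp add: mult_le_cancel_left)
  qed
  have "(\<lambda>w. z' + T' *v w) ` unit_ball = (\<lambda>x. z' + x) ` (\<lambda>x. T' *v x) ` unit_ball"
    by (simp add: image_image)
  also have "\<dots> = (\<lambda>w. z + T *v w) ` unit_ball"
    unfolding e(4) by (simp add: \<mu> diag_op_one[OF e(1)] image_image \<open>z' = z\<close>)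
  finally show ?thesis
    using u by simp
qed

lemma ellipsoid_functions_below_iff:
  fixes f :: "real^'n \<Rightarrow> real"
  assumes "\<And>x. 0 \<le> f x"
  shows "e \<in> ellipsoid_functions_below f \<longleftrightarrow>
    (\<exists>u z T. invertible (T :: real^'n^'n) \<and> (\<forall>w. norm w \<le> 1 \<longrightarrow> z + T *v w \<in> level f u) \<and>
      e = (\<lambda>x. exp (- u) * indicator ((\<lambda>w. z + T *v w) ` unit_ball) x))"
proof
  assume "e \<in> ellipsoid_functions_below f"
  then obtain a E where a: "a > 0" "ellipsoid E" "e = (\<lambda>x. a * indicator E x)" "\<And>x. e x \<le> f x"
    by (auto simp: ellipsoid_functions_below_def)
  obtain z T where T: "invertible (T :: real^'n^'n)" "E = (\<lambda>u. z + T *v u) ` unit_ball"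
    using a(2) by (auto simp: ellipsoid_def)
  have "z + T *v w \<in> level f (- ln a)" if "norm w \<le> 1" for w
  proof -
    have "z + T *v w \<in> E" using that by (auto simp: T(2))
    then show ?thesis
      using a(4)[of "z + T *v w"] a(1) by (simp add: a(3) level_def)
  qed
  moreover have "e = (\<lambda>x. exp (- (- ln a)) * indicator ((\<lambda>w. z + T *v w) ` unit_ball) x)"
    using a(1) by (simp add: a(3) T(2))
  ultimately show "\<exists>u z T. invertible (T :: real^'n^'n) \<and> (\<forall>w. norm w \<le> 1 \<longrightarrow> z + T *v w \<in> level f u) \<and>
      e = (\<lambda>x. exp (- u) * indicator ((\<lambda>w. z + T *v w) ` unit_ball) x)"
    using T(1) by blast
next
  assume "\<exists>u z T. invertible (T :: real^'n^'n) \<and> (\<forall>w. norm w \<le> 1 \<longrightarrow> z + T *v w \<in> level f u) \<and>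
      e = (\<lambda>x. exp (- u) * indicator ((\<lambda>w. z + T *v w) ` unit_ball) x)"
  then obtain u z T where T: "invertible (T :: real^'n^'n)" "\<And>w. norm w \<le> 1 \<Longrightarrow> z + T *v w \<in> level f u"
      "e = (\<lambda>x. exp (- u) * indicator ((\<lambda>w. z + T *v w) ` unit_ball) x)"
    by blast
  have "e x \<le> f x" for x
    using T(2) assms[of x] by (auto simp: T(3) level_def indicator_def)
  moreover have "ellipsoid ((\<lambda>w. z + T *v w) ` unit_ball)"
    using T(1) unfolding ellipsoid_def by blast
  ultimately show "e \<in> ellipsoid_functions_below f"
    unfolding ellipsoid_functions_below_def T(3) by (auto intro!: exI[of _ "exp (- u)"])
qed

lemma integral_ellipsoid_function:
  fixes T :: "real^'n^'n"
  assumes "invertible T"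
  shows "integral\<^sup>L lborel (\<lambda>x. exp (- u) * indicator ((\<lambda>w. z + T *v w) ` unit_ball) x) =
    exp (- u) * \<bar>det T\<bar> * measure lborel (unit_ball :: (real^'n) set)"
proof -
  have "(\<lambda>w. z + T *v w) ` unit_ball \<in> sets borel"
    by (rule sets_borel_affine_image[OF assms]) simp
  then show ?thesis
    by (simp add: measure_ellipsoid[OF assms] mult.assoc)
qed

theorem john_ellipsoid_eq:
  fixes f :: "real^'n \<Rightarrow> real"
  assumes lc: "level_concave f" and jp: "john_pair f u z T"
  shows "john_ellipsoid f = (\<lambda>x. exp (- u) * indicator ((\<lambda>w. z + T *v w) ` unit_ball) x)"
    (is "_ = ?e")
proof -
  have nn: "\<And>x. 0 \<le> f x"
    using lc by (simp add: level_concave_def)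
  have T: "invertible T" "\<And>w. norm w \<le> 1 \<Longrightarrow> z + T *v w \<in> level f u"
    using jp by (auto simp: john_pair_def)
  have Bpos: "measure lborel (unit_ball :: (real^'n) set) > 0"
    by (rule measure_unit_ball_pos)
  show ?thesis
    unfolding john_ellipsoid_def
  proof (rule the_equality, intro conjI ballI)
    show "?e \<in> ellipsoid_functions_below f"
      unfolding ellipsoid_functions_below_iff[OF nn] using T by blast
    fix e' assume "e' \<in> ellipsoid_functions_below f"
    then obtain u' z' T' where T': "invertible (T' :: real^'n^'n)" "\<And>w. norm w \<le> 1 \<Longrightarrow> z' + T' *v w \<in> level f u'"
      "e' = (\<lambda>x. exp (- u') * indicator ((\<lambda>w. z' + T' *v w) ` unit_ball) x)"
      unfolding ellipsoid_functions_below_iff[OF nn] by blast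
    have "exp (- u') * \<bar>det T'\<bar> \<le> exp (- u) * \<bar>det T\<bar>"
      using jp T' unfolding john_pair_def by blast
    then show "integral\<^sup>L lborel e' \<le> integral\<^sup>L lborel ?e"
      using Bpos by (simp only: T'(3) integral_ellipsoid_function[OF T'(1)] integral_ellipsoid_function[OF T(1)]) simp
  next
    fix e' assume e': "e' \<in> ellipsoid_functions_below f \<and>
      (\<forall>e''\<in>ellipsoid_functions_below f. integral\<^sup>L lborel e'' \<le> integral\<^sup>L lborel e')"
    then obtain u' z' T' where T': "invertible (T' :: real^'n^'n)" "\<And>w. norm w \<le> 1 \<Longrightarrow> z' + T' *v w \<in> level f u'"
      "e' = (\<lambda>x. exp (- u') * indicator ((\<lambda>w. z' + T' *v w) ` unit_ball) x)"
      unfolding ellipsoid_functions_below_iff[OF nn] by blast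
    have "john_pair f u' z' T'"
      unfolding john_pair_def
    proof (intro conjI allI impI)
      fix u'' z'' and T'' :: "real^'n^'n"
      assume T'': "invertible T''" "\<forall>w. norm w \<le> 1 \<longrightarrow> z'' + T'' *v w \<in> level f u''"
      then have "(\<lambda>x. exp (- u'') * indicator ((\<lambda>w. z'' + T'' *v w) ` unit_ball) x) \<in> ellipsoid_functions_below f"
        unfolding ellipsoid_functions_below_iff[OF nn] by blast
      with e' have "integral\<^sup>L lborel (\<lambda>x. exp (- u'') * indicator ((\<lambda>w. z'' + T'' *v w) ` unit_ball) x) \<le> integral\<^sup>L lborel e'"
        by blast
      then show "exp (- u'') * \<bar>det T''\<bar> \<le> exp (- u') * \<bar>det T'\<bar>"
        unfolding T'(3) integral_ellipsoid_function[OF T''(1)] integral_ellipsoid_function[OF T'(1)]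
        using Bpos by simp
    qed (use T' in auto)
    then show "e' = ?e"
      using john_pair_unique[OF lc jp] T'(3) by simp
  qed
qed

section \<open>Volumes of the levels and the integral\<close>

lemma nn_integral_exp_atLeast:
  "(\<integral>\<^sup>+u. ennreal (exp (- u)) * indicator {a..} u \<partial>lborel) = ennreal (exp (- a))"
proof -
  have "(\<integral>\<^sup>+u. ennreal (exp (- u)) * indicator {a..} u \<partial>lborel) = ennreal (0 - (- exp (- a)))"
  proof (rule nn_integral_FTC_atLeast)
    show "((\<lambda>x. - exp (- x)) has_real_derivative exp (- x)) (at x)" for x :: real
      by (auto intro!: derivative_eq_intros)
    have "((\<lambda>x. exp (- x)) \<longlongrightarrow> (0 :: real)) at_top"
      by (rule filterlim_compose[OF exp_at_bot filterlim_uminus_at_bot_at_top])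
    from tendsto_minus[OF this] show "((\<lambda>x. - exp (- x)) \<longlongrightarrow> (0::real)) at_top" by simp
  qed auto
  then show ?thesis by simp
qed

lemma layer_cake:
  fixes f :: "'a::euclidean_space \<Rightarrow> real"
  assumes f [measurable]: "f \<in> borel_measurable borel" and nn: "\<And>x. 0 \<le> f x"
  shows "(\<integral>\<^sup>+x. ennreal (f x) \<partial>lborel) = (\<integral>\<^sup>+u. ennreal (exp (- u)) * emeasure lborel (level f u) \<partial>lborel)"
proof -
  have lev [measurable]: "level f u \<in> sets borel" for u
    unfolding level_def by measurable
  have fx: "ennreal (f x) = (\<integral>\<^sup>+u. ennreal (exp (- u)) * indicator (level f u) x \<partial>lborel)" for x
  proof (cases "f x = 0")
    case True
    then show ?thesis by (simp add: level_def)
  next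
    case False
    then have pos: "f x > 0" using nn[of x] by simp
    have "x \<in> level f u \<longleftrightarrow> - ln (f x) \<le> u" for u
    proof -
      have "exp (- u) \<le> f x \<longleftrightarrow> - u \<le> ln (f x)"
        using pos by (metis exp_le_cancel_iff exp_ln)
      then show ?thesis
        by (auto simp: level_def)
    qed
    then have "(\<integral>\<^sup>+u. ennreal (exp (- u)) * indicator (level f u) x \<partial>lborel) =
        (\<integral>\<^sup>+u. ennreal (exp (- u)) * indicator {- ln (f x)..} u \<partial>lborel)"
      by (intro nn_integral_cong) (auto simp: indicator_def)
    then show ?thesis
      using pos by (simp add: nn_integral_exp_atLeast)
  qed
  have meas: "(\<lambda>(x, u). ennreal (exp (- u)) * indicator (level f u) x) \<in> borel_measurable (lborel \<Otimes>\<^sub>M (lborel :: real measure))"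
  proof -
    have "(\<lambda>p :: 'a \<times> real. ennreal (exp (- snd p)) * indicator {p. exp (- snd p) \<le> f (fst p)} p) \<in> borel_measurable (lborel \<Otimes>\<^sub>M lborel)"
    proof (intro borel_measurable_times_ennreal borel_measurable_indicator)
      have "{p \<in> space ((lborel :: 'a measure) \<Otimes>\<^sub>M (lborel :: real measure)). exp (- snd p) \<le> f (fst p)} \<in> sets (lborel \<Otimes>\<^sub>M lborel)"
        by measurable
      then show "{p :: 'a \<times> real. exp (- snd p) \<le> f (fst p)} \<in> sets (lborel \<Otimes>\<^sub>M lborel)"
        by (simp add: space_pair_measure)
    qed measurable
    then show ?thesis
      by (simp add: case_prod_beta' level_def indicator_def)
  qed
  have "(\<integral>\<^sup>+x. ennreal (f x) \<partial>lborel) = (\<integral>\<^sup>+x. \<integral>\<^sup>+u. ennreal (exp (- u)) * indicator (level f u) x \<partial>lborel \<partial>lborel)"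
    by (simp add: fx)
  also have "\<dots> = (\<integral>\<^sup>+u. \<integral>\<^sup>+x. ennreal (exp (- u)) * indicator (level f u) x \<partial>lborel \<partial>lborel)"
    by (rule lborel_pair.Fubini'[OF meas, symmetric])
  also have "\<dots> = (\<integral>\<^sup>+u. ennreal (exp (- u)) * emeasure lborel (level f u) \<partial>lborel)"
    by (intro nn_integral_cong nn_integral_cmult_indicator) simp
  finally show ?thesis .
qed

text \<open>The \<open>n\<close>-th power of the integral ratio of the gauge exponential of an ellipsoid: the part of the ratio that
comes from the decay of the function rather than from the shape of its levels.\<close>

definition cone_ratio :: "nat \<Rightarrow> real" where
  "cone_ratio n = exp (real n) * fact n / real n ^ n"

text \<open>The substitution \<open>u = u\<^sub>0 - n + w\<close> turns the integral into \<open>\<integral> w\<^sup>n exp (- w) dw = n!\<close> over the half-line.\<close>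

lemma nn_integral_cone_profile:
  assumes n: "n > 0" and W: "W \<ge> 0"
  shows "(\<integral>\<^sup>+u. ennreal (exp (- u)) * ennreal (W * (max 0 (1 + (u - u\<^sub>0) / real n)) ^ n) \<partial>lborel) =
    ennreal (W * exp (- u\<^sub>0) * cone_ratio n)"
proof -
  let ?C = "W * exp (real n - u\<^sub>0) / real n ^ n"
  have C: "?C \<ge> 0" using W by simp
  have "(\<integral>\<^sup>+u. ennreal (exp (- u)) * ennreal (W * (max 0 (1 + (u - u\<^sub>0) / real n)) ^ n) \<partial>lborel) =
      ennreal \<bar>1\<bar> * (\<integral>\<^sup>+w. ennreal (exp (- ((u\<^sub>0 - real n) + 1 * w))) *
        ennreal (W * (max 0 (1 + ((u\<^sub>0 - real n) + 1 * w - u\<^sub>0) / real n)) ^ n) \<partial>lborel)"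
    by (rule nn_integral_real_affine) auto
  also have "\<dots> = (\<integral>\<^sup>+w. ennreal ?C * (ennreal (w ^ n * exp (- w)) * indicator {0..} w) \<partial>lborel)"
  proof -
    have "ennreal (exp (- ((u\<^sub>0 - real n) + 1 * w))) * ennreal (W * (max 0 (1 + ((u\<^sub>0 - real n) + 1 * w - u\<^sub>0) / real n)) ^ n) =
        ennreal ?C * (ennreal (w ^ n * exp (- w)) * indicator {0..} w)" for w
    proof (cases "w \<ge> 0")
      case True
      have "1 + ((u\<^sub>0 - real n) + 1 * w - u\<^sub>0) / real n = w / real n"
        using n by (simp add: field_simps)
      then have m: "max 0 (1 + ((u\<^sub>0 - real n) + 1 * w - u\<^sub>0) / real n) = w / real n"
        using True by simp
      have "exp (- ((u\<^sub>0 - real n) + 1 * w)) = exp (real n - u\<^sub>0) * exp (- w)"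
        by (simp add: exp_add[symmetric])
      then have "exp (- ((u\<^sub>0 - real n) + 1 * w)) * (W * (w / real n) ^ n) = ?C * (w ^ n * exp (- w))"
        by (simp add: power_divide)
      then show ?thesis
        unfolding m using True W C by (simp add: ennreal_mult[symmetric])
    next
      case False
      have "1 + ((u\<^sub>0 - real n) + 1 * w - u\<^sub>0) / real n = w / real n"
        using n by (simp add: field_simps)
      then have "max 0 (1 + ((u\<^sub>0 - real n) + 1 * w - u\<^sub>0) / real n) = 0"
        using False by (simp add: divide_le_0_iff)
      then show ?thesis
        using False n by (simp add: zero_power)
    qed
    then show ?thesis by simp
  qed
  also have "\<dots> = ennreal ?C * (\<integral>\<^sup>+w. ennreal (w ^ n * exp (- w)) * indicator {0..} w \<partial>lborel)"
    by (rule nn_integral_cmult) measurable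
  also have "(\<integral>\<^sup>+w. ennreal (w ^ n * exp (- w)) * indicator {0..} w \<partial>lborel) = ennreal (fact n)"
    by (subst nn_intergal_power_times_exp_Ici) simp
  also have "ennreal ?C * ennreal (fact n) = ennreal (W * exp (- u\<^sub>0) * cone_ratio n)"
    using C by (simp add: ennreal_mult[symmetric] cone_ratio_def exp_diff exp_minus field_simps)
  finally show ?thesis .
qed

section \<open>Integrable log-concave functions\<close>

locale lc_function =
  fixes f :: "real^'n \<Rightarrow> real"
  assumes lc: "level_concave f" and usc: "upper_semicont f"
    and integrable: "integrable lborel f" and pos: "0 < integral\<^sup>L lborel f"
begin

lemma nonneg: "0 \<le> f x"
  using lc by (simp add: level_concave_def)

lemma closed_level: "closed (level f u)"
  unfolding level_def by (rule upper_semicont_closed_levels[OF usc])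

lemma sets_level [measurable]: "level f u \<in> sets borel"
  using closed_level by (rule borel_closed)

lemma measurable_f [measurable]: "f \<in> borel_measurable borel"
  using integrable by auto

lemma nn_integral_f: "(\<integral>\<^sup>+x. ennreal (f x) \<partial>lborel) = ennreal (integral\<^sup>L lborel f)"
  by (rule nn_integral_eq_integral[OF integrable]) (simp add: nonneg)

lemma integral_levels: "(\<integral>\<^sup>+u. ennreal (exp (- u)) * emeasure lborel (level f u) \<partial>lborel) = ennreal (integral\<^sup>L lborel f)"
  using layer_cake[OF measurable_f nonneg] nn_integral_f by simp

lemma emeasure_level_finite: "emeasure lborel (level f u) \<noteq> \<infinity>"
proof
  assume inf: "emeasure lborel (level f u) = \<infinity>"
  have "ennreal (exp (- u)) * emeasure lborel (level f u) = (\<integral>\<^sup>+x. ennreal (exp (- u)) * indicator (level f u) x \<partial>lborel)"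
    by (rule nn_integral_cmult_indicator[symmetric]) simp
  also have "\<dots> \<le> (\<integral>\<^sup>+x. ennreal (f x) \<partial>lborel)"
    by (intro nn_integral_mono) (auto simp: indicator_def level_def intro!: ennreal_leI)
  finally show False
    using inf by (simp add: nn_integral_f ennreal_mult_top top_unique)
qed

lemma emeasure_level: "emeasure lborel (level f u) = ennreal (measure lborel (level f u))"
  using emeasure_level_finite by (simp add: emeasure_eq_ennreal_measure)

lemma measure_level_zero_of_interior:
  assumes "interior (level f u) = {}" shows "measure lborel (level f u) = 0"
proof -
  have "negligible (level f u)"
    using assms negligible_convex_interior[OF convex_level[OF lc]] by blast
  then have "emeasure lebesgue (level f u) = 0"
    by (simp add: negligible_iff_null_sets null_sets_def)
  then have "emeasure lborel (level f u) = 0"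
    by (simp add: main_part_sets)
  then show ?thesis
    by (simp add: measure_def)
qed

text \<open>Otherwise all levels would be null sets, and so would be the integral.\<close>

lemma thick_level_exists: "\<exists>u. interior (level f u) \<noteq> {}"
proof (rule ccontr)
  assume "\<not> ?thesis"
  then have "emeasure lborel (level f u) = 0" for u
    using measure_level_zero_of_interior[of u] by (simp add: emeasure_level)
  then have "ennreal (integral\<^sup>L lborel f) = 0"
    by (simp add: integral_levels[symmetric])
  then show False
    using pos by simp
qed

text \<open>A ball in a level \<open>K(U)\<close> and a point \<open>x\<close> of it span, by convexity, translates of a smaller ball far apart, and
hence an ellipsoid in \<open>K(U)\<close> whose volume grows linearly with the distance of \<open>x\<close>. The measure of the level
is finite because \<open>f\<close> is integrable.\<close>

lemma bounded_level: "bounded (level f u)"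
proof -
  obtain u\<^sub>2 where "interior (level f u\<^sub>2) \<noteq> {}"
    using thick_level_exists by blast
  then obtain p r where r: "r > 0" "cball p r \<subseteq> level f u\<^sub>2"
    by (meson ex_in_conv mem_interior_cball)
  \<comment> \<open>A level that contains both the given one and the ball.\<close>
  define U where "U = max u u\<^sub>2"
  have sub: "level f u \<subseteq> level f U" "level f u\<^sub>2 \<subseteq> level f U"
    by (auto simp: U_def intro!: level_mono)
  define m where "m = measure lborel (level f U)"
  let ?T = "matrix ((*\<^sub>R) (r/2)) :: real^'n^'n"
  have T: "?T *v w = (r/2) *\<^sub>R w" for w
    by (rule matrix_scaleR_mult)
  have det: "det ?T = (r/2) ^ CARD('n)"
    by (rule det_matrix_scaleR)
  define B where "B = measure lborel (unit_ball :: (real^'n) set)"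
  have B: "B > 0" unfolding B_def by (rule measure_unit_ball_pos)
  have far: "norm (x - p) \<le> 2 * r * (m / ((r/2) ^ CARD('n) * B))" if x: "x \<in> level f u" for x
  proof (cases "x = p")
    case True
    then show ?thesis using r(1) B by (simp add: m_def)
  next
    case False
    \<comment> \<open>The midpoint of \<open>p\<close> and \<open>x\<close> is the centre of a ball of radius \<open>r/2\<close> in the level, which is why the
      smaller ball is used at \<open>p\<close>, too.\<close>
    define z' where "z' = (1/2) *\<^sub>R (p + x)"
    define d where "d = (1 / (2 * r)) *\<^sub>R (x - p)"
    have d: "d \<noteq> 0" "?T *v d = (1/2) *\<^sub>R (z' - p)"
      using False r(1) by (auto simp: d_def T z'_def vec_eq_iff field_simps)
    have in1: "p + ?T *v w \<in> level f U" if "norm w \<le> 1" for w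
    proof -
      have "norm w * r \<le> 1 * (r * 2)"
        using that r(1) by (intro mult_mono) auto
      then have "p + (r/2) *\<^sub>R w \<in> cball p r"
        using r(1) by (simp add: dist_norm)
      then show ?thesis
        using r(2) sub(2) unfolding T by blast
    qed
    have in2: "z' + ?T *v w \<in> level f U" if "norm w \<le> 1" for w
    proof -
      have "p + r *\<^sub>R w \<in> cball p r"
        using r(1) that by (simp add: dist_norm mult_left_le)
      then have "p + r *\<^sub>R w \<in> level f U"
        using r(2) sub(2) by blast
      moreover have "x \<in> level f U"
        using x sub(1) by blast
      ultimately have "(1/2) *\<^sub>R (p + r *\<^sub>R w) + (1/2) *\<^sub>R x \<in> level f U"
        by (intro convexD[OF convex_level[OF lc]]) auto
      also have "(1/2) *\<^sub>R (p + r *\<^sub>R w) + (1/2) *\<^sub>R x = z' + ?T *v w"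
        by (simp add: T z'_def scaleR_add_right)
      finally show ?thesis .
    qed
    obtain R :: "real^'n^'n" where R: "1 + norm d \<le> det R"
      "\<And>w. norm w \<le> 1 \<Longrightarrow> (1/2) *\<^sub>R (p + z') + (?T ** R) *v w \<in> level f U"
      using stretched_ellipsoid[OF convex_level[OF lc] d in1 in2] by metis
    let ?E = "(\<lambda>w. (1/2) *\<^sub>R (p + z') + (?T ** R) *v w) ` unit_ball"
    have detR: "det R > 0" using R(1) norm_ge_zero[of d] by linarith
    have inv: "invertible (?T ** R)"
      using r(1) detR by (simp add: invertible_det_nz det_mul det)
    have "?E \<subseteq> level f U"
      using R(2) by auto
    moreover have "?E \<in> sets borel"
      by (rule sets_borel_affine_image[OF inv]) simp
    ultimately have "measure lborel ?E \<le> m"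
      unfolding m_def using emeasure_level_finite[of U]
      by (intro measure_mono_fmeasurable) (auto simp: fmeasurable_def less_top)
    then have "(r/2) ^ CARD('n) * det R * B \<le> m"
      using r(1) detR by (simp add: measure_ellipsoid[OF inv] det_mul det abs_mult B_def)
    then have "det R \<le> m / ((r/2) ^ CARD('n) * B)"
      using r(1) B by (simp add: pos_le_divide_eq mult_ac)
    then have "norm d \<le> m / ((r/2) ^ CARD('n) * B)"
      using R(1) by linarith
    then have "2 * r * norm d \<le> 2 * r * (m / ((r/2) ^ CARD('n) * B))"
      using r(1) by (intro mult_left_mono) auto
    also have "2 * r * norm d = norm (x - p)"
      using r(1) by (simp add: d_def)
    finally show ?thesis .
  qed
  then have "level f u \<subseteq> cball p (2 * r * (m / ((r/2) ^ CARD('n) * B)))"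
    by (auto simp: dist_norm norm_minus_commute)
  then show ?thesis
    using bounded_cball bounded_subset by blast
qed

lemma compact_level: "compact (level f u)"
  by (simp add: compact_eq_bounded_closed bounded_level closed_level)

text \<open>Otherwise the compact levels of ever greater height would have a common point, at which \<open>f\<close> exceeds every
real number.\<close>

lemma bounded_above: "\<exists>M. \<forall>x. f x \<le> M"
proof (rule ccontr)
  assume unb: "\<not> ?thesis"
  have "level f (- real k) \<noteq> {}" for k
  proof -
    obtain x where "\<not> f x \<le> exp (real k)"
      using unb by blast
    then have "x \<in> level f (- real k)" by (simp add: level_def)
    then show ?thesis by blast
  qed
  then have "(\<Inter>k. level f (- real k)) \<noteq> {}"
    by (intro compact_nest compact_level level_mono) auto
  then obtain x where x: "\<And>k :: nat. exp (real k) \<le> f x"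
    by (auto simp: level_def)
  obtain k :: nat where "f x < real k"
    using reals_Archimedean2 by blast
  also have "real k < exp (real k)"
    using exp_ge_add_one_self[of "real k"] by linarith
  finally show False
    using x[of k] by simp
qed

text \<open>Dominated convergence: \<open>exp (- k)\<close> times the indicator of the level lies below \<open>f\<close>.\<close>

lemma tail_levels: "(\<lambda>k. exp (- real k) * measure lborel (level f (real k))) \<longlonglongrightarrow> 0"
proof -
  have "(\<lambda>k. \<integral>x. exp (- real k) * indicator (level f (real k)) x \<partial>lborel) \<longlonglongrightarrow> (\<integral>x. 0 \<partial>(lborel :: (real^'n) measure))"
  proof (rule integral_dominated_convergence[where w = f])
    show "AE x in lborel. (\<lambda>k. exp (- real k) * indicator (level f (real k)) x) \<longlonglongrightarrow> (0 :: real)"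
    proof (rule AE_I2)
      fix x :: "real^'n"
      have "(\<lambda>k. exp (- 1) ^ k :: real) \<longlonglongrightarrow> 0"
        by (rule LIMSEQ_power_zero) simp
      then have e: "(\<lambda>k. exp (- real k)) \<longlonglongrightarrow> 0"
        by (simp add: exp_of_nat_mult[symmetric])
      show "(\<lambda>k. exp (- real k) * indicator (level f (real k)) x) \<longlonglongrightarrow> (0 :: real)"
        by (rule tendsto_sandwich[OF _ _ tendsto_const e]) (auto simp: indicator_def)
    qed
    show "AE x in lborel. norm (exp (- real k) * indicator (level f (real k)) x :: real) \<le> f x" for k
      using nonneg by (intro AE_I2) (auto simp: indicator_def level_def)
  qed (use integrable in auto)
  then show ?thesis by simp
qed

text \<open>Ellipsoids at small heights have small integrals because the levels do, so the maximum may be taken over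
heights bounded away from zero, where compactness applies.\<close>

lemma john_pair_exists: "\<exists>u z T. john_pair f u z T"
proof -
  obtain u\<^sub>2 where "interior (level f u\<^sub>2) \<noteq> {}"
    using thick_level_exists by blast
  then obtain p r where r: "r > 0" "cball p r \<subseteq> level f u\<^sub>2"
    by (meson ex_in_conv mem_interior_cball)
  let ?T = "matrix ((*\<^sub>R) r) :: real^'n^'n"
  have T: "?T *v w = r *\<^sub>R w" for w
    by (rule matrix_scaleR_mult)
  have det: "det ?T = r ^ CARD('n)"
    by (rule det_matrix_scaleR)
  have feas: "p + ?T *v w \<in> level f u\<^sub>2" if "norm w \<le> 1" for w
  proof -
    have "p + r *\<^sub>R w \<in> cball p r"
      using r(1) that by (simp add: dist_norm mult_left_le)
    then show ?thesis
      using r(2) unfolding T by blast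
  qed
  define B where "B = measure lborel (unit_ball :: (real^'n) set)"
  have B: "B > 0" unfolding B_def by (rule measure_unit_ball_pos)
  define v\<^sub>0 where "v\<^sub>0 = exp (- u\<^sub>2) * r ^ CARD('n)"
  have v0: "v\<^sub>0 > 0" using r(1) by (simp add: v\<^sub>0_def)
  have "\<forall>\<^sub>F k in sequentially. exp (- real k) * measure lborel (level f (real k)) < v\<^sub>0 * B * exp (- 1)"
    using order_tendstoD(2)[OF tail_levels, of "v\<^sub>0 * B * exp (- 1)"] v0 B by simp
  then obtain N where N: "\<And>k. k \<ge> N \<Longrightarrow> exp (- real k) * measure lborel (level f (real k)) < v\<^sub>0 * B * exp (- 1)"
    by (auto simp: eventually_sequentially)
  \<comment> \<open>The ball of radius \<open>r\<close> at height \<open>exp (- u\<^sub>2)\<close> has the value \<open>v\<^sub>0\<close>.\<close>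
  have low: "exp (- u') * \<bar>det T'\<bar> < v\<^sub>0"
    if u': "u' > real N" and T': "invertible T'" "\<And>w. norm w \<le> 1 \<Longrightarrow> z' + T' *v w \<in> level f u'"
    for u' z' and T' :: "real^'n^'n"
  proof -
    define k where "k = nat \<lceil>u'\<rceil>"
    have "0 \<le> u'" using u' of_nat_0_le_iff[of N] by linarith
    then have k: "u' \<le> real k" "real k < u' + 1"
      by (auto simp: k_def) linarith+
    have "k \<ge> N" using k(1) u' by linarith
    let ?E = "(\<lambda>w. z' + T' *v w) ` unit_ball"
    have "?E \<subseteq> level f (real k)"
      using T'(2) level_mono[OF k(1), of f] by auto
    moreover have "?E \<in> sets borel"
      by (rule sets_borel_affine_image[OF T'(1)]) simp
    ultimately have "measure lborel ?E \<le> measure lborel (level f (real k))"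
      using emeasure_level_finite[of "real k"]
      by (intro measure_mono_fmeasurable) (auto simp: fmeasurable_def less_top)
    then have "exp (- real k) * (\<bar>det T'\<bar> * B) \<le> exp (- real k) * measure lborel (level f (real k))"
      unfolding measure_ellipsoid[OF T'(1)] B_def[symmetric] by (rule mult_left_mono) simp
    also have "\<dots> < v\<^sub>0 * B * exp (- 1)"
      by (rule N[OF \<open>k \<ge> N\<close>])
    finally have "exp (- real k) * (\<bar>det T'\<bar> * B) < v\<^sub>0 * B * exp (- 1)" .
    moreover have "exp (- u') * exp (- 1) \<le> exp (- real k)"
      using k(2) by (simp add: exp_add[symmetric])
    then have "exp (- u') * exp (- 1) * (\<bar>det T'\<bar> * B) \<le> exp (- real k) * (\<bar>det T'\<bar> * B)"
      using B by (intro mult_right_mono) auto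
    ultimately have "(exp (- u') * \<bar>det T'\<bar>) * (exp (- 1) * B) < v\<^sub>0 * (exp (- 1) * B)"
      by (simp add: mult_ac)
    then show ?thesis
      using B by (simp add: mult_less_cancel_right)
  qed
  define w\<^sub>0 where "w\<^sub>0 = max (real N) u\<^sub>2"
  obtain M where M: "\<And>x. f x \<le> M"
    using bounded_above by blast
  have "\<exists>a z (T :: real^'n^'n). exp (- w\<^sub>0) \<le> a \<and> (\<forall>w. norm w \<le> 1 \<longrightarrow> a \<le> f (z + T *v w)) \<and>
    (\<forall>a' z' (T' :: real^'n^'n). exp (- w\<^sub>0) \<le> a' \<longrightarrow> (\<forall>w. norm w \<le> 1 \<longrightarrow> a' \<le> f (z' + T' *v w)) \<longrightarrow>
      a' * \<bar>det T'\<bar> \<le> a * \<bar>det T\<bar>)"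
  proof (rule maximal_ellipsoid_below_exists[OF usc _ M])
    show "bounded {x. exp (- w\<^sub>0) \<le> f x}"
      using bounded_level[of w\<^sub>0] by (simp add: level_def)
    show "exp (- w\<^sub>0) \<le> exp (- u\<^sub>2)"
      by (simp add: w\<^sub>0_def)
    show "exp (- u\<^sub>2) \<le> f (p + ?T *v w)" if "norm w \<le> 1" for w
      using feas[OF that] by (simp add: level_def)
  qed
  then obtain a z and T :: "real^'n^'n" where a: "exp (- w\<^sub>0) \<le> a" "\<And>w. norm w \<le> 1 \<Longrightarrow> a \<le> f (z + T *v w)"
    and max: "\<And>a' z' (T' :: real^'n^'n). exp (- w\<^sub>0) \<le> a' \<Longrightarrow> (\<And>w. norm w \<le> 1 \<Longrightarrow> a' \<le> f (z' + T' *v w)) \<Longrightarrow>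
      a' * \<bar>det T'\<bar> \<le> a * \<bar>det T\<bar>"
    by metis
  have apos: "a > 0"
    using a(1) exp_gt_zero[of "- w\<^sub>0"] by linarith
  have "exp (- u\<^sub>2) * \<bar>det ?T\<bar> \<le> a * \<bar>det T\<bar>"
  proof (rule max)
    show "exp (- w\<^sub>0) \<le> exp (- u\<^sub>2)" by (simp add: w\<^sub>0_def)
    show "exp (- u\<^sub>2) \<le> f (p + ?T *v w)" if "norm w \<le> 1" for w
      using feas[OF that] by (simp add: level_def)
  qed
  then have v0_le: "v\<^sub>0 \<le> a * \<bar>det T\<bar>"
    using r(1) by (simp add: det v\<^sub>0_def)
  have "john_pair f (- ln a) z T"
    unfolding john_pair_def
  proof (intro conjI allI impI)
    have "det T \<noteq> 0" using v0_le v0 by auto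
    then show "invertible T" by (simp add: invertible_det_nz)
    show "z + T *v w \<in> level f (- ln a)" if "norm w \<le> 1" for w
      using a(2)[OF that] apos by (simp add: level_def)
    fix u' z' and T' :: "real^'n^'n"
    assume T': "invertible T'" "\<forall>w. norm w \<le> 1 \<longrightarrow> z' + T' *v w \<in> level f u'"
    show "exp (- u') * \<bar>det T'\<bar> \<le> exp (- (- ln a)) * \<bar>det T\<bar>"
    proof (cases "u' \<le> w\<^sub>0")
      case True
      have "exp (- u') * \<bar>det T'\<bar> \<le> a * \<bar>det T\<bar>"
        using True T'(2) by (intro max) (auto simp: level_def)
      then show ?thesis using apos by simp
    next
      case False
      then have "exp (- u') * \<bar>det T'\<bar> < v\<^sub>0"
        using T' by (intro low[of u' T' z']) (auto simp: w\<^sub>0_def)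
      then show ?thesis
        using v0_le apos by simp
    qed
  qed
  then show ?thesis by blast
qed

end

section \<open>Functions with homothetic levels\<close>

lemma compact_homothety: "compact S \<Longrightarrow> compact (homothety x\<^sub>0 r ` S)"
  unfolding homothety_matrix by (rule compact_affine_image)

lemma convex_homothety: "convex S \<Longrightarrow> convex (homothety x\<^sub>0 r ` S)"
  unfolding homothety_matrix by (rule convex_affine_image)

text \<open>For a compact convex \<open>K\<close> that contains the origin, this is the level structure of the function
\<open>exp (- u\<^sub>1 - \<parallel>x - x\<^sub>0\<parallel>\<^sub>K)\<close>. At \<open>u = u\<^sub>1\<close> the dilation factor is zero and the level is the point \<open>x\<^sub>0\<close>.\<close>

definition conic_levels :: "(real^'n \<Rightarrow> real) \<Rightarrow> real \<Rightarrow> real^'n \<Rightarrow> (real^'n) set \<Rightarrow> bool" where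
  "conic_levels f u\<^sub>1 x\<^sub>0 K \<longleftrightarrow> (\<forall>x. 0 \<le> f x) \<and>
     (\<forall>u. level f u = (if u < u\<^sub>1 then {} else homothety x\<^sub>0 (u - u\<^sub>1) ` K))"

lemma conic_levels_level_concave:
  assumes cl: "conic_levels f u\<^sub>1 x\<^sub>0 K" and K: "convex K"
  shows "level_concave f"
  unfolding level_concave_def
proof (intro conjI allI impI)
  show "0 \<le> f x" for x using cl by (simp add: conic_levels_def)
  fix u w x y and t :: real
  assume x: "x \<in> level f u" and y: "y \<in> level f w" and t: "0 \<le> t" "t \<le> 1"
  have lev: "level f u = (if u < u\<^sub>1 then {} else homothety x\<^sub>0 (u - u\<^sub>1) ` K)" for u
    using cl by (simp add: conic_levels_def)
  obtain a b where a: "a \<in> K" "x = x\<^sub>0 + (u - u\<^sub>1) *\<^sub>R a" "u\<^sub>1 \<le> u" and b: "b \<in> K" "y = x\<^sub>0 + (w - u\<^sub>1) *\<^sub>R b" "u\<^sub>1 \<le> w"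
    using x y by (auto simp: lev homothety_def split: if_splits)
  define p where "p = (1 - t) * (u - u\<^sub>1)"
  define q where "q = t * (w - u\<^sub>1)"
  have pq: "p \<ge> 0" "q \<ge> 0"
    using t a(3) b(3) by (auto simp: p_def q_def)
  have r: "(1 - t) * u + t * w - u\<^sub>1 = p + q"
    by (simp add: p_def q_def algebra_simps)
  have comb: "(1 - t) *\<^sub>R x + t *\<^sub>R y = x\<^sub>0 + (p *\<^sub>R a + q *\<^sub>R b)"
    by (simp add: a(2) b(2) p_def q_def algebra_simps)
  have "\<exists>k\<in>K. p *\<^sub>R a + q *\<^sub>R b = (p + q) *\<^sub>R k"
  proof (cases "p + q = 0")
    case True
    then have "p = 0" "q = 0" using pq by auto
    then show ?thesis using a(1) by auto
  next
    case False
    then have "(p / (p + q)) *\<^sub>R a + (q / (p + q)) *\<^sub>R b \<in> K"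
      using pq a(1) b(1) by (intro convexD[OF K]) (auto simp: add_divide_distrib[symmetric])
    moreover have "p *\<^sub>R a + q *\<^sub>R b = (p + q) *\<^sub>R ((p / (p + q)) *\<^sub>R a + (q / (p + q)) *\<^sub>R b)"
      using False by (simp add: scaleR_add_right)
    ultimately show ?thesis by blast
  qed
  then show "(1 - t) *\<^sub>R x + t *\<^sub>R y \<in> level f ((1 - t) * u + t * w)"
    using pq r unfolding lev comb by (auto simp: homothety_def)
qed

lemma conic_levels_measurable:
  assumes cl: "conic_levels f u\<^sub>1 x\<^sub>0 K" and K: "compact K"
  shows "f \<in> borel_measurable borel"
proof (rule borel_measurableI_ge)
  fix a
  have "closed (level f u)" for u
    using cl compact_homothety[OF K, of x\<^sub>0 "u - u\<^sub>1"] by (auto simp: conic_levels_def compact_imp_closed)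
  then have lb: "level f u \<in> sets borel" for u
    by (simp add: borel_closed)
  show "{x \<in> space borel. a \<le> f x} \<in> sets borel"
  proof (cases "a > 0")
    case True
    then have "{x \<in> space borel. a \<le> f x} = level f (- ln a)"
      by (simp add: level_def)
    then show ?thesis using lb by simp
  next
    case False
    have "a \<le> f x" for x
    proof -
      have "0 \<le> f x" using cl by (simp add: conic_levels_def)
      then show ?thesis using False by simp
    qed
    then have "{x \<in> space borel. a \<le> f x} = UNIV" by simp
    then show ?thesis by simp
  qed
qed

lemma conic_levels_integral:
  fixes f :: "real^'n \<Rightarrow> real"
  assumes cl: "conic_levels f u\<^sub>1 x\<^sub>0 K" and K: "compact K"
  shows "integral\<^sup>L lborel f = real CARD('n) ^ CARD('n) * measure lborel K * exp (- (u\<^sub>1 + real CARD('n))) * cone_ratio CARD('n)"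
    (is "_ = ?I")
proof -
  let ?n = "CARD('n)"
  have nn: "0 \<le> f x" for x using cl by (simp add: conic_levels_def)
  have Kb: "K \<in> sets borel" using K by (simp add: compact_imp_closed borel_closed)
  have Kfin: "emeasure lborel K = ennreal (measure lborel K)"
    using emeasure_compact_finite[OF K] by (simp add: emeasure_eq_ennreal_measure less_top)
  have lev: "level f u = (if u < u\<^sub>1 then {} else homothety x\<^sub>0 (u - u\<^sub>1) ` K)" for u
    using cl by (simp add: conic_levels_def)
  have "(\<integral>\<^sup>+x. ennreal (f x) \<partial>lborel) = (\<integral>\<^sup>+u. ennreal (exp (- u)) * emeasure lborel (level f u) \<partial>lborel)"
    by (rule layer_cake[OF conic_levels_measurable[OF cl K] nn])
  also have "\<dots> = (\<integral>\<^sup>+u. ennreal (exp (- u)) * ennreal ((real ?n ^ ?n * measure lborel K) *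
      (max 0 (1 + (u - (u\<^sub>1 + real ?n)) / real ?n)) ^ ?n) \<partial>lborel)"
  proof (rule nn_integral_cong)
    fix u
    have "1 + (u - (u\<^sub>1 + real ?n)) / real ?n = (u - u\<^sub>1) / real ?n"
      by (simp add: field_simps)
    moreover have "emeasure lborel (level f u) = ennreal ((real ?n ^ ?n * measure lborel K) * (max 0 ((u - u\<^sub>1) / real ?n)) ^ ?n)"
    proof (cases "u > u\<^sub>1")
      case True
      then have "max 0 ((u - u\<^sub>1) / real ?n) = (u - u\<^sub>1) / real ?n" by simp
      moreover have "emeasure lborel (level f u) = ennreal ((u - u\<^sub>1) ^ ?n) * ennreal (measure lborel K)"
        using True emeasure_homothety[OF _ Kb, of "u - u\<^sub>1" x\<^sub>0] by (simp add: lev Kfin)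
      ultimately show ?thesis
        using True by (simp add: ennreal_mult[symmetric] power_divide mult.commute)
    next
      case False
      have "level f u \<subseteq> {x\<^sub>0}"
        using False by (auto simp: lev homothety_def)
      then have "emeasure lborel (level f u) = 0"
        by (metis emeasure_lborel_countable countable_empty countable_insert countable_subset)
      moreover have "max 0 ((u - u\<^sub>1) / real ?n) = 0"
        using False by (simp add: divide_le_0_iff)
      ultimately show ?thesis by (simp add: zero_power)
    qed
    ultimately show "ennreal (exp (- u)) * emeasure lborel (level f u) =
      ennreal (exp (- u)) * ennreal ((real ?n ^ ?n * measure lborel K) * (max 0 (1 + (u - (u\<^sub>1 + real ?n)) / real ?n)) ^ ?n)"
      by simp
  qed
  also have "\<dots> = ennreal ?I"
    by (rule nn_integral_cone_profile) auto
  finally have "(\<integral>\<^sup>+x. ennreal (f x) \<partial>lborel) = ennreal ?I" .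
  moreover have "?I \<ge> 0"
    by (simp add: cone_ratio_def)
  ultimately show ?thesis
    using integral_eq_nn_integral[of f lborel] conic_levels_measurable[OF cl K] nn by simp
qed

lemma power_times_exp_le:
  fixes r :: real
  assumes "r \<ge> 0" "n > 0"
  shows "exp (- r) * r ^ n \<le> exp (- real n) * real n ^ n"
proof -
  have "r / real n \<le> exp (r / real n - 1)"
    using exp_ge_add_one_self[of "r / real n - 1"] by simp
  then have "(r / real n) ^ n \<le> exp (r / real n - 1) ^ n"
    using assms by (intro power_mono) auto
  also have "\<dots> = exp (r - real n)"
    using assms by (simp add: exp_of_nat_mult[symmetric] right_diff_distrib)
  finally have "r ^ n / real n ^ n \<le> exp r * exp (- real n)"
    by (simp add: power_divide exp_add[symmetric])
  then have "r ^ n \<le> exp r * (exp (- real n) * real n ^ n)"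
    using assms by (simp add: divide_le_eq mult.assoc)
  then have "exp (- r) * r ^ n \<le> exp (- r) * (exp r * (exp (- real n) * real n ^ n))"
    by (rule mult_left_mono) simp
  then show ?thesis
    by (simp add: mult.assoc[symmetric] exp_add[symmetric])
qed

text \<open>At the level \<open>u\<^sub>1 + r\<close> the largest ellipsoid has an integral proportional to \<open>exp (- r) * r ^ n\<close>, which is
maximal at \<open>r = n\<close>.\<close>

lemma conic_levels_john_pair:
  fixes f :: "real^'n \<Rightarrow> real"
  assumes cl: "conic_levels f u\<^sub>1 x\<^sub>0 K" and E: "max_ellipsoid K ((\<lambda>w. z + T *v w) ` unit_ball)" and T: "invertible T"
  shows "john_pair f (u\<^sub>1 + real CARD('n)) (homothety x\<^sub>0 (real CARD('n)) z) (matrix ((*\<^sub>R) (real CARD('n))) ** T)"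
proof -
  let ?n = "CARD('n)"
  have lev: "level f u = (if u < u\<^sub>1 then {} else homothety x\<^sub>0 (u - u\<^sub>1) ` K)" for u
    using cl by (simp add: conic_levels_def)
  have sc: "matrix ((*\<^sub>R) r) *v y = r *\<^sub>R y" for r and y :: "real^'n"
    by (rule matrix_scaleR_mult)
  have Bpos: "measure lborel (unit_ball :: (real^'n) set) > 0"
    by (rule measure_unit_ball_pos)
  show ?thesis
    unfolding john_pair_def
  proof (intro conjI allI impI)
    show "invertible (matrix ((*\<^sub>R) (real ?n)) ** T)"
      by (intro invertible_mult invertible_scaling T) simp
    show "homothety x\<^sub>0 (real ?n) z + (matrix ((*\<^sub>R) (real ?n)) ** T) *v w \<in> level f (u\<^sub>1 + real ?n)" if "norm w \<le> 1" for w
    proof -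
      have "z + T *v w \<in> K"
        using E that by (auto simp: max_ellipsoid_def)
      moreover have "homothety x\<^sub>0 (real ?n) z + (matrix ((*\<^sub>R) (real ?n)) ** T) *v w = homothety x\<^sub>0 (real ?n) (z + T *v w)"
        by (simp add: homothety_def matrix_vector_mul_assoc[symmetric] sc scaleR_add_right)
      ultimately show ?thesis
        by (simp add: lev)
    qed
    fix u' z' and T' :: "real^'n^'n"
    assume T': "invertible T'" "\<forall>w. norm w \<le> 1 \<longrightarrow> z' + T' *v w \<in> level f u'"
    define r where "r = u' - u\<^sub>1"
    have "level f u' \<noteq> {}"
      using T'(2)[rule_format, of 0] by auto
    then have r0: "r \<ge> 0"
      by (auto simp: lev r_def split: if_splits)
    have sub: "(\<lambda>w. z' + T' *v w) ` unit_ball \<subseteq> homothety x\<^sub>0 r ` K"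
      using T'(2) r0 by (auto simp: lev r_def)
    have ell: "ellipsoid ((\<lambda>w. z' + T' *v w) ` unit_ball)"
      using T'(1) unfolding ellipsoid_def by blast
    have "\<bar>det T'\<bar> \<le> r ^ ?n * \<bar>det T\<bar>"
    proof (cases "r = 0")
      case True
      then have "(\<lambda>w. z' + T' *v w) ` unit_ball \<subseteq> {x\<^sub>0}"
        using sub by (auto simp: homothety_def)
      then have "emeasure lborel ((\<lambda>w. z' + T' *v w) ` unit_ball) = 0"
        by (metis emeasure_lborel_countable countable_empty countable_insert countable_subset)
      then have "measure lborel ((\<lambda>w. z' + T' *v w) ` unit_ball) = 0"
        by (simp add: measure_def)
      then show ?thesis
        using measure_ellipsoid_pos[OF ell] by simp
    next
      case False
      then have r: "r > 0" using r0 by simp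
      let ?F = "homothety (- (1/r) *\<^sub>R x\<^sub>0) (1/r) ` (\<lambda>w. z' + T' *v w) ` unit_ball"
      have "?F \<subseteq> K"
        using image_mono[OF sub, of "homothety (- (1/r) *\<^sub>R x\<^sub>0) (1/r)"] r
        by (simp add: image_image homothety_def scaleR_add_right)
      moreover have "ellipsoid ?F"
        unfolding homothety_matrix using r by (intro ellipsoid_affine_image invertible_scaling ell) simp
      ultimately have "measure lborel ?F \<le> measure lborel ((\<lambda>w. z + T *v w) ` unit_ball)"
        using E by (simp add: max_ellipsoid_def)
      then have "(1/r) ^ ?n * (\<bar>det T'\<bar> * measure lborel (unit_ball :: (real^'n) set)) \<le> \<bar>det T\<bar> * measure lborel (unit_ball :: (real^'n) set)"
        using measure_homothety[of "1/r" "(\<lambda>w. z' + T' *v w) ` unit_ball" "- (1/r) *\<^sub>R x\<^sub>0"] r sets_borel_ellipsoid[OF ell]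
        by (simp only: measure_ellipsoid[OF T'(1)] measure_ellipsoid[OF T]) simp
      then have "(1/r) ^ ?n * \<bar>det T'\<bar> \<le> \<bar>det T\<bar>"
        using Bpos by (simp add: mult.assoc[symmetric])
      then show ?thesis
        using r by (simp add: power_one_over field_simps)
    qed
    then have "exp (- u') * \<bar>det T'\<bar> \<le> exp (- u') * (r ^ ?n * \<bar>det T\<bar>)"
      by (rule mult_left_mono) simp
    also have "\<dots> = exp (- u\<^sub>1) * (exp (- r) * r ^ ?n) * \<bar>det T\<bar>"
      by (simp add: r_def exp_add[symmetric] mult.assoc[symmetric])
    also have "\<dots> \<le> exp (- u\<^sub>1) * (exp (- real ?n) * real ?n ^ ?n) * \<bar>det T\<bar>"
      using power_times_exp_le[OF r0, of ?n] by (intro mult_right_mono mult_left_mono) auto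
    also have "\<dots> = exp (- (u\<^sub>1 + real ?n)) * \<bar>det (matrix ((*\<^sub>R) (real ?n)) ** T)\<bar>"
      by (simp add: det_mul abs_mult exp_add[symmetric] mult.assoc[symmetric])
    finally show "exp (- u') * \<bar>det T'\<bar> \<le> exp (- (u\<^sub>1 + real ?n)) * \<bar>det (matrix ((*\<^sub>R) (real ?n)) ** T)\<bar>" .
  qed
qed

theorem integral_ratio_conic:
  fixes f :: "real^'n \<Rightarrow> real"
  assumes cl: "conic_levels f u\<^sub>1 x\<^sub>0 K" and K: "compact K" "convex K" and E: "max_ellipsoid K E"
  shows "integral_ratio f = (cone_ratio CARD('n) * (measure lborel K / measure lborel E)) powr (1 / real CARD('n))"
proof -
  let ?n = "CARD('n)"
  obtain z T where T: "invertible (T :: real^'n^'n)" "E = (\<lambda>w. z + T *v w) ` unit_ball"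
    using E by (auto simp: max_ellipsoid_def ellipsoid_def)
  let ?R = "matrix ((*\<^sub>R) (real ?n)) ** T" and ?B = "measure lborel (unit_ball :: (real^'n) set)"
  have jp: "john_pair f (u\<^sub>1 + real ?n) (homothety x\<^sub>0 (real ?n) z) ?R"
    by (rule conic_levels_john_pair[OF cl E[unfolded T(2)] T(1)])
  have R: "invertible ?R"
    using jp by (simp add: john_pair_def)
  have "integral\<^sup>L lborel (john_ellipsoid f) = exp (- (u\<^sub>1 + real ?n)) * \<bar>det ?R\<bar> * ?B"
    unfolding john_ellipsoid_eq[OF conic_levels_level_concave[OF cl K(2)] jp]
    by (rule integral_ellipsoid_function[OF R])
  also have "\<dots> = real ?n ^ ?n * measure lborel E * exp (- (u\<^sub>1 + real ?n))"
    by (simp add: T(2) measure_ellipsoid[OF T(1)] det_mul abs_mult)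
  finally have J: "integral\<^sup>L lborel (john_ellipsoid f) = real ?n ^ ?n * measure lborel E * exp (- (u\<^sub>1 + real ?n))" .
  have "real ?n ^ ?n * exp (- (u\<^sub>1 + real ?n)) \<noteq> 0"
    by simp
  then have "integral\<^sup>L lborel f / integral\<^sup>L lborel (john_ellipsoid f) = cone_ratio ?n * (measure lborel K / measure lborel E)"
    unfolding J conic_levels_integral[OF cl K(1)] by (simp add: field_simps)
  then show ?thesis
    by (simp add: integral_ratio_def)
qed

section \<open>The bound on the integral ratio\<close>

context lc_function
begin

text \<open>The integral weighs the volume of the level \<open>u\<close> with \<open>exp (- u)\<close>. In the equality case the volumes agree
with the profile at every \<open>u\<close>, not only almost everywhere, because the volumes are increasing in \<open>u\<close> and
the profile is continuous.\<close>

lemma integral_profile_bound: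
  assumes W: "W \<ge> 0"
    and bound: "\<And>u. measure lborel (level f u) \<le> W * (max 0 (1 + (u - u\<^sub>0) / real CARD('n))) ^ CARD('n)"
  shows "integral\<^sup>L lborel f \<le> W * exp (- u\<^sub>0) * cone_ratio CARD('n)"
    and "integral\<^sup>L lborel f = W * exp (- u\<^sub>0) * cone_ratio CARD('n) \<Longrightarrow>
      measure lborel (level f u) = W * (max 0 (1 + (u - u\<^sub>0) / real CARD('n))) ^ CARD('n)"
proof -
  let ?n = "CARD('n)"
  define P where "P u = W * (max 0 (1 + (u - u\<^sub>0) / real ?n)) ^ ?n" for u
  define I where "I = W * exp (- u\<^sub>0) * cone_ratio ?n"
  have P: "(\<integral>\<^sup>+u. ennreal (exp (- u)) * ennreal (P u) \<partial>lborel) = ennreal I"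
    unfolding P_def I_def by (rule nn_integral_cone_profile) (use W in auto)
  have I0: "I \<ge> 0"
    using W by (simp add: I_def cone_ratio_def)
  have "ennreal (integral\<^sup>L lborel f) = (\<integral>\<^sup>+u. ennreal (exp (- u)) * emeasure lborel (level f u) \<partial>lborel)"
    by (rule integral_levels[symmetric])
  also have "\<dots> \<le> (\<integral>\<^sup>+u. ennreal (exp (- u)) * ennreal (P u) \<partial>lborel)"
    using bound by (intro nn_integral_mono mult_left_mono) (auto simp: emeasure_level P_def intro!: ennreal_leI)
  finally show "integral\<^sup>L lborel f \<le> W * exp (- u\<^sub>0) * cone_ratio ?n"
    using I0 by (simp add: P I_def)
  assume "integral\<^sup>L lborel f = W * exp (- u\<^sub>0) * cone_ratio ?n"
  then have eq: "integral\<^sup>L lborel f = I" by (simp add: I_def)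
  have "measure lborel (level f u) = P u"
  proof (rule ccontr)
    assume "measure lborel (level f u) \<noteq> P u"
    then have less: "measure lborel (level f u) < P u"
      using bound[of u] by (simp add: P_def)
    define \<epsilon> where "\<epsilon> = (P u - measure lborel (level f u)) / 2"
    have \<epsilon>: "\<epsilon> > 0" using less by (simp add: \<epsilon>_def)
    have "isCont P u"
      unfolding P_def by (intro continuous_intros) auto
    then have "\<forall>\<^sub>F v in at u. P v > P u - \<epsilon>"
      unfolding isCont_def using \<epsilon> by (intro order_tendstoD(1)) auto
    then obtain d where d: "d > 0" "\<And>v. v \<noteq> u \<Longrightarrow> dist v u < d \<Longrightarrow> P u - \<epsilon> < P v"
      unfolding eventually_at by blast
    \<comment> \<open>By continuity of the profile and monotonicity of the volumes a gap at \<open>u\<close> persists to its left.\<close>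
    have gap: "measure lborel (level f v) + \<epsilon> \<le> P v" if v: "v \<in> {u - d<..<u}" for v
    proof -
      have "measure lborel (level f v) \<le> measure lborel (level f u)"
        using level_mono[of v u f] v emeasure_level_finite[of u]
        by (intro measure_mono_fmeasurable) (auto simp: fmeasurable_def less_top)
      moreover have "P u - \<epsilon> < P v"
        using v by (intro d(2)) (auto simp: dist_real_def)
      ultimately show ?thesis
        by (simp add: \<epsilon>_def field_simps)
    qed
    have meas: "(\<lambda>v. ennreal (exp (- v)) * emeasure lborel (level f v)) \<in> borel_measurable lborel"
    proof -
      have "mono (\<lambda>v. measure lborel (level f v))"
      proof (rule monoI)
        fix v w :: real assume "v \<le> w"
        then show "measure lborel (level f v) \<le> measure lborel (level f w)"
          using level_mono[of v w f] emeasure_level_finite[of w]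
          by (intro measure_mono_fmeasurable) (auto simp: fmeasurable_def less_top)
      qed
      then have "(\<lambda>v. measure lborel (level f v)) \<in> borel_measurable borel"
        by (rule borel_measurable_mono)
      then show ?thesis
        unfolding emeasure_level by measurable
    qed
    have "ennreal I + ennreal (exp (- u) * \<epsilon>) * emeasure lborel {u - d<..<u} =
      (\<integral>\<^sup>+v. ennreal (exp (- v)) * emeasure lborel (level f v) + ennreal (exp (- u) * \<epsilon>) * indicator {u - d<..<u} v \<partial>lborel)"
      using meas by (subst nn_integral_add) (auto simp: integral_levels eq nn_integral_cmult_indicator
          intro!: borel_measurable_times_ennreal borel_measurable_indicator)
    also have "\<dots> \<le> (\<integral>\<^sup>+v. ennreal (exp (- v)) * ennreal (P v) \<partial>lborel)"
    proof (rule nn_integral_mono)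
      fix v
      show "ennreal (exp (- v)) * emeasure lborel (level f v) + ennreal (exp (- u) * \<epsilon>) * indicator {u - d<..<u} v
        \<le> ennreal (exp (- v)) * ennreal (P v)"
      proof (cases "v \<in> {u - d<..<u}")
        case True
        have "exp (- u) * \<epsilon> \<le> exp (- v) * \<epsilon>"
          using True \<epsilon> by (intro mult_right_mono) auto
        then have "exp (- v) * measure lborel (level f v) + exp (- u) * \<epsilon> \<le> exp (- v) * (measure lborel (level f v) + \<epsilon>)"
          by (simp add: distrib_left)
        also have "\<dots> \<le> exp (- v) * P v"
          using gap[OF True] by (intro mult_left_mono) auto
        finally have "ennreal (exp (- v) * measure lborel (level f v) + exp (- u) * \<epsilon>) \<le> ennreal (exp (- v) * P v)"
          by (rule ennreal_leI)
        moreover have "P v \<ge> 0" using W by (simp add: P_def)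
        ultimately show ?thesis
          using True \<epsilon> by (simp add: emeasure_level ennreal_mult[symmetric] ennreal_plus[symmetric] del: ennreal_plus)
      next
        case False
        have "ennreal (measure lborel (level f v)) \<le> ennreal (P v)"
          using bound[of v] by (intro ennreal_leI) (simp add: P_def)
        then show ?thesis
          using False by (simp add: emeasure_level mult_left_mono)
      qed
    qed
    also have "\<dots> = ennreal I" by (rule P)
    finally have "ennreal (exp (- u) * \<epsilon>) * emeasure lborel {u - d<..<u} = 0"
      using ennreal_add_left_cancel_le[of "ennreal I" "ennreal (exp (- u) * \<epsilon>) * emeasure lborel {u - d<..<u}" 0] by simp
    then show False
      using \<epsilon> d(1) by (auto simp: mult_le_0_iff not_le)
  qed
  then show "measure lborel (level f u) = W * (max 0 (1 + (u - u\<^sub>0) / real ?n)) ^ ?n"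
    by (simp add: P_def)
qed

end

text \<open>Concavity of the levels places a dilate of \<open>K(u\<^sub>1 + w)\<close> by the factor \<open>s / w\<close>, about a point \<open>x\<^sub>0\<close> of \<open>K(u\<^sub>1)\<close>, into
\<open>K(u\<^sub>1 + s)\<close>. If the volume of \<open>K(u)\<close> is a multiple of \<open>(u - u\<^sub>1)\<^sup>n\<close>, the two sets have the same volume and so
they are equal.\<close>

lemma (in lc_function) conic_of_profile:
  assumes W: "W > 0"
    and prof: "\<And>u. measure lborel (level f u) = W * (max 0 ((u - u\<^sub>1) / real CARD('n))) ^ CARD('n)"
  shows "\<exists>x\<^sub>0. conic_levels f u\<^sub>1 x\<^sub>0 (homothety (- x\<^sub>0) 1 ` level f (u\<^sub>1 + 1)) \<and> level f u\<^sub>1 = {x\<^sub>0}"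
proof -
  let ?n = "CARD('n)"
  have prof_pos: "measure lborel (level f u) = W * ((u - u\<^sub>1) / real ?n) ^ ?n" if "u > u\<^sub>1" for u
    using that by (simp add: prof)
  have mpos: "measure lborel (level f u) > 0" if "u > u\<^sub>1" for u
    using that W by (simp add: prof_pos)
  have int: "interior (level f u) \<noteq> {}" if "u > u\<^sub>1" for u
    using mpos[OF that] measure_level_zero_of_interior[of u] by auto
  have ne: "level f u \<noteq> {}" if "u > u\<^sub>1" for u
    using int[OF that] interior_subset by blast
  have "(\<Inter>k. level f (u\<^sub>1 + inverse (real (Suc k)))) \<noteq> {}"
  proof (rule compact_nest)
    show "level f (u\<^sub>1 + inverse (real (Suc k))) \<noteq> {}" for k
      by (rule ne) simp
    show "level f (u\<^sub>1 + inverse (real (Suc l))) \<subseteq> level f (u\<^sub>1 + inverse (real (Suc k)))" if "k \<le> l" for k l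
      using that by (intro level_mono add_left_mono le_imp_inverse_le) auto
  qed (rule compact_level)
  then obtain x\<^sub>0 where x0': "\<And>k. x\<^sub>0 \<in> level f (u\<^sub>1 + inverse (real (Suc k)))"
    by blast
  have x0: "x\<^sub>0 \<in> level f u\<^sub>1"
  proof -
    have "(\<lambda>k. exp (- (u\<^sub>1 + inverse (real (Suc k))))) \<longlonglongrightarrow> exp (- (u\<^sub>1 + 0))"
      by (intro tendsto_intros LIMSEQ_inverse_real_of_nat)
    then have "exp (- (u\<^sub>1 + 0)) \<le> f x\<^sub>0"
      by (rule LIMSEQ_le_const2) (use x0' in \<open>auto simp: level_def\<close>)
    then show ?thesis by (simp add: level_def)
  qed
  have empty: "level f u = {}" if u: "u < u\<^sub>1" for u
  proof (rule ccontr)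
    assume "level f u \<noteq> {}"
    then obtain y where y: "y \<in> level f u" by blast
    \<comment> \<open>The midpoint of \<open>u\<close> and \<open>w\<close> is \<open>u\<^sub>1\<close>, whose level is a null set; but it contains half of the level \<open>w\<close>.\<close>
    define w where "w = u\<^sub>1 + (u\<^sub>1 - u)"
    have w: "w > u\<^sub>1" using u by (simp add: w_def)
    have sub: "homothety ((1/2) *\<^sub>R y) (1/2) ` level f w \<subseteq> level f u\<^sub>1"
    proof
      fix v assume "v \<in> homothety ((1/2) *\<^sub>R y) (1/2) ` level f w"
      then obtain p where p: "p \<in> level f w" "v = (1 - 1/2) *\<^sub>R y + (1/2) *\<^sub>R p"
        by (auto simp: homothety_def)
      have "(1 - 1/2) *\<^sub>R y + (1/2) *\<^sub>R p \<in> level f ((1 - 1/2) * u + (1/2) * w)"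
        by (rule level_concaveD[OF lc y p(1)]) auto
      moreover have "(1 - 1/2) * u + (1/2) * w = u\<^sub>1"
        by (simp add: w_def field_simps)
      ultimately show "v \<in> level f u\<^sub>1" by (simp only: p(2))
    qed
    have "(1/2) ^ ?n * measure lborel (level f w) = measure lborel (homothety ((1/2) *\<^sub>R y) (1/2) ` level f w)"
      by (rule measure_homothety[symmetric]) auto
    also have "\<dots> \<le> measure lborel (level f u\<^sub>1)"
      using sub emeasure_level_finite[of u\<^sub>1] compact_homothety[OF compact_level[of w]]
      by (intro measure_mono_fmeasurable) (auto simp: fmeasurable_def less_top compact_imp_closed borel_closed)
    also have "\<dots> = 0"
      by (simp add: prof zero_power)
    finally show False
      using mult_pos_pos[OF _ mpos[OF w], of "(1/2) ^ ?n"] by simp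
  qed
  have scale: "level f (u\<^sub>1 + s) = homothety (x\<^sub>0 - (s/w) *\<^sub>R x\<^sub>0) (s/w) ` level f (u\<^sub>1 + w)" if s: "0 < s" "s \<le> w" for s w
  proof -
    let ?H = "homothety (x\<^sub>0 - (s/w) *\<^sub>R x\<^sub>0) (s/w) ` level f (u\<^sub>1 + w)"
    have w: "w > 0" using s by simp
    have sub: "?H \<subseteq> level f (u\<^sub>1 + s)"
    proof
      fix v assume "v \<in> ?H"
      then obtain p where p: "p \<in> level f (u\<^sub>1 + w)" "v = (1 - s/w) *\<^sub>R x\<^sub>0 + (s/w) *\<^sub>R p"
        by (auto simp: homothety_def scaleR_diff_left)
      have "(1 - s/w) *\<^sub>R x\<^sub>0 + (s/w) *\<^sub>R p \<in> level f ((1 - s/w) * u\<^sub>1 + (s/w) * (u\<^sub>1 + w))"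
        using s by (intro level_concaveD[OF lc x0 p(1)]) auto
      moreover have "(1 - s/w) * u\<^sub>1 + (s/w) * (u\<^sub>1 + w) = u\<^sub>1 + s"
        using w by (simp add: field_simps)
      ultimately show "v \<in> level f (u\<^sub>1 + s)" by (simp only: p(2))
    qed
    have "emeasure lborel ?H = ennreal ((s/w) ^ ?n) * emeasure lborel (level f (u\<^sub>1 + w))"
      using s by (intro emeasure_homothety) auto
    also have "\<dots> = ennreal ((s/w) ^ ?n * (W * (w / real ?n) ^ ?n))"
      using w s W by (simp add: emeasure_level prof_pos ennreal_mult[symmetric])
    also have "(s/w) ^ ?n * (W * (w / real ?n) ^ ?n) = W * (s / real ?n) ^ ?n"
      using w by (simp add: power_divide)
    also have "ennreal \<dots> = emeasure lborel (level f (u\<^sub>1 + s))"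
      using s by (simp add: emeasure_level prof_pos)
    finally have eq: "emeasure lborel ?H = emeasure lborel (level f (u\<^sub>1 + s))" .
    have "?H = level f (u\<^sub>1 + s)"
    proof (rule closed_subset_eq_of_emeasure[OF _ sub convex_level[OF lc] closed_level _ eq])
      show "closed ?H"
        by (intro compact_imp_closed compact_homothety compact_level)
      show "interior (level f (u\<^sub>1 + s)) \<noteq> {}"
        using s by (intro int) simp
      show "emeasure lborel (level f (u\<^sub>1 + s)) \<noteq> \<infinity>"
        by (rule emeasure_level_finite)
    qed
    then show ?thesis by simp
  qed
  let ?K = "homothety (- x\<^sub>0) 1 ` level f (u\<^sub>1 + 1)"
  have pos: "level f (u\<^sub>1 + s) = homothety x\<^sub>0 s ` ?K" if s: "s > 0" for s
  proof (cases "s \<le> 1")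
    case True
    show ?thesis
      using scale[OF s True] by (simp add: image_image homothety_def algebra_simps)
  next
    case False
    then have "level f (u\<^sub>1 + 1) = homothety (x\<^sub>0 - (1/s) *\<^sub>R x\<^sub>0) (1/s) ` level f (u\<^sub>1 + s)"
      by (intro scale) auto
    then show ?thesis
      using s by (simp add: image_image homothety_def algebra_simps)
  qed
  have lev1: "level f u\<^sub>1 = {x\<^sub>0}"
  proof (intro equalityI subsetI)
    fix y assume y: "y \<in> level f u\<^sub>1"
    obtain C where C: "\<And>k. k \<in> ?K \<Longrightarrow> norm k \<le> C"
      using compact_imp_bounded[OF compact_homothety[OF compact_level]] unfolding bounded_iff by metis
    have small: "norm (y - x\<^sub>0) \<le> s * C" if s: "s > 0" for s
    proof -
      have "y \<in> level f (u\<^sub>1 + s)"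
        using y s level_mono[of u\<^sub>1 "u\<^sub>1 + s" f] by auto
      then obtain k where "k \<in> ?K" "y = x\<^sub>0 + s *\<^sub>R k"
        unfolding pos[OF s] by (auto simp: homothety_def)
      then show ?thesis
        using C[of k] s by (simp add: mult_left_mono)
    qed
    have "(\<lambda>k. inverse (real (Suc k)) * C) \<longlonglongrightarrow> 0 * C"
      by (intro tendsto_intros LIMSEQ_inverse_real_of_nat)
    then have "norm (y - x\<^sub>0) \<le> 0 * C"
      by (rule LIMSEQ_le_const) (use small in auto)
    then show "y \<in> {x\<^sub>0}" by simp
  qed (use x0 in auto)
  have "conic_levels f u\<^sub>1 x\<^sub>0 ?K"
    unfolding conic_levels_def
  proof (intro conjI allI)
    fix u
    consider "u < u\<^sub>1" | "u = u\<^sub>1" | "u > u\<^sub>1" by linarith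
    then show "level f u = (if u < u\<^sub>1 then {} else homothety x\<^sub>0 (u - u\<^sub>1) ` ?K)"
    proof cases
      case 2
      then show ?thesis
        using lev1 ne[of "u\<^sub>1 + 1"] by (auto simp: homothety_def)
    next
      case 3
      then show ?thesis
        using pos[of "u - u\<^sub>1"] by simp
    qed (simp add: empty)
  qed (rule nonneg)
  with lev1 show ?thesis by blast
qed

text \<open>The hypothesis \<open>vr\<close> is a volume ratio theorem for the levels, with the extremal body of volume \<open>m\<close> whose
largest ellipsoid is the unit ball. It bounds the level \<open>u\<close> by its maximal ellipsoid, which in turn is
bounded by the maximal ellipsoid below the function. If the ratio attains the bound, the volumes follow
the extremal profile; so the levels are conic, and the volume ratio of a level is extremal too.\<close>

theorem (in lc_function) integral_ratio_bound:
  fixes m :: real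
  defines "B \<equiv> measure lborel (unit_ball :: (real^'n) set)"
  assumes m: "m \<ge> 0"
    and vr: "\<And>u E. max_ellipsoid (level f u) E \<Longrightarrow> measure lborel (level f u) * B \<le> m * measure lborel E"
  shows "integral_ratio f \<le> (cone_ratio CARD('n) * (m / B)) powr (1 / real CARD('n))"
    and "integral_ratio f = (cone_ratio CARD('n) * (m / B)) powr (1 / real CARD('n)) \<Longrightarrow>
      \<exists>u\<^sub>1 x\<^sub>0 E. conic_levels f u\<^sub>1 x\<^sub>0 (homothety (- x\<^sub>0) 1 ` level f (u\<^sub>1 + 1)) \<and> level f u\<^sub>1 = {x\<^sub>0} \<and>
        max_ellipsoid (level f (u\<^sub>1 + 1)) E \<and> measure lborel (level f (u\<^sub>1 + 1)) * B = m * measure lborel E"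
proof -
  let ?n = "CARD('n)"
  obtain u\<^sub>0 z T where jp: "john_pair f u\<^sub>0 z T"
    using john_pair_exists by blast
  have T: "invertible T" using jp by (simp add: john_pair_def)
  have detT: "\<bar>det T\<bar> > 0" using T by (simp add: invertible_det_nz)
  have B: "B > 0" unfolding B_def by (rule measure_unit_ball_pos)
  have Eb: "measure lborel E \<le> \<bar>det T\<bar> * B * (max 0 (1 + (u - u\<^sub>0) / real ?n)) ^ ?n" if "max_ellipsoid (level f u) E" for u E
    using john_pair_ellipsoid_bound[OF lc jp, of E u] that by (simp add: max_ellipsoid_def B_def)
  define W where "W = m * \<bar>det T\<bar>"
  have W0: "W \<ge> 0" using m by (simp add: W_def)
  have bound: "measure lborel (level f u) \<le> W * (max 0 (1 + (u - u\<^sub>0) / real ?n)) ^ ?n" for u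
  proof (cases "interior (level f u) = {}")
    case True
    then show ?thesis
      using measure_level_zero_of_interior W0 by simp
  next
    case False
    then obtain E where E: "max_ellipsoid (level f u) E"
      using max_ellipsoid_exists[OF compact_level] by blast
    have "measure lborel (level f u) * B \<le> m * (\<bar>det T\<bar> * B * (max 0 (1 + (u - u\<^sub>0) / real ?n)) ^ ?n)"
      using vr[OF E] mult_left_mono[OF Eb[OF E] m] by linarith
    also have "\<dots> = (W * (max 0 (1 + (u - u\<^sub>0) / real ?n)) ^ ?n) * B"
      by (simp add: W_def mult_ac)
    finally show ?thesis
      using B by simp
  qed
  have J: "integral\<^sup>L lborel (john_ellipsoid f) = exp (- u\<^sub>0) * \<bar>det T\<bar> * B"
    unfolding john_ellipsoid_eq[OF lc jp] B_def by (rule integral_ellipsoid_function[OF T])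
  define q where "q = integral\<^sup>L lborel f / integral\<^sup>L lborel (john_ellipsoid f)"
  have Jpos: "exp (- u\<^sub>0) * \<bar>det T\<bar> * B > 0"
    using detT B by simp
  have q0: "q > 0"
    unfolding q_def J using pos Jpos by simp
  have bnd: "W * exp (- u\<^sub>0) * cone_ratio ?n = cone_ratio ?n * (m / B) * (exp (- u\<^sub>0) * \<bar>det T\<bar> * B)"
    using B by (simp add: W_def)
  have "integral\<^sup>L lborel f \<le> cone_ratio ?n * (m / B) * (exp (- u\<^sub>0) * \<bar>det T\<bar> * B)"
    using integral_profile_bound(1)[OF W0 bound] by (simp only: bnd)
  then have qle: "q \<le> cone_ratio ?n * (m / B)"
    unfolding q_def J using Jpos by (simp add: pos_divide_le_eq)
  show "integral_ratio f \<le> (cone_ratio ?n * (m / B)) powr (1 / real ?n)"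
    unfolding integral_ratio_def q_def[symmetric] using qle q0 by (intro powr_mono2) auto
  assume eq: "integral_ratio f = (cone_ratio ?n * (m / B)) powr (1 / real ?n)"
  have qeq: "q = cone_ratio ?n * (m / B)"
  proof (rule ccontr)
    assume "q \<noteq> cone_ratio ?n * (m / B)"
    then have "q powr (1 / real ?n) < (cone_ratio ?n * (m / B)) powr (1 / real ?n)"
      using qle q0 by (intro powr_less_mono2) auto
    then show False
      using eq by (simp add: integral_ratio_def q_def)
  qed
  have "integral\<^sup>L lborel f = q * (exp (- u\<^sub>0) * \<bar>det T\<bar> * B)"
    unfolding q_def J using Jpos by (intro nonzero_divide_eq_eq[THEN iffD1]) auto
  then have feq: "integral\<^sup>L lborel f = W * exp (- u\<^sub>0) * cone_ratio ?n"
    by (simp only: bnd qeq)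
  have W: "W > 0"
    using feq pos W0 by (cases "W = 0") auto
  \<comment> \<open>The zero of the profile.\<close>
  define u\<^sub>1 where "u\<^sub>1 = u\<^sub>0 - real ?n"
  have arg: "1 + (u - u\<^sub>0) / real ?n = (u - u\<^sub>1) / real ?n" for u
    by (simp add: u\<^sub>1_def field_simps)
  have prof: "measure lborel (level f u) = W * (max 0 ((u - u\<^sub>1) / real ?n)) ^ ?n" for u
    using integral_profile_bound(2)[OF W0 bound feq, of u] by (simp only: arg)
  obtain x\<^sub>0 where x0: "conic_levels f u\<^sub>1 x\<^sub>0 (homothety (- x\<^sub>0) 1 ` level f (u\<^sub>1 + 1))" "level f u\<^sub>1 = {x\<^sub>0}"
    using conic_of_profile[OF W prof] by blast
  have m1: "measure lborel (level f (u\<^sub>1 + 1)) = W * (1 / real ?n) ^ ?n"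
    by (simp add: prof)
  have "measure lborel (level f (u\<^sub>1 + 1)) > 0"
    unfolding m1 using W by simp
  then have "interior (level f (u\<^sub>1 + 1)) \<noteq> {}"
    using measure_level_zero_of_interior[of "u\<^sub>1 + 1"] by auto
  then obtain E where E: "max_ellipsoid (level f (u\<^sub>1 + 1)) E"
    using max_ellipsoid_exists[OF compact_level] by blast
  have "m * measure lborel E \<le> m * (\<bar>det T\<bar> * B * (1 / real ?n) ^ ?n)"
    using mult_left_mono[OF Eb[OF E] m] by (simp add: arg)
  also have "\<dots> = measure lborel (level f (u\<^sub>1 + 1)) * B"
    by (simp add: m1 W_def mult_ac)
  finally have "measure lborel (level f (u\<^sub>1 + 1)) * B = m * measure lborel E"
    using vr[OF E] by simp
  with x0 E show "\<exists>u\<^sub>1 x\<^sub>0 E. conic_levels f u\<^sub>1 x\<^sub>0 (homothety (- x\<^sub>0) 1 ` level f (u\<^sub>1 + 1)) \<and> level f u\<^sub>1 = {x\<^sub>0} \<and>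
        max_ellipsoid (level f (u\<^sub>1 + 1)) E \<and> measure lborel (level f (u\<^sub>1 + 1)) * B = m * measure lborel E"
    by blast
qed

section \<open>Gauges\<close>

text \<open>As \<open>0 \<in> K\<close>, the dilates \<open>l K\<close> increase with \<open>l\<close>, and compactness of \<open>K\<close> shows that a point of all \<open>l K\<close> with
\<open>l > u\<close> lies in \<open>u K\<close>, even for \<open>u = 0\<close>.\<close>

lemma exp_neg_gauge_conic_levels:
  fixes K :: "(real^'n) set"
  assumes K: "compact K" "convex K" "0 \<in> K"
  shows "conic_levels (exp_neg_gauge K) 0 0 K"
proof -
  let ?m = "minkowski_functional K"
  have m0: "0 \<le> ?m x" for x
    unfolding minkowski_functional_def by (rule Inf_greatest) auto
  have lev: "x \<in> level (exp_neg_gauge K) u \<longleftrightarrow> ?m x \<le> ereal u" for x u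
    using m0[of x] by (cases "?m x") (auto simp: level_def exp_neg_gauge_def exp_neg_def)
  have star: "y \<in> (*\<^sub>R) l ` K" if y: "y \<in> (*\<^sub>R) r ` K" and r: "0 \<le> r" "r < l" for y r l
  proof -
    obtain k where k: "k \<in> K" "y = r *\<^sub>R k" using y by auto
    have "(r / l) *\<^sub>R k + (1 - r / l) *\<^sub>R 0 \<in> K"
      using r by (intro convexD[OF K(2) k(1) K(3)]) auto
    then have "(r / l) *\<^sub>R k \<in> K" by simp
    moreover have "y = l *\<^sub>R ((r / l) *\<^sub>R k)"
      using r by (simp add: k(2))
    ultimately show ?thesis by blast
  qed
  have "level (exp_neg_gauge K) u = (if u < 0 then {} else homothety 0 (u - 0) ` K)" for u
  proof (cases "u < 0")
    case True
    have "\<not> ?m x \<le> ereal u" for x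
      using True m0[of x] by (metis ereal_less_eq(5) not_less order_trans zero_ereal_def ereal_less_eq(3))
    then show ?thesis
      using True lev by auto
  next
    case False
    then have u: "u \<ge> 0" by simp
    have "?m x \<le> ereal u \<longleftrightarrow> x \<in> (*\<^sub>R) u ` K" for x
    proof
      assume x: "x \<in> (*\<^sub>R) u ` K"
      show "?m x \<le> ereal u"
      proof (rule ccontr)
        assume "\<not> ?m x \<le> ereal u"
        then obtain l where l: "ereal u < ereal l" "ereal l < ?m x"
          using ereal_dense2[of "ereal u" "?m x"] by (auto simp: not_le)
        have "x \<in> (*\<^sub>R) l ` K"
          using star[OF x u] l(1) by simp
        then have "?m x \<le> ereal l"
          unfolding minkowski_functional_def using l(1) u by (intro Inf_lower) auto
        then show False using l(2) by simp
      qed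
    next
      assume mx: "?m x \<le> ereal u"
      have inl: "x \<in> (*\<^sub>R) l ` K" if "u < l" for l
      proof -
        have "?m x < ereal l"
          using mx that by (meson ereal_less(2) le_less_trans less_ereal.simps(1))
        then obtain r where "r > 0" "x \<in> (*\<^sub>R) r ` K" "r < l"
          unfolding minkowski_functional_def Inf_less_iff by auto
        then show ?thesis
          using star[of x r l] by simp
      qed
      define l where "l k = u + inverse (real (Suc k))" for k
      have "\<forall>k. \<exists>y\<in>K. x = l k *\<^sub>R y"
        using inl by (force simp: l_def)
      then obtain y where y: "\<And>k. y k \<in> K" "\<And>k. x = l k *\<^sub>R y k"
        by metis
      obtain p r where p: "p \<in> K" "strict_mono (r :: nat \<Rightarrow> nat)" "(\<lambda>k. y (r k)) \<longlonglongrightarrow> p"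
        using K(1) y(1) unfolding compact_def o_def by metis
      have "l \<longlonglongrightarrow> u + 0"
        unfolding l_def by (intro tendsto_intros LIMSEQ_inverse_real_of_nat)
      then have "(\<lambda>k. l (r k)) \<longlonglongrightarrow> u"
        using LIMSEQ_subseq_LIMSEQ[OF _ p(2), of l u] by (simp add: o_def)
      then have "(\<lambda>k. l (r k) *\<^sub>R y (r k)) \<longlonglongrightarrow> u *\<^sub>R p"
        using p(3) by (rule tendsto_scaleR)
      then have "(\<lambda>k. x) \<longlonglongrightarrow> u *\<^sub>R p"
        using y(2) by simp
      then have "x = u *\<^sub>R p"
        by (rule LIMSEQ_unique[OF tendsto_const])
      then show "x \<in> (*\<^sub>R) u ` K" using p(1) by blast
    qed
    then show ?thesis
      using False lev by (auto simp: homothety_def)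
  qed
  moreover have "0 \<le> exp_neg_gauge K x" for x
    by (simp add: exp_neg_gauge_def exp_neg_def)
  ultimately show ?thesis
    unfolding conic_levels_def by blast
qed

lemma conic_levels_affine:
  fixes A :: "real^'n^'n"
  assumes g: "conic_levels g 0 0 K" and A: "\<And>x. A' *v (A *v x) = x" "\<And>x. A *v (A' *v x) = x"
  shows "conic_levels (\<lambda>x. g (A *v (x - x\<^sub>0))) 0 x\<^sub>0 ((\<lambda>x. A' *v x) ` K)"
proof -
  have lev: "level g u = (if u < 0 then {} else homothety 0 (u - 0) ` K)" for u
    using g by (simp add: conic_levels_def)
  have "x \<in> level (\<lambda>x. g (A *v (x - x\<^sub>0))) u \<longleftrightarrow> A *v (x - x\<^sub>0) \<in> level g u" for x u
    by (simp add: level_def)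
  moreover have "A *v (x - x\<^sub>0) \<in> homothety 0 u ` K \<longleftrightarrow> x \<in> homothety x\<^sub>0 u ` (\<lambda>x. A' *v x) ` K" for x u
  proof
    assume "A *v (x - x\<^sub>0) \<in> homothety 0 u ` K"
    then obtain k where k: "k \<in> K" "A *v (x - x\<^sub>0) = u *\<^sub>R k"
      by (auto simp: homothety_def)
    then have "x - x\<^sub>0 = u *\<^sub>R (A' *v k)"
      by (metis A(1) matrix_vector_mult_scaleR)
    then have "x = homothety x\<^sub>0 u (A' *v k)"
      by (simp add: homothety_def algebra_simps)
    then show "x \<in> homothety x\<^sub>0 u ` (\<lambda>x. A' *v x) ` K"
      using k(1) by blast
  next
    assume "x \<in> homothety x\<^sub>0 u ` (\<lambda>x. A' *v x) ` K"
    then obtain k where k: "k \<in> K" "x = x\<^sub>0 + u *\<^sub>R (A' *v k)"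
      by (auto simp: homothety_def)
    then have "A *v (x - x\<^sub>0) = homothety 0 u k"
      by (simp add: homothety_def matrix_vector_mult_scaleR A)
    then show "A *v (x - x\<^sub>0) \<in> homothety 0 u ` K"
      using k(1) by blast
  qed
  ultimately show ?thesis
    using g unfolding conic_levels_def lev by (auto simp: set_eq_iff)
qed

lemma conic_levels_scale:
  assumes "conic_levels f u\<^sub>1 x\<^sub>0 K"
  shows "conic_levels (\<lambda>x. f x / exp (- w)) (u\<^sub>1 - w) x\<^sub>0 K"
proof -
  have "level (\<lambda>x. f x / exp (- w)) u = level f (u + w)" for u
    by (auto simp: level_def pos_le_divide_eq exp_add[symmetric] add.commute)
  then show ?thesis
    using assms by (auto simp: conic_levels_def algebra_simps)
qed

lemma conic_levels_unique:
  "conic_levels f u\<^sub>1 x\<^sub>0 K \<Longrightarrow> conic_levels g u\<^sub>1 x\<^sub>0 K \<Longrightarrow> f = g"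
  by (rule eq_of_levels) (auto simp: conic_levels_def)

lemma conic_levels_sup_norm:
  assumes cl: "conic_levels f u\<^sub>1 x\<^sub>0 K" and K: "K \<noteq> {}"
  shows "sup_norm f = exp (- u\<^sub>1)"
proof -
  have lev: "level f u = (if u < u\<^sub>1 then {} else homothety x\<^sub>0 (u - u\<^sub>1) ` K)" for u
    using cl by (simp add: conic_levels_def)
  have "level f u\<^sub>1 = {x\<^sub>0}"
    using K by (auto simp: lev homothety_def)
  then have x0: "exp (- u\<^sub>1) \<le> f x\<^sub>0"
    by (auto simp: level_def)
  have up: "f x \<le> exp (- u\<^sub>1)" for x
  proof (rule ccontr)
    assume "\<not> ?thesis"
    then have *: "exp (- u\<^sub>1) < f x" by simp
    then have pos: "f x > 0"
      using exp_gt_zero[of "- u\<^sub>1"] by linarith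
    have "x \<in> level f (- ln (f x))"
      using pos by (simp add: level_def)
    moreover have "- ln (f x) < u\<^sub>1"
      using * pos by (metis exp_less_cancel_iff exp_ln minus_less_iff)
    ultimately show False by (simp add: lev)
  qed
  show ?thesis
    unfolding sup_norm_def
  proof (rule cSup_eq_maximum)
    show "exp (- u\<^sub>1) \<in> range f"
      using x0 up[of x\<^sub>0] by (metis order_antisym rangeI)
  qed (use up in auto)
qed

text \<open>The levels of such a function are homothetic images of the preimage of \<open>K\<close> under \<open>A\<close>, and the quotient of
the volumes of \<open>K\<close> and of its maximal ellipsoid is an affine invariant.\<close>

lemma integral_ratio_gauge_affine:
  fixes f :: "real^'n \<Rightarrow> real" and A :: "real^'n^'n"
  assumes K: "compact K" "convex K" "0 \<in> K" "max_ellipsoid K E" and A: "invertible A"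
    and f: "\<And>x. 0 \<le> f x" "(\<lambda>x. f x / M) = exp_neg_gauge K \<circ> (\<lambda>x. A *v x + b)"
  shows "integral_ratio f = (cone_ratio CARD('n) * (measure lborel K / measure lborel E)) powr (1 / real CARD('n))"
proof -
  obtain A' where A': "invertible (A' :: real^'n^'n)" "\<And>x. A' *v (A *v x) = x" "\<And>x. A *v (A' *v x) = x"
    using invertible_matrix_inverse[OF A] by metis
  define x\<^sub>0 where "x\<^sub>0 = - (A' *v b)"
  have Ax: "A *v x + b = A *v (x - x\<^sub>0)" for x
    by (simp add: x\<^sub>0_def matrix_vector_right_distrib A')
  have g: "conic_levels (\<lambda>x. f x / M) 0 x\<^sub>0 ((\<lambda>x. A' *v x) ` K)"
    using conic_levels_affine[OF exp_neg_gauge_conic_levels[OF K(1-3)] A'(2,3), of x\<^sub>0]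
    unfolding f(2) by (simp add: o_def Ax)
  have M: "M > 0"
  proof -
    have "level (\<lambda>x. f x / M) 0 \<noteq> {}"
      using g K(3) by (auto simp: conic_levels_def)
    then obtain x where "1 \<le> f x / M" by (auto simp: level_def)
    then show ?thesis
      using f(1)[of x] by (smt (verit) divide_nonneg_nonpos)
  qed
  have "conic_levels (\<lambda>x. (f x / M) / exp (- (- ln (1 / M)))) (0 - (- ln (1 / M))) x\<^sub>0 ((\<lambda>x. A' *v x) ` K)"
    by (rule conic_levels_scale[OF g])
  then have cf: "conic_levels f (ln (1 / M)) x\<^sub>0 ((\<lambda>x. A' *v x) ` K)"
    using M by simp
  have Kb: "K \<in> sets borel" using K(1) by (simp add: compact_imp_closed borel_closed)
  have E: "ellipsoid E" using K(4) by (simp add: max_ellipsoid_def)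
  have "max_ellipsoid ((\<lambda>x. A' *v x) ` K) ((\<lambda>x. A' *v x) ` E)"
    using max_ellipsoid_affine_image[OF A'(1) K(4), of 0] by simp
  moreover have "compact ((\<lambda>x. A' *v x) ` K)" "convex ((\<lambda>x. A' *v x) ` K)"
    using compact_affine_image[OF K(1), of 0 A'] convex_affine_image[OF K(2), of 0 A'] by simp_all
  ultimately have "integral_ratio f = (cone_ratio CARD('n) * (measure lborel ((\<lambda>x. A' *v x) ` K) / measure lborel ((\<lambda>x. A' *v x) ` E))) powr (1 / real CARD('n))"
    by (intro integral_ratio_conic[OF cf])
  moreover have "measure lborel ((\<lambda>x. A' *v x) ` K) = \<bar>det A'\<bar> * measure lborel K"
    "measure lborel ((\<lambda>x. A' *v x) ` E) = \<bar>det A'\<bar> * measure lborel E"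
    using measure_affine_image[OF A'(1) Kb, of 0] measure_affine_image[OF A'(1) sets_borel_ellipsoid[OF E], of 0] by simp_all
  moreover have "\<bar>det A'\<bar> \<noteq> 0"
    using A'(1) by (simp add: invertible_det_nz)
  ultimately show ?thesis by simp
qed

section \<open>Facet normals of the regular simplex\<close>

text \<open>Summing the squared distances from one vertex to all the others shows that the vertices have a common
norm \<open>r\<close> and constant mutual inner products \<open>- r\<^sup>2 / n\<close>. So the vectors \<open>- v / r\<close> for the vertices \<open>v\<close> form a
simplex frame, and they are the outer normals of the facets opposite to the vertices.\<close>

lemma centered_regular_simplex_frame:
  fixes \<Delta> :: "(real^'n) set"
  assumes \<Delta>: "centered_regular_simplex \<Delta>"
  shows "\<exists>R \<rho>. simplex_frame R \<and> \<rho> > 0 \<and> \<Delta> = homothety 0 \<rho> ` polar_polytope R"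
proof -
  let ?n = "real CARD('n)"
  obtain V d where V: "\<not> affine_dependent V" "card V = CARD('n) + 1" "\<Delta> = convex hull V"
    "\<And>x y. x \<in> V \<Longrightarrow> y \<in> V \<Longrightarrow> x \<noteq> y \<Longrightarrow> dist x y = d" "(\<Sum>x\<in>V. x) = 0"
    using \<Delta> unfolding centered_regular_simplex_def by auto
  have finV: "finite V"
    using V(1) by (simp add: aff_independent_finite)
  have dist_sq: "(dist v w)\<^sup>2 = (norm v)\<^sup>2 - 2 * (v \<bullet> w) + (norm w)\<^sup>2" for v w :: "real^'n"
    by (simp add: dist_norm power2_norm_eq_inner inner_diff_left inner_diff_right inner_commute)
  have "2 * (?n + 1) * (norm v)\<^sup>2 = ?n * d\<^sup>2 + (?n + 1) * (norm v)\<^sup>2 - (\<Sum>w\<in>V. (norm w)\<^sup>2)" if v: "v \<in> V" for v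
  proof -
    have "(\<Sum>w\<in>V. (dist v w)\<^sup>2) = (\<Sum>w\<in>V - {v}. (dist v w)\<^sup>2)"
      using finV v by (subst sum.remove[of V v]) auto
    also have "\<dots> = (\<Sum>w\<in>V - {v}. d\<^sup>2)"
      using V(4)[OF v] by (intro sum.cong) auto
    also have "\<dots> = ?n * d\<^sup>2"
      using V(2) v finV by simp
    finally have 1: "(\<Sum>w\<in>V. (dist v w)\<^sup>2) = ?n * d\<^sup>2" .
    have "(\<Sum>w\<in>V. (dist v w)\<^sup>2) = (\<Sum>w\<in>V. (norm v)\<^sup>2 - 2 * (v \<bullet> w) + (norm w)\<^sup>2)"
      by (simp only: dist_sq)
    also have "\<dots> = (?n + 1) * (norm v)\<^sup>2 - 2 * (v \<bullet> (\<Sum>w\<in>V. w)) + (\<Sum>w\<in>V. (norm w)\<^sup>2)"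
      using V(2) by (simp add: sum.distrib sum_subtractf inner_sum_right sum_distrib_left)
    finally show ?thesis
      using 1 V(5) by (simp add: algebra_simps)
  qed
  then have sq: "(?n + 1) * (norm v)\<^sup>2 = ?n * d\<^sup>2 - (\<Sum>w\<in>V. (norm w)\<^sup>2)" if "v \<in> V" for v
    using that by (simp add: algebra_simps)
  have "(\<Sum>v\<in>V. (?n + 1) * (norm v)\<^sup>2) = (?n + 1) * (?n * d\<^sup>2 - (\<Sum>w\<in>V. (norm w)\<^sup>2))"
    using sq V(2) by simp
  then have "(?n + 1) * (\<Sum>w\<in>V. (norm w)\<^sup>2) = (?n + 1) * (?n * d\<^sup>2 - (\<Sum>w\<in>V. (norm w)\<^sup>2))"
    by (simp only: sum_distrib_left)
  then have "(\<Sum>w\<in>V. (norm w)\<^sup>2) = ?n * d\<^sup>2 - (\<Sum>w\<in>V. (norm w)\<^sup>2)"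
    by (simp only: mult_cancel_left) simp
  then have nv: "2 * (?n + 1) * (norm v)\<^sup>2 = ?n * d\<^sup>2" if "v \<in> V" for v
    using sq[OF that] by (simp add: algebra_simps)
  define r where "r = sqrt (?n * d\<^sup>2 / (2 * (?n + 1)))"
  have r2: "(norm v)\<^sup>2 = r\<^sup>2" if "v \<in> V" for v
    using nv[OF that] by (simp add: r_def field_simps)
  have r0: "r \<ge> 0" by (simp add: r_def)
  have nr: "norm v = r" if "v \<in> V" for v
    using r2[OF that] r0 by simp
  have d2: "?n * d\<^sup>2 = 2 * (?n + 1) * r\<^sup>2"
    by (simp add: r_def field_simps)
  have ip: "v \<bullet> w = - r\<^sup>2 / ?n" if "v \<in> V" "w \<in> V" "v \<noteq> w" for v w
  proof -
    have "d\<^sup>2 = r\<^sup>2 - 2 * (v \<bullet> w) + r\<^sup>2"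
      using dist_sq[of v w] by (simp only: V(4)[OF that] r2[OF that(1)] r2[OF that(2)])
    then have vw: "2 * (v \<bullet> w) = 2 * r\<^sup>2 - d\<^sup>2"
      by linarith
    have "?n * (2 * (v \<bullet> w)) = ?n * (2 * r\<^sup>2) - ?n * d\<^sup>2"
      by (simp only: vw right_diff_distrib)
    also have "\<dots> = ?n * (2 * r\<^sup>2) - 2 * (?n + 1) * r\<^sup>2"
      by (simp only: d2)
    also have "\<dots> = - 2 * r\<^sup>2"
    proof -
      have "n * (2 * s) - 2 * (n + 1) * s = - 2 * s" for n s :: real
        by (simp add: algebra_simps)
      then show ?thesis .
    qed
    finally have *: "?n * (2 * (v \<bullet> w)) = - 2 * r\<^sup>2" .
    have "n * (2 * x) = - 2 * s \<Longrightarrow> n * x = - s" for n x s :: real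
      by linarith
    from this[OF *] have "?n * (v \<bullet> w) = - r\<^sup>2" .
    then have "(?n * (v \<bullet> w)) / ?n = - r\<^sup>2 / ?n"
      by (simp only:)
    then show ?thesis by simp
  qed
  have rpos: "r > 0"
  proof (rule ccontr)
    assume "\<not> r > 0"
    then have "r = 0" using r0 by simp
    then have "V \<subseteq> {0}" using nr by auto
    then have "card V \<le> 1" by (metis card.empty card_insert_disjoint card_mono empty_iff finite.emptyI finite_insert One_nat_def)
    then show False using V(2) by simp
  qed
  define \<phi> where "\<phi> v = (- 1 / r) *\<^sub>R v" for v :: "real^'n"
  define R where "R = \<phi> ` V"
  have inj: "inj_on \<phi> V"
    using rpos by (auto simp: inj_on_def \<phi>_def)
  have R1: "norm u = 1" if "u \<in> R" for u
    using that rpos nr by (auto simp: R_def \<phi>_def)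
  have Rip: "u \<bullet> w = - 1 / ?n" if "u \<in> R" "w \<in> R" "u \<noteq> w" for u w
  proof -
    from that(1,2) obtain a b where ab: "a \<in> V" "b \<in> V" "u = \<phi> a" "w = \<phi> b"
      by (auto simp: R_def)
    then have "a \<noteq> b" using that(3) by auto
    have "u \<bullet> w = (a \<bullet> b) / r\<^sup>2"
      by (simp add: ab(3,4) \<phi>_def power2_eq_square)
    then show ?thesis
      using ip[OF ab(1,2) \<open>a \<noteq> b\<close>] rpos by simp
  qed
  have cardR: "card R = CARD('n) + 1" "finite R"
    using V(2) finV by (auto simp: R_def card_image[OF inj])
  have sumR: "(\<Sum>u\<in>R. u) = 0"
  proof -
    have "(\<Sum>u\<in>R. u) = (\<Sum>v\<in>V. \<phi> v)"
      unfolding R_def by (subst sum.reindex[OF inj]) (simp add: o_def)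
    also have "\<dots> = (- 1 / r) *\<^sub>R (\<Sum>v\<in>V. v)"
      unfolding \<phi>_def by (simp only: scaleR_sum_right)
    finally show ?thesis by (simp only: V(5)) simp
  qed
  have frR: "(\<Sum>u\<in>R. (?n / (?n + 1) * (u \<bullet> x)) *\<^sub>R u) = x" for x
  proof -
    define h where "h x = (\<Sum>u\<in>R. (?n / (?n + 1) * (u \<bullet> x)) *\<^sub>R u)" for x
    have lin: "linear h"
      unfolding h_def by (rule linearI)
        (simp_all add: inner_add_right distrib_left scaleR_add_left sum.distrib scaleR_sum_right mult.left_commute del: times_divide_eq_left times_divide_eq_right)
    have hu: "h u = u" if u: "u \<in> R" for u
    proof -
      have "h u = (?n / (?n + 1)) *\<^sub>R (\<Sum>w\<in>R. (w \<bullet> u) *\<^sub>R w)"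
        by (simp add: h_def scaleR_sum_right)
      also have "(\<Sum>w\<in>R. (w \<bullet> u) *\<^sub>R w) = u + (\<Sum>w\<in>R - {u}. (w \<bullet> u) *\<^sub>R w)"
        using cardR(2) u R1[OF u] by (subst sum.remove[of R u]) (auto simp: norm_eq_1)
      also have "(\<Sum>w\<in>R - {u}. (w \<bullet> u) *\<^sub>R w) = (\<Sum>w\<in>R - {u}. (- 1 / ?n) *\<^sub>R w)"
        using Rip u by (intro sum.cong) auto
      also have "\<dots> = (- 1 / ?n) *\<^sub>R ((\<Sum>w\<in>R. w) - u)"
        using cardR(2) u by (simp only: scaleR_sum_right[symmetric] sum_diff1) simp
      also have "u + (- 1 / ?n) *\<^sub>R ((\<Sum>w\<in>R. w) - u) = (1 + 1 / ?n) *\<^sub>R u"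
        by (simp add: sumR scaleR_add_left)
      also have "(?n / (?n + 1)) *\<^sub>R (1 + 1 / ?n) *\<^sub>R u = ((?n / (?n + 1)) * (1 + 1 / ?n)) *\<^sub>R u"
        by simp
      also have "(?n / (?n + 1)) * (1 + 1 / ?n) = 1"
      proof -
        have unit: "(n / (n + 1)) * (1 + 1 / n) = 1" if "n > 0" for n :: real
        proof -
          have "n + 1 \<noteq> 0" using that by linarith
          then show ?thesis using that by (simp add: divide_simps)
        qed
        show ?thesis by (rule unit) simp
      qed
      finally show ?thesis by simp
    qed
    have "affine hull V = UNIV"
      using affine_independent_span_eq[OF V(1)] V(2) by simp
    then have "span V = UNIV"
      using affine_hull_subset_span[of V] by blast
    moreover have "V \<subseteq> span R"
    proof
      fix v assume "v \<in> V"
      then have "\<phi> v \<in> span R" by (simp add: R_def span_base)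
      then have "(- r) *\<^sub>R \<phi> v \<in> span R" by (rule span_scale)
      then show "v \<in> span R" using rpos by (simp add: \<phi>_def)
    qed
    ultimately have "span R = UNIV"
      by (metis span_minimal subspace_span top.extremum_unique)
    then have "x \<in> span R" by simp
    then have "h x = x"
    proof (induction rule: span_induct_alt)
      case base
      then show ?case using lin by (simp add: linear_0)
    next
      case (step c u y)
      then show ?case using lin hu by (simp add: linear_add linear_cmul)
    qed
    then show ?thesis by (simp add: h_def)
  qed
  have tf: "tight_frame R (\<lambda>_. ?n / (?n + 1))"
    by unfold_locales (use cardR R1 frR in auto)
  have sR: "simplex_frame R"
    using tf Rip by (simp add: simplex_frame_def)
  define \<rho> where "\<rho> = r / ?n"
  have \<rho>: "\<rho> > 0" using rpos by (simp add: \<rho>_def)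
  have vR: "v = - (r *\<^sub>R \<phi> v)" for v
    using rpos by (simp add: \<phi>_def)
  have "\<Delta> = homothety 0 \<rho> ` polar_polytope R"
  proof (intro equalityI)
    have "V \<subseteq> homothety 0 \<rho> ` polar_polytope R"
    proof
      fix v assume v: "v \<in> V"
      have "u \<bullet> ((1/\<rho>) *\<^sub>R v) \<le> 1" if u: "u \<in> R" for u
      proof -
        have "\<phi> v \<in> R" using v by (simp add: R_def)
        then have "- 1 / ?n \<le> u \<bullet> \<phi> v"
          using simplex_frame_inner[OF sR u] by (simp add: order_trans[of "-1" 0])
        then have "r * (- 1 / ?n) \<le> r * (u \<bullet> \<phi> v)"
          using rpos by (intro mult_left_mono) auto
        moreover have "u \<bullet> v = - (r * (u \<bullet> \<phi> v))"
          by (subst vR) simp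
        ultimately have "u \<bullet> v \<le> \<rho>"
          by (simp add: \<rho>_def)
        then show ?thesis using \<rho> by simp
      qed
      then have "(1/\<rho>) *\<^sub>R v \<in> polar_polytope R"
        by (simp add: polar_polytope_def)
      moreover have "v = homothety 0 \<rho> ((1/\<rho>) *\<^sub>R v)"
        using \<rho> by (simp add: homothety_def)
      ultimately show "v \<in> homothety 0 \<rho> ` polar_polytope R" by blast
    qed
    moreover have "convex (polar_polytope R)"
      by (rule convex_polar_polytope)
    ultimately show "\<Delta> \<subseteq> homothety 0 \<rho> ` polar_polytope R"
      unfolding V(3) by (intro hull_minimal convex_homothety)
  next
    show "homothety 0 \<rho> ` polar_polytope R \<subseteq> \<Delta>"
    proof
      fix y assume "y \<in> homothety 0 \<rho> ` polar_polytope R"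
      then obtain x where x: "x \<in> polar_polytope R" "y = \<rho> *\<^sub>R x"
        by (auto simp: homothety_def)
      \<comment> \<open>The barycentric coordinates of \<open>y\<close> are proportional to the slacks of the facet inequalities.\<close>
      define l where "l v = (1 - \<phi> v \<bullet> x) / (?n + 1)" for v
      have l0: "l v \<ge> 0" if "v \<in> V" for v
        using x(1) that by (auto simp: l_def polar_polytope_def R_def)
      have sphi: "(\<Sum>v\<in>V. g (\<phi> v)) = (\<Sum>u\<in>R. g u)" for g :: "_ \<Rightarrow> 'b::comm_monoid_add"
        by (simp add: R_def sum.reindex[OF inj])
      have "(\<Sum>v\<in>V. l v) = (\<Sum>u\<in>R. 1 - u \<bullet> x) / (?n + 1)"
        using sphi[of "\<lambda>u. (1 - u \<bullet> x) / (?n + 1)"] by (simp add: l_def sum_divide_distrib)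
      also have "(\<Sum>u\<in>R. 1 - u \<bullet> x) = (?n + 1) - (\<Sum>u\<in>R. u) \<bullet> x"
        using cardR by (simp add: sum_subtractf inner_sum_left)
      finally have l1: "(\<Sum>v\<in>V. l v) = 1"
        by (simp add: sumR add_pos_pos)
      have "(\<Sum>v\<in>V. l v *\<^sub>R v) = (\<Sum>u\<in>R. - ((r * ((1 - u \<bullet> x) / (?n + 1))) *\<^sub>R u))"
      proof -
        have "l v *\<^sub>R v = - ((r * ((1 - \<phi> v \<bullet> x) / (?n + 1))) *\<^sub>R \<phi> v)" for v
        proof -
          have "l v *\<^sub>R v = l v *\<^sub>R (- (r *\<^sub>R \<phi> v))"
            by (simp only: vR[of v, symmetric])
          also have "\<dots> = - ((r * l v) *\<^sub>R \<phi> v)"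
            by (simp add: mult.commute)
          finally show ?thesis by (simp only: l_def)
        qed
        then show ?thesis by (simp only: sphi[of "\<lambda>u. - ((r * ((1 - u \<bullet> x) / (?n + 1))) *\<^sub>R u)"])
      qed
      also have "\<dots> = - (r / (?n + 1)) *\<^sub>R (\<Sum>u\<in>R. u) + (r / (?n + 1)) *\<^sub>R (\<Sum>u\<in>R. (u \<bullet> x) *\<^sub>R u)"
        by (simp add: scaleR_sum_right sum.distrib[symmetric] sum_subtractf[symmetric] diff_divide_distrib scaleR_diff_left right_diff_distrib)
      also have "(r / (?n + 1)) *\<^sub>R (\<Sum>u\<in>R. (u \<bullet> x) *\<^sub>R u) = \<rho> *\<^sub>R (\<Sum>u\<in>R. (?n / (?n + 1) * (u \<bullet> x)) *\<^sub>R u)"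
        by (simp add: scaleR_sum_right \<rho>_def)
      finally have "(\<Sum>v\<in>V. l v *\<^sub>R v) = y"
        by (simp only: frR sumR x(2)) simp
      then show "y \<in> \<Delta>"
        unfolding V(3) convex_hull_finite[OF finV] using l0 l1 by blast
    qed
  qed
  with sR \<rho> show ?thesis by blast
qed

section \<open>The extremal integral ratios\<close>

lemma integrable_log_concave_lc_function:
  "integrable_log_concave f \<Longrightarrow> lc_function f"
  by (simp add: integrable_log_concave_def lc_function_def log_concave_level_concave)

lemma gauge_form_of_conic_levels:
  fixes f :: "real^'n \<Rightarrow> real" and A :: "real^'n^'n"
  assumes cl: "conic_levels f u\<^sub>1 x\<^sub>0 ((\<lambda>x. A *v x) ` K)" and A: "invertible A"
    and K: "compact K" "convex K" "0 \<in> K"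
  shows "\<exists>(A' :: real^'n^'n) b. invertible A' \<and> (\<lambda>x. f x / sup_norm f) = exp_neg_gauge K \<circ> (\<lambda>x. A' *v x + b) \<and>
    b = - (A' *v x\<^sub>0)"
proof -
  obtain A' where A': "invertible (A' :: real^'n^'n)" "\<And>x. A' *v (A *v x) = x" "\<And>x. A *v (A' *v x) = x"
    using invertible_matrix_inverse[OF A] by metis
  have "sup_norm f = exp (- u\<^sub>1)"
    using conic_levels_sup_norm[OF cl] K(3) by blast
  then have "conic_levels (\<lambda>x. f x / sup_norm f) 0 x\<^sub>0 ((\<lambda>x. A *v x) ` K)"
    using conic_levels_scale[OF cl, of u\<^sub>1] by simp
  moreover have "conic_levels (\<lambda>x. exp_neg_gauge K (A' *v (x - x\<^sub>0))) 0 x\<^sub>0 ((\<lambda>x. A *v x) ` K)"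
    by (rule conic_levels_affine[OF exp_neg_gauge_conic_levels[OF K] A'(3,2)])
  ultimately have "(\<lambda>x. f x / sup_norm f) = (\<lambda>x. exp_neg_gauge K (A' *v (x - x\<^sub>0)))"
    by (rule conic_levels_unique)
  also have "\<dots> = exp_neg_gauge K \<circ> (\<lambda>x. A' *v x + - (A' *v x\<^sub>0))"
    by (simp add: o_def matrix_vector_mult_diff_distrib)
  finally show ?thesis
    using A'(1) by blast
qed

text \<open>The bound and the case of equality follow from \<open>integral_ratio_bound\<close> with \<open>volume_ratio_simplex\<close>. All translates of
the simplex have the same volume ratio, whence the ratio of \<open>g c\<close> does not depend on \<open>c\<close>. In the case of
equality \<open>f\<close> is the gauge exponential of a simplex, up to a factor, about a point \<open>x\<^sub>0\<close> of that simplex; the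
position of \<open>x\<^sub>0\<close> in the simplex is the parameter \<open>c'\<close>.\<close>

theorem integral_ratio_simplex:
  fixes f :: "real^'n \<Rightarrow> real" and \<Delta> :: "(real^'n) set"
  assumes \<Delta>: "centered_regular_simplex \<Delta>" and f: "integrable_log_concave f" and c: "c \<in> \<Delta>"
  defines "g \<equiv> \<lambda>c. exp_neg_gauge ((\<lambda>x. x - c) ` \<Delta>)"
  shows "integral_ratio f \<le> integral_ratio (g c)"
    and "integral_ratio f = integral_ratio (g c) \<longleftrightarrow>
      (\<exists>c'\<in>\<Delta>. \<exists>(A::real^'n^'n) b. invertible A \<and> (\<lambda>x. f x / sup_norm f) = g c' \<circ> (\<lambda>x. A *v x + b))"
proof -
  let ?n = "CARD('n)" and ?B = "measure lborel (unit_ball :: (real^'n) set)"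
  obtain R \<rho> where R: "simplex_frame R" and \<rho>: "\<rho> > 0" and \<Delta>R: "\<Delta> = homothety 0 \<rho> ` polar_polytope R"
    using centered_regular_simplex_frame[OF \<Delta>] by blast
  interpret lc_function f
    by (rule integrable_log_concave_lc_function[OF f])
  define m where "m = measure lborel (polar_polytope R)"
  have m: "m \<ge> 0" by (simp add: m_def)
  have \<Delta>_cc: "compact \<Delta>" "convex \<Delta>"
  proof -
    obtain V where V: "\<not> affine_dependent V" "\<Delta> = convex hull V"
      using \<Delta> unfolding centered_regular_simplex_def by auto
    then show "compact \<Delta>" "convex \<Delta>"
      by (auto simp: aff_independent_finite finite_imp_compact_convex_hull)
  qed
  have translate: "(\<lambda>x. x - c) ` \<Delta> = (\<lambda>x. (0 - c) + matrix ((*\<^sub>R) \<rho>) *v x) ` polar_polytope R" for c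
    by (simp add: \<Delta>R image_image homothety_def matrix_scaleR_mult)
  have body: "compact ((\<lambda>x. x - c) ` \<Delta>)" "convex ((\<lambda>x. x - c) ` \<Delta>)" for c
    using \<Delta>_cc by (auto intro: compact_translation_subtract)
  have zero: "0 \<in> (\<lambda>x. x - c) ` \<Delta>" if "c \<in> \<Delta>" for c
    using that by (auto intro!: image_eqI[of _ _ c])
  have inv: "invertible (matrix ((*\<^sub>R) \<rho>) :: real^'n^'n)"
    using \<rho> by (simp add: invertible_scaling)
  have max: "max_ellipsoid ((\<lambda>x. x - c) ` \<Delta>) ((\<lambda>x. (0 - c) + matrix ((*\<^sub>R) \<rho>) *v x) ` unit_ball)" for c
    unfolding translate by (rule max_ellipsoid_affine_image[OF inv max_ellipsoid_simplex[OF R]])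
  have quot: "measure lborel ((\<lambda>x. x - c) ` \<Delta>) / measure lborel ((\<lambda>x. (0 - c) + matrix ((*\<^sub>R) \<rho>) *v x) ` unit_ball) = m / ?B" for c
  proof -
    have "\<bar>det (matrix ((*\<^sub>R) \<rho>) :: real^'n^'n)\<bar> \<noteq> 0"
      using inv by (simp add: invertible_det_nz)
    then show ?thesis
      unfolding translate m_def
      using measure_affine_image[OF inv borel_closed[OF closed_polar_polytope], of "0 - c" R]
      by (simp only: measure_ellipsoid[OF inv]) simp
  qed
  have ratio: "integral_ratio h = (cone_ratio ?n * (m / ?B)) powr (1 / real ?n)"
    if "c \<in> \<Delta>" "invertible (A :: real^'n^'n)" "\<And>x. 0 \<le> h x" "(\<lambda>x. h x / M) = g c \<circ> (\<lambda>x. A *v x + b)" for h M c A b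
  proof -
    have "(\<lambda>x. h x / M) = exp_neg_gauge ((\<lambda>x. x - c) ` \<Delta>) \<circ> (\<lambda>x. A *v x + b)"
      using that(4) by (simp only: g_def)
    from integral_ratio_gauge_affine[OF body zero[OF that(1)] max that(2) that(3) this]
    show ?thesis by (simp only: quot)
  qed
  have ratio_g: "integral_ratio (g c) = (cone_ratio ?n * (m / ?B)) powr (1 / real ?n)"
  proof (rule ratio[OF c])
    show "invertible (mat 1 :: real^'n^'n)" by (simp add: invertible_det_nz)
    show "0 \<le> g c x" for x by (simp add: g_def exp_neg_gauge_def exp_neg_def)
    show "(\<lambda>x. g c x / 1) = g c \<circ> (\<lambda>x. mat 1 *v x + 0)" by (simp add: o_def)
  qed
  have vr: "measure lborel (level f u) * ?B \<le> m * measure lborel E" if "max_ellipsoid (level f u) E" for u E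
    unfolding m_def by (rule volume_ratio_simplex(1)[OF compact_level convex_level[OF lc] that R])
  show "integral_ratio f \<le> integral_ratio (g c)"
    unfolding ratio_g by (rule integral_ratio_bound(1)[OF m vr])
  show "integral_ratio f = integral_ratio (g c) \<longleftrightarrow>
      (\<exists>c'\<in>\<Delta>. \<exists>(A::real^'n^'n) b. invertible A \<and> (\<lambda>x. f x / sup_norm f) = g c' \<circ> (\<lambda>x. A *v x + b))"
  proof
    assume "\<exists>c'\<in>\<Delta>. \<exists>(A::real^'n^'n) b. invertible A \<and> (\<lambda>x. f x / sup_norm f) = g c' \<circ> (\<lambda>x. A *v x + b)"
    then show "integral_ratio f = integral_ratio (g c)"
      unfolding ratio_g using ratio nonneg by blast
  next
    assume "integral_ratio f = integral_ratio (g c)"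
    then have opt: "integral_ratio f = (cone_ratio ?n * (m / ?B)) powr (1 / real ?n)"
      by (simp only: ratio_g)
    have "\<exists>u\<^sub>1 x\<^sub>0 E. conic_levels f u\<^sub>1 x\<^sub>0 (homothety (- x\<^sub>0) 1 ` level f (u\<^sub>1 + 1)) \<and> level f u\<^sub>1 = {x\<^sub>0} \<and>
        max_ellipsoid (level f (u\<^sub>1 + 1)) E \<and> measure lborel (level f (u\<^sub>1 + 1)) * ?B = m * measure lborel E"
      by (rule integral_ratio_bound(2)[OF m _ opt]) (rule vr)
    then obtain u\<^sub>1 x\<^sub>0 E where cl: "conic_levels f u\<^sub>1 x\<^sub>0 (homothety (- x\<^sub>0) 1 ` level f (u\<^sub>1 + 1))"
      and x0: "level f u\<^sub>1 = {x\<^sub>0}" and E: "max_ellipsoid (level f (u\<^sub>1 + 1)) E"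
      and eq: "measure lborel (level f (u\<^sub>1 + 1)) * ?B = m * measure lborel E"
      by blast
    obtain A :: "real^'n^'n" and b where A: "invertible A" "level f (u\<^sub>1 + 1) = (\<lambda>x. b + A *v x) ` polar_polytope R"
      using volume_ratio_simplex(2)[OF compact_level convex_level[OF lc] E R] eq unfolding m_def by blast
    define P where "P = A ** matrix ((*\<^sub>R) (1 / \<rho>))"
    have P: "invertible P"
      unfolding P_def using A(1) \<rho> by (intro invertible_mult invertible_scaling) auto
    have "P *v (\<rho> *\<^sub>R x) = A *v x" for x
    proof -
      have "matrix ((*\<^sub>R) (1 / \<rho>)) *v (\<rho> *\<^sub>R x) = x"
        using \<rho> by (simp add: matrix_scaleR_mult)
      then show ?thesis by (simp add: P_def matrix_vector_mul_assoc[symmetric])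
    qed
    then have lev: "homothety (- x\<^sub>0) 1 ` level f (u\<^sub>1 + 1) = (\<lambda>x. (b - x\<^sub>0) + P *v x) ` \<Delta>"
      by (simp add: A(2) \<Delta>R image_image homothety_def add_diff_eq diff_add_eq)
    have "x\<^sub>0 \<in> level f (u\<^sub>1 + 1)"
      using x0 level_mono[of u\<^sub>1 "u\<^sub>1 + 1" f] by auto
    then have "0 \<in> homothety (- x\<^sub>0) 1 ` level f (u\<^sub>1 + 1)"
      by (intro image_eqI[of _ _ x\<^sub>0]) (auto simp: homothety_def)
    then obtain c' where c': "c' \<in> \<Delta>" "(b - x\<^sub>0) + P *v c' = 0"
      unfolding lev by auto
    have "homothety (- x\<^sub>0) 1 ` level f (u\<^sub>1 + 1) = (\<lambda>x. P *v x) ` (\<lambda>x. x - c') ` \<Delta>"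
    proof -
      have "b - x\<^sub>0 = - (P *v c')"
        using c'(2) by (simp add: eq_neg_iff_add_eq_0)
      then show ?thesis
        unfolding lev by (simp add: image_image matrix_vector_mult_diff_distrib)
    qed
    then have "conic_levels f u\<^sub>1 x\<^sub>0 ((\<lambda>x. P *v x) ` (\<lambda>x. x - c') ` \<Delta>)"
      using cl by simp
    from gauge_form_of_conic_levels[OF this P body zero[OF c'(1)]] c'(1)
    show "\<exists>c'\<in>\<Delta>. \<exists>(A::real^'n^'n) b. invertible A \<and> (\<lambda>x. f x / sup_norm f) = g c' \<circ> (\<lambda>x. A *v x + b)"
      unfolding g_def by blast
  qed
qed

text \<open>The levels of an even function are symmetric, so \<open>volume_ratio_cube\<close> applies to them. In the case of
equality the symmetric level \<open>{x\<^sub>0}\<close> forces \<open>x\<^sub>0 = 0\<close>, so that only linear maps occur.\<close>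

theorem integral_ratio_cube:
  fixes f :: "real^'n \<Rightarrow> real"
  assumes f: "integrable_log_concave f" and even: "\<And>x. f (- x) = f x"
  defines "g \<equiv> exp_neg_gauge (unit_cube :: (real^'n) set)"
  shows "integral_ratio f \<le> integral_ratio g"
    and "integral_ratio f = integral_ratio g \<longleftrightarrow>
      (\<exists>A::real^'n^'n. invertible A \<and> (\<lambda>x. f x / sup_norm f) = g \<circ> (\<lambda>x. A *v x))"
proof -
  let ?n = "CARD('n)" and ?B = "measure lborel (unit_ball :: (real^'n) set)" and ?C = "unit_cube :: (real^'n) set"
  interpret lc_function f
    by (rule integrable_log_concave_lc_function[OF f])
  define m where "m = measure lborel ?C"
  have m: "m \<ge> 0" by (simp add: m_def)
  have C: "compact ?C" "convex ?C" "0 \<in> ?C"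
    by (auto simp: unit_cube_cbox compact_cbox convex_box) (auto simp: mem_box_cart)
  have sym: "- x \<in> level f u" if "x \<in> level f u" for x u
    using that even by (simp add: level_def)
  have ratio: "integral_ratio h = (cone_ratio ?n * (m / ?B)) powr (1 / real ?n)"
    if "invertible (A :: real^'n^'n)" "\<And>x. 0 \<le> h x" "(\<lambda>x. h x / M) = g \<circ> (\<lambda>x. A *v x + 0)" for h M A
    unfolding m_def by (rule integral_ratio_gauge_affine[OF C max_ellipsoid_cube that[unfolded g_def]])
  have ratio_g: "integral_ratio g = (cone_ratio ?n * (m / ?B)) powr (1 / real ?n)"
  proof (rule ratio)
    show "invertible (mat 1 :: real^'n^'n)" by (simp add: invertible_det_nz)
    show "0 \<le> g x" for x by (simp add: g_def exp_neg_gauge_def exp_neg_def)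
    show "(\<lambda>x. g x / 1) = g \<circ> (\<lambda>x. mat 1 *v x + 0)" by (simp add: o_def)
  qed
  have vr: "measure lborel (level f u) * ?B \<le> m * measure lborel E" if "max_ellipsoid (level f u) E" for u E
    unfolding m_def by (rule volume_ratio_cube(1)[OF compact_level convex_level[OF lc] that sym])
  show "integral_ratio f \<le> integral_ratio g"
    unfolding ratio_g by (rule integral_ratio_bound(1)[OF m vr])
  show "integral_ratio f = integral_ratio g \<longleftrightarrow>
      (\<exists>A::real^'n^'n. invertible A \<and> (\<lambda>x. f x / sup_norm f) = g \<circ> (\<lambda>x. A *v x))"
  proof
    assume "\<exists>A::real^'n^'n. invertible A \<and> (\<lambda>x. f x / sup_norm f) = g \<circ> (\<lambda>x. A *v x)"
    then obtain A :: "real^'n^'n" where "invertible A" "(\<lambda>x. f x / sup_norm f) = g \<circ> (\<lambda>x. A *v x + 0)"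
      by auto
    then show "integral_ratio f = integral_ratio g"
      unfolding ratio_g using ratio nonneg by blast
  next
    assume "integral_ratio f = integral_ratio g"
    then have opt: "integral_ratio f = (cone_ratio ?n * (m / ?B)) powr (1 / real ?n)"
      by (simp only: ratio_g)
    have "\<exists>u\<^sub>1 x\<^sub>0 E. conic_levels f u\<^sub>1 x\<^sub>0 (homothety (- x\<^sub>0) 1 ` level f (u\<^sub>1 + 1)) \<and> level f u\<^sub>1 = {x\<^sub>0} \<and>
        max_ellipsoid (level f (u\<^sub>1 + 1)) E \<and> measure lborel (level f (u\<^sub>1 + 1)) * ?B = m * measure lborel E"
      by (rule integral_ratio_bound(2)[OF m _ opt]) (rule vr)
    then obtain u\<^sub>1 x\<^sub>0 E where cl: "conic_levels f u\<^sub>1 x\<^sub>0 (homothety (- x\<^sub>0) 1 ` level f (u\<^sub>1 + 1))"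
      and x0: "level f u\<^sub>1 = {x\<^sub>0}" and E: "max_ellipsoid (level f (u\<^sub>1 + 1)) E"
      and eq: "measure lborel (level f (u\<^sub>1 + 1)) * ?B = m * measure lborel E"
      by blast
    have "- x\<^sub>0 \<in> level f u\<^sub>1"
      by (rule sym) (simp add: x0)
    then have "- x\<^sub>0 = x\<^sub>0" by (simp add: x0)
    then have z: "x\<^sub>0 = 0" by (simp add: neg_eq_iff_add_eq_0 vec_eq_iff)
    obtain A :: "real^'n^'n" where A: "invertible A" "level f (u\<^sub>1 + 1) = (\<lambda>x. A *v x) ` ?C"
      using volume_ratio_cube(2)[OF compact_level convex_level[OF lc] E sym] eq unfolding m_def by blast
    have "homothety (- x\<^sub>0) 1 ` level f (u\<^sub>1 + 1) = (\<lambda>x. A *v x) ` ?C"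
      by (simp add: z homothety_def A(2))
    then have "conic_levels f u\<^sub>1 x\<^sub>0 ((\<lambda>x. A *v x) ` ?C)"
      using cl by simp
    from gauge_form_of_conic_levels[OF this A(1) C]
    show "\<exists>A::real^'n^'n. invertible A \<and> (\<lambda>x. f x / sup_norm f) = g \<circ> (\<lambda>x. A *v x)"
      by (auto simp: g_def z)
  qed
qed

theorem theorem1p2:
  fixes f :: "real^'n \<Rightarrow> real"
    and \<Delta> :: "(real^'n) set"
    and g\<^sub>c :: "real^'n \<Rightarrow> real^'n \<Rightarrow> real"
    and g :: "real^'n \<Rightarrow> real"
  assumes \<Delta>: "centered_regular_simplex \<Delta>"
    and f: "integrable_log_concave f"
    and g\<^sub>c: "\<And>c. g\<^sub>c c = exp_neg_gauge ((\<lambda>x. x - c) ` \<Delta>)"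
    and g: "g = exp_neg_gauge unit_cube"
  shows "(\<forall>c\<in>\<Delta>.
            integral_ratio f \<le> integral_ratio (g\<^sub>c c) \<and>
            (integral_ratio f = integral_ratio (g\<^sub>c c) \<longleftrightarrow>
               (\<exists>c'\<in>\<Delta>. \<exists>(A::real^'n^'n) b. invertible A \<and>
                  (\<lambda>x. f x / sup_norm f) = g\<^sub>c c' \<circ> (\<lambda>x. A *v x + b)))) \<and>
         ((\<forall>x. f (- x) = f x) \<longrightarrow>
            integral_ratio f \<le> integral_ratio g \<and>
            (integral_ratio f = integral_ratio g \<longleftrightarrow>
               (\<exists>A::real^'n^'n. invertible A \<and>
                  (\<lambda>x. f x / sup_norm f) = g \<circ> (\<lambda>x. A *v x))))"
  unfolding g\<^sub>c g
  using integral_ratio_simplex[OF \<Delta> f] integral_ratio_cube[OF f] by blast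

end
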